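(* Let $G=(V,E)$ be a finite, simple, connected reflective graph. Then $G$ is a cartesian product (of one or more factors) of graphs from the following list: cocktail party graphs $CP(k)$, Hamming graphs $K_n^m$, Johnson graphs $J(n,k)$, halved cubes, the Schläfli graph, the Gosset graph.
   Context: $d$ is the combinatorial distance. For adjacent $x\sim y$ let $V_x^y=\{v: d(v,x)<d(v,y)\}$, $V^{xy}=\{v:d(v,x)=d(v,y)\}$. A reflection from $x$ to $y$ is a graph automorphism $\phi$ with $\phi\circ\phi=\mathrm{id}$, $\phi(x)=y$, such that the edges between $V_x^y$ and $V_y^x$ are exactly $\{\{x',\phi(x')\}:x'\in V_x^y\}$ and $\phi$ fixes $V^{xy}$ pointwise. $G$ is reflective if every edge admits a reflection. $CP(k)$: $K_{2k}$ minus a perfect matching. Hamming graph $K_n^m$: cartesian product of $m$ copies of the complete graph $K_n$. $J(n,k)$: $k$-subsets of an $n$-set, adjacent iff sharing $k-1$ elements. Halved cube: even-weight binary strings of length $n$, adjacent iff differing in exactly two coordinates. Schläfli graph: srg$(27,16,10,8)$. Gosset graph: the 56-vertex 27-regular distance regular graph (1-skeleton of the $3_{21}$ polytope). Cartesian product: $(a,b)\sim(a',b')$ iff ($a=a'$, $b\sim b'$) or ($a\sim a'$, $b=b'$). *)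

theory Defs
  imports Main
begin

definition simple_graph :: "'a set \<Rightarrow> ('a \<Rightarrow> 'a \<Rightarrow> bool) \<Rightarrow> bool" where
  "simple_graph V E \<longleftrightarrow>
     (\<forall>x y. E x y \<longrightarrow> x \<in> V \<and> y \<in> V \<and> x \<noteq> y \<and> E y x)"

fun walk :: "'a set \<Rightarrow> ('a \<Rightarrow> 'a \<Rightarrow> bool) \<Rightarrow> nat \<Rightarrow> 'a \<Rightarrow> 'a \<Rightarrow> bool" where
  "walk V E 0 x y \<longleftrightarrow> x \<in> V \<and> x = y"
| "walk V E (Suc n) x y \<longleftrightarrow> x \<in> V \<and> (\<exists>z\<in>V. E x z \<and> walk V E n z y)"

definition connected_graph :: "'a set \<Rightarrow> ('a \<Rightarrow> 'a \<Rightarrow> bool) \<Rightarrow> bool" where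
  "connected_graph V E \<longleftrightarrow> V \<noteq> {} \<and> (\<forall>x\<in>V. \<forall>y\<in>V. \<exists>n. walk V E n x y)"

definition gdist :: "'a set \<Rightarrow> ('a \<Rightarrow> 'a \<Rightarrow> bool) \<Rightarrow> 'a \<Rightarrow> 'a \<Rightarrow> nat" where
  "gdist V E x y = (LEAST n. walk V E n x y)"

definition closer :: "'a set \<Rightarrow> ('a \<Rightarrow> 'a \<Rightarrow> bool) \<Rightarrow> 'a \<Rightarrow> 'a \<Rightarrow> 'a set" where
  "closer V E x y = {v \<in> V. gdist V E v x < gdist V E v y}"

definition is_automorphism :: "'a set \<Rightarrow> ('a \<Rightarrow> 'a \<Rightarrow> bool) \<Rightarrow> ('a \<Rightarrow> 'a) \<Rightarrow> bool" where
  "is_automorphism V E \<phi> \<longleftrightarrow> bij_betw \<phi> V V \<and> (\<forall>u\<in>V. \<forall>v\<in>V. E u v \<longleftrightarrow> E (\<phi> u) (\<phi> v))"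

text \<open>A reflection from x to y.  The condition on edges says that the set of edges
  between V_x^y and V_y^x is exactly {{x', phi x'} | x' in V_x^y}.\<close>
definition is_reflection :: "'a set \<Rightarrow> ('a \<Rightarrow> 'a \<Rightarrow> bool) \<Rightarrow> 'a \<Rightarrow> 'a \<Rightarrow> ('a \<Rightarrow> 'a) \<Rightarrow> bool" where
  "is_reflection V E x y \<phi> \<longleftrightarrow>
     is_automorphism V E \<phi> \<and>
     (\<forall>v\<in>V. \<phi> (\<phi> v) = v) \<and>
     \<phi> x = y \<and>
     (\<forall>a\<in>closer V E x y. \<phi> a \<in> closer V E y x \<and> E a (\<phi> a)) \<and>
     (\<forall>a\<in>closer V E x y. \<forall>b\<in>closer V E y x. E a b \<longrightarrow> b = \<phi> a) \<and>
     (\<forall>v\<in>V. gdist V E v x = gdist V E v y \<longrightarrow> \<phi> v = v)"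

definition reflective :: "'a set \<Rightarrow> ('a \<Rightarrow> 'a \<Rightarrow> bool) \<Rightarrow> bool" where
  "reflective V E \<longleftrightarrow> (\<forall>x\<in>V. \<forall>y\<in>V. E x y \<longrightarrow> (\<exists>\<phi>. is_reflection V E x y \<phi>))"

type_synonym 'b graph = "'b set \<times> ('b \<Rightarrow> 'b \<Rightarrow> bool)"

definition graph_iso :: "'a set \<Rightarrow> ('a \<Rightarrow> 'a \<Rightarrow> bool) \<Rightarrow> 'b set \<Rightarrow> ('b \<Rightarrow> 'b \<Rightarrow> bool) \<Rightarrow> bool" where
  "graph_iso V E W F \<longleftrightarrow>
     (\<exists>f. bij_betw f V W \<and> (\<forall>x\<in>V. \<forall>y\<in>V. E x y \<longleftrightarrow> F (f x) (f y)))"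

definition prod_V :: "'b graph list \<Rightarrow> 'b list set" where
  "prod_V fs = {xs. length xs = length fs \<and> (\<forall>i<length fs. xs ! i \<in> fst (fs ! i))}"

definition prod_E :: "'b graph list \<Rightarrow> 'b list \<Rightarrow> 'b list \<Rightarrow> bool" where
  "prod_E fs xs ys \<longleftrightarrow>
     (\<exists>i<length fs. snd (fs ! i) (xs ! i) (ys ! i) \<and>
        (\<forall>j<length fs. j \<noteq> i \<longrightarrow> xs ! j = ys ! j))"

definition hdist :: "int list \<Rightarrow> int list \<Rightarrow> nat" where
  "hdist xs ys = card {i. i < length xs \<and> xs ! i \<noteq> ys ! i}"

text \<open>Cocktail party graph CP(k): K_{2k} minus the perfect matching {2i,2i+1}.\<close>
definition cocktail_party :: "nat \<Rightarrow> int list graph" where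
  "cocktail_party k =
     ({[int i] | i. i < 2 * k},
      (\<lambda>u v. u \<in> {[int i] | i. i < 2 * k} \<and> v \<in> {[int i] | i. i < 2 * k} \<and>
             u \<noteq> v \<and> hd u div 2 \<noteq> hd v div 2))"

definition hamming_V :: "nat \<Rightarrow> nat \<Rightarrow> int list set" where
  "hamming_V n m = {xs. length xs = m \<and> (\<forall>i<m. 0 \<le> xs ! i \<and> xs ! i < int n)}"

definition hamming :: "nat \<Rightarrow> nat \<Rightarrow> int list graph" where
  "hamming n m = (hamming_V n m,
     (\<lambda>u v. u \<in> hamming_V n m \<and> v \<in> hamming_V n m \<and> hdist u v = 1))"

text \<open>Johnson graph J(n,k): k-subsets of {0..n-1}, represented by their characteristic
  0/1 vectors; two k-subsets share k-1 elements iff the vectors differ in exactly 2 places.\<close>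
definition johnson_V :: "nat \<Rightarrow> nat \<Rightarrow> int list set" where
  "johnson_V n k = {xs. length xs = n \<and> (\<forall>i<n. xs ! i \<in> {0, 1}) \<and>
                        card {i. i < n \<and> xs ! i = 1} = k}"

definition johnson :: "nat \<Rightarrow> nat \<Rightarrow> int list graph" where
  "johnson n k = (johnson_V n k,
     (\<lambda>u v. u \<in> johnson_V n k \<and> v \<in> johnson_V n k \<and> hdist u v = 2))"

definition halved_cube_V :: "nat \<Rightarrow> int list set" where
  "halved_cube_V n = {xs. length xs = n \<and> (\<forall>i<n. xs ! i \<in> {0, 1}) \<and>
                         even (card {i. i < n \<and> xs ! i = 1})}"

definition halved_cube :: "nat \<Rightarrow> int list graph" where
  "halved_cube n = (halved_cube_V n,
     (\<lambda>u v. u \<in> halved_cube_V n \<and> v \<in> halved_cube_V n \<and> hdist u v = 2))"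

definition srg :: "'b set \<Rightarrow> ('b \<Rightarrow> 'b \<Rightarrow> bool) \<Rightarrow> nat \<Rightarrow> nat \<Rightarrow> nat \<Rightarrow> nat \<Rightarrow> bool" where
  "srg V E nv k l m \<longleftrightarrow> simple_graph V E \<and> finite V \<and> card V = nv \<and>
     (\<forall>x\<in>V. card {z\<in>V. E x z} = k) \<and>
     (\<forall>x\<in>V. \<forall>y\<in>V. E x y \<longrightarrow> card {z\<in>V. E x z \<and> E y z} = l) \<and>
     (\<forall>x\<in>V. \<forall>y\<in>V. x \<noteq> y \<and> \<not> E x y \<longrightarrow> card {z\<in>V. E x z \<and> E y z} = m)"

text \<open>Schlaefli graph: (the unique) srg(27,16,10,8).\<close>
definition is_schlaefli :: "'b graph \<Rightarrow> bool" where
  "is_schlaefli G \<longleftrightarrow> srg (fst G) (snd G) 27 16 10 8"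

text \<open>Gosset graph (1-skeleton of the 3_21 polytope): the 56 vectors of R^8 that are
  permutations of (3,3,-1,-1,-1,-1,-1,-1) or of its negative; adjacent iff their inner
  product is 8.\<close>
definition gosset_V :: "int list set" where
  "gosset_V = {v. length v = 8 \<and>
     ((card {i. i < 8 \<and> v ! i = 3} = 2 \<and> (\<forall>i<8. v ! i \<in> {3, -1})) \<or>
      (card {i. i < 8 \<and> v ! i = -3} = 2 \<and> (\<forall>i<8. v ! i \<in> {-3, 1})))}"

definition gosset :: "int list graph" where
  "gosset = (gosset_V,
     (\<lambda>u v. u \<in> gosset_V \<and> v \<in> gosset_V \<and> (\<Sum>i<8. u ! i * v ! i) = 8))"

definition allowed_factor :: "int list graph \<Rightarrow> bool" where
  "allowed_factor G \<longleftrightarrow>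
     (\<exists>k. k \<ge> 1 \<and> G = cocktail_party k) \<or>
     (\<exists>n m. n \<ge> 1 \<and> m \<ge> 1 \<and> G = hamming n m) \<or>
     (\<exists>n k. k \<le> n \<and> G = johnson n k) \<or>
     (\<exists>n. n \<ge> 1 \<and> G = halved_cube n) \<or>
     is_schlaefli G \<or>
     G = gosset"

end

(* Let g_xy(v) = d(v,y) - d(v,x). A folding argument gives d(r v, z) = d(v,z) + g_xy(v) g_xy(z) for the
   reflection r in an edge xy, so reflective graphs behave like orbits of minuscule weights with edges
   as roots. Consequences of this identity:
   - the numbers g_xz(v), z adjacent to x, determine v, and the reflections in the edges at x act on them
     by a formula involving only the local graph at x; hence a reflective graph is determined by a local
     graph;
   - if a local graph is disconnected, the graph is a cartesian product of two smaller reflective graphs;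
   - if it is connected, it is an isometric reflective subgraph of diameter at most 2.
   By induction on the number of vertices a connected local graph is a product of graphs from the list,
   and diameter 2 leaves few cases: a product of two complete graphs (giving a Johnson graph), a cocktail
   party graph (giving a larger one), J(n,2) (giving the halved n-cube), the halved 5-cube (giving the
   Schlaefli graph) and the Schlaefli graph (giving the Gosset graph). Johnson graphs, halved
   cubes and the Gosset graph are reflective because they are sets of integer vectors closed under the
   reflections in their edges. *)
theory Submission
  imports Defs
begin

section \<open>Distances and reflections\<close>

text \<open>Reconstruction from a local graph is a uniqueness statement about two reflective graphs;
  it produces no graph. Each admissible local graph therefore needs an explicit reflective graph
  that has it, which is why models are realised by integer vectors. There the graph distance is the
  squared Euclidean distance in units of the squared edge length. The Schlaefli graph is taken as a
  local graph of the Gosset graph and inherits its reflectivity. Cocktail party graphs have no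
  vector model here: they are recognised directly, by spreading the local structure to all vertices
  and counting non-neighbours. Diameter 2 is restrictive because diameters add up in a product: at
  most two factors with an edge can occur, and two only if both are complete. A single factor is
  excluded by exhibiting two vertices that are too far apart. Hamming graphs form no case of their
  own, since K_n is J(n,1) and K_n^m splits into its factors. During the induction the one-vertex
  graph is the empty product.\<close>

lemma walk_ends: "walk V E n x y \<Longrightarrow> x \<in> V \<and> y \<in> V"
  by (induction n arbitrary: x) auto

lemma walk_append: "walk V E m x y \<Longrightarrow> walk V E n y z \<Longrightarrow> walk V E (m + n) x z"
  by (induction m arbitrary: x) auto

lemma walk_edge: "simple_graph V E \<Longrightarrow> E x y \<Longrightarrow> walk V E 1 x y"
  by (auto simp: simple_graph_def)

lemma walk_rev:
  assumes "simple_graph V E"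
  shows "walk V E n x y \<Longrightarrow> walk V E n y x"
proof (induction n arbitrary: x)
  case (Suc n)
  then obtain z where z: "E x z" "walk V E n z y" by auto
  have "walk V E 1 z x"
    using z(1) assms by (auto simp: simple_graph_def)
  then show ?case
    using walk_append[OF Suc.IH[OF z(2)]] by fastforce
qed auto

text \<open>Descending along \<open>step\<close> gives a walk of length \<open>D u v\<close>, and
  \<open>lip\<close> bounds \<open>D u v\<close> by the length of any walk. This criterion
  identifies distances under automorphisms, in subgraphs and in sets of vectors.\<close>

lemma graph_dist:
  fixes D :: "'a \<Rightarrow> 'a \<Rightarrow> nat"
  assumes refl: "\<And>v. v \<in> V \<Longrightarrow> D v v = 0"
    and sep: "\<And>u v. u \<in> V \<Longrightarrow> v \<in> V \<Longrightarrow> D u v = 0 \<Longrightarrow> u = v"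
    and lip: "\<And>u w v. u \<in> V \<Longrightarrow> w \<in> V \<Longrightarrow> v \<in> V \<Longrightarrow> E u w \<Longrightarrow> D u v \<le> Suc (D w v)"
    and step: "\<And>u v n. u \<in> V \<Longrightarrow> v \<in> V \<Longrightarrow> D u v = Suc n \<Longrightarrow> \<exists>w\<in>V. E u w \<and> D w v = n"
    and uv: "u \<in> V" "v \<in> V"
  shows "walk V E (D u v) u v" and "gdist V E u v = D u v"
proof -
  have w: "walk V E n u v" if "D u v = n" "u \<in> V" for n u
    using that
  proof (induction n arbitrary: u)
    case (Suc n)
    then show ?case using step[OF Suc.prems(2) uv(2) Suc.prems(1)] by auto
  qed (use sep uv in auto)
  have l: "D u v \<le> n" if "walk V E n u v" for n u
    using that
  proof (induction n arbitrary: u)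
    case (Suc n)
    then obtain z where z: "E u z" "walk V E n z v" "u \<in> V" "z \<in> V" by auto
    then show ?case using Suc.IH[of z] lip[of u z v] uv by auto
  qed (use refl in auto)
  show "walk V E (D u v) u v" using w uv by simp
  then show "gdist V E u v = D u v"
    unfolding gdist_def using l by (intro Least_equality) auto
qed

locale cgraph =
  fixes V :: "'a set" and E :: "'a \<Rightarrow> 'a \<Rightarrow> bool"
  assumes simple: "simple_graph V E" and conn: "connected_graph V E"
begin

abbreviation d where "d \<equiv> gdist V E"

lemma E_V: "E x y \<Longrightarrow> x \<in> V" "E x y \<Longrightarrow> y \<in> V"
  and E_neq: "E x y \<Longrightarrow> x \<noteq> y"
  and E_sym: "E x y \<Longrightarrow> E y x"
  using simple by (auto simp: simple_graph_def)

lemma d_walk: "x \<in> V \<Longrightarrow> y \<in> V \<Longrightarrow> walk V E (d x y) x y"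
  using conn unfolding connected_graph_def gdist_def by (metis LeastI_ex)

lemma d_le: "walk V E n x y \<Longrightarrow> d x y \<le> n"
  unfolding gdist_def by (rule Least_le)

lemma d_self [simp]: "x \<in> V \<Longrightarrow> d x x = 0"
  using d_le[of 0 x x] by simp

lemma d_0: "x \<in> V \<Longrightarrow> y \<in> V \<Longrightarrow> d x y = 0 \<longleftrightarrow> x = y"
  using d_walk[of x y] by auto

lemma d_sym: "x \<in> V \<Longrightarrow> y \<in> V \<Longrightarrow> d x y = d y x"
  by (metis d_le d_walk dual_order.antisym simple walk_rev)

lemma d_tri: "x \<in> V \<Longrightarrow> y \<in> V \<Longrightarrow> z \<in> V \<Longrightarrow> d x z \<le> d x y + d y z"
  by (meson d_le d_walk walk_append)

lemma d_1: "x \<in> V \<Longrightarrow> y \<in> V \<Longrightarrow> d x y = 1 \<longleftrightarrow> E x y"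
proof
  assume "x \<in> V" "y \<in> V" "d x y = 1"
  then show "E x y" using d_walk[of x y] by auto
next
  assume a: "x \<in> V" "y \<in> V" "E x y"
  then have "d x y \<le> 1" by (intro d_le walk_edge simple)
  then show "d x y = 1" using a d_0[of x y] E_neq[of x y] by linarith
qed

lemma d_E: "E x y \<Longrightarrow> d x y = 1"
  using d_1 E_V by blast

lemma d_lip: "E u w \<Longrightarrow> v \<in> V \<Longrightarrow> d u v \<le> Suc (d w v)"
  using d_tri[of u w v] d_E[of u w] E_V[of u w] by simp

lemma d_lip2: "E u w \<Longrightarrow> v \<in> V \<Longrightarrow> d v u \<le> Suc (d v w)"
  using d_lip d_sym E_V by metis

lemma d_step: "u \<in> V \<Longrightarrow> v \<in> V \<Longrightarrow> d u v = Suc n \<Longrightarrow> \<exists>w\<in>V. E u w \<and> d w v = n"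
proof -
  assume a: "u \<in> V" "v \<in> V" "d u v = Suc n"
  then obtain w where w: "w \<in> V" "E u w" "walk V E n w v"
    using d_walk[of u v] by auto
  have "d w v \<le> n" using d_le w by blast
  moreover have "Suc n \<le> Suc (d w v)" using d_lip[OF w(2) a(2)] a by simp
  ultimately show ?thesis using w by (intro bexI[of _ w]) auto
qed

lemma d_2:
  assumes "x \<in> V" "y \<in> V" "x \<noteq> y" "\<not> E x y" "E x w" "E w y"
  shows "d x y = 2"
proof -
  have "d x y \<noteq> 0" using d_0 assms by blast
  moreover have "d x y \<noteq> 1" using d_1 assms by blast
  moreover have "d x y \<le> 2" using d_lip[OF assms(5) assms(2)] d_E[OF assms(6)] by simp
  ultimately show ?thesis by linarith
qed

text \<open>The function \<open>d (f u) (f v)\<close> of \<open>u\<close> and \<open>v\<close> meets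
  the criterion \<open>graph_dist\<close>; surjectivity of \<open>f\<close> pulls a neighbour of
  \<open>f u\<close> nearer to \<open>f v\<close> back to a neighbour of \<open>u\<close>.\<close>

lemma auto_d:
  assumes "is_automorphism V E f" "u \<in> V" "v \<in> V"
  shows "d (f u) (f v) = d u v"
proof -
  have b: "bij_betw f V V" and e: "\<And>u v. u \<in> V \<Longrightarrow> v \<in> V \<Longrightarrow> E u v = E (f u) (f v)"
    using assms by (auto simp: is_automorphism_def)
  have fV: "f u \<in> V" if "u \<in> V" for u using b that by (auto simp: bij_betw_def)
  have inj: "f u = f v \<Longrightarrow> u = v" if "u \<in> V" "v \<in> V" for u v
    using b that by (auto simp: bij_betw_def inj_on_def)
  have "d u v = (\<lambda>u v. d (f u) (f v)) u v"
  proof (rule graph_dist(2))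
    fix u v n assume a: "u \<in> V" "v \<in> V" "d (f u) (f v) = Suc n"
    obtain w where w: "w \<in> V" "E (f u) w" "d w (f v) = n"
      using d_step[OF fV fV] a by blast
    obtain w' where "w' \<in> V" "w = f w'"
      using b w(1) by (auto simp: bij_betw_def)
    then show "\<exists>w\<in>V. E u w \<and> d (f w) (f v) = n" using w e a by blast
  next
    fix u w v assume "u \<in> V" "w \<in> V" "v \<in> V" "E u w"
    then show "d (f u) (f v) \<le> Suc (d (f w) (f v))" using d_lip e fV by blast
  qed (use assms fV inj d_0 in auto)
  then show ?thesis by simp
qed

end

section \<open>Folding along an edge and the distance formula for reflections\<close>

locale rgraph = cgraph +
  assumes reflective: "reflective V E"
begin

definition r where "r x y = (SOME \<phi>. is_reflection V E x y \<phi>)"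

lemma r_refl: "E x y \<Longrightarrow> is_reflection V E x y (r x y)"
  using reflective E_V unfolding r_def reflective_def by (metis someI_ex)

lemma r_auto: "E x y \<Longrightarrow> is_automorphism V E (r x y)"
  and r_r [simp]: "E x y \<Longrightarrow> v \<in> V \<Longrightarrow> r x y (r x y v) = v"
  and r_x [simp]: "E x y \<Longrightarrow> r x y x = y"
  and r_closer: "E x y \<Longrightarrow> v \<in> V \<Longrightarrow> d v x < d v y \<Longrightarrow> E v (r x y v)"
  and r_unique: "E x y \<Longrightarrow> v \<in> V \<Longrightarrow> w \<in> V \<Longrightarrow> d v x < d v y \<Longrightarrow> d w y < d w x \<Longrightarrow> E v w \<Longrightarrow> w = r x y v"
  and r_fix: "E x y \<Longrightarrow> v \<in> V \<Longrightarrow> d v x = d v y \<Longrightarrow> r x y v = v"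
  using r_refl[of x y] by (auto simp: is_reflection_def closer_def)

lemma r_V [simp]: "E x y \<Longrightarrow> v \<in> V \<Longrightarrow> r x y v \<in> V"
  using r_auto[of x y] by (auto simp: is_automorphism_def bij_betw_def)

lemma r_y [simp]: "E x y \<Longrightarrow> r x y y = x"
  by (metis E_V(1) r_r r_x)

lemma r_E: "E x y \<Longrightarrow> u \<in> V \<Longrightarrow> v \<in> V \<Longrightarrow> E (r x y u) (r x y v) \<longleftrightarrow> E u v"
  using r_auto[of x y] unfolding is_automorphism_def by blast

lemma r_d: "E x y \<Longrightarrow> u \<in> V \<Longrightarrow> v \<in> V \<Longrightarrow> d (r x y u) (r x y v) = d u v"
  using auto_d[OF r_auto] .

lemma r_d1: "E x y \<Longrightarrow> v \<in> V \<Longrightarrow> d (r x y v) x = d v y"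
  and r_d2: "E x y \<Longrightarrow> v \<in> V \<Longrightarrow> d (r x y v) y = d v x"
  using r_d[of x y v y] r_d[of x y v x] E_V by auto

text \<open>The map \<open>\<rho>\<close> folds the side of \<open>y\<close> onto the side of
  \<open>x\<close> and fixes everything else. An edge goes to an edge, or collapses if it joins the
  two sides, because such an edge joins a vertex to its mirror image. So walks do not get
  longer.\<close>

lemma fold_le:
  assumes xy: "E x y" and uv: "u \<in> V" "v \<in> V"
  defines "\<rho> \<equiv> \<lambda>v. if d v y < d v x then r x y v else v"
  shows "d (\<rho> u) (\<rho> v) \<le> d u v"
proof -
  have rV: "\<rho> w \<in> V" if "w \<in> V" for w
    using that xy by (auto simp: \<rho>_def)
  have edge: "d (\<rho> a) (\<rho> b) \<le> 1" if ab: "E a b" for a b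
  proof -
    have V: "a \<in> V" "b \<in> V" using E_V ab by auto
    have dab: "d a b \<le> 1" "d b a \<le> 1" using d_E E_sym ab by (metis order_refl)+
    have eq: "r x y b' = a'" if "a' \<in> V" "b' \<in> V" "d b' y < d b' x" "d a' x < d a' y" "E a' b'" for a' b'
      using r_unique[OF xy, of a' b'] that xy by auto
    consider "d a y < d a x" "d b y < d b x" | "d a y < d a x" "d b y = d b x" | "d a y < d a x" "d b y > d b x"
      | "\<not> d a y < d a x" "\<not> d b y < d b x" | "d b y < d b x" "d a y = d a x" | "d b y < d b x" "d a y > d a x"
      by linarith
    then show ?thesis
    proof cases
      case 1 then show ?thesis using r_d[OF xy] V dab by (simp add: \<rho>_def)
    next
      case 2 then show ?thesis using r_d[OF xy, of a b] r_fix[OF xy, of b] V dab by (simp add: \<rho>_def)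
    next
      case 3 then show ?thesis using eq[of b a] V ab E_sym by (simp add: \<rho>_def)
    next
      case 4 then show ?thesis using dab by (simp add: \<rho>_def)
    next
      case 5 then show ?thesis using r_d[OF xy, of a b] r_fix[OF xy, of a] V dab by (simp add: \<rho>_def)
    next
      case 6 then show ?thesis using eq[of a b] V ab by (simp add: \<rho>_def)
    qed
  qed
  have "d (\<rho> u) (\<rho> v) \<le> n" if "walk V E n u v" for n u
    using that
  proof (induction n arbitrary: u)
    case 0 then show ?case using d_self[OF rV[OF uv(2)]] by auto
  next
    case (Suc n)
    then obtain z where z: "E u z" "walk V E n z v" by auto
    then have "d (\<rho> u) (\<rho> v) \<le> d (\<rho> u) (\<rho> z) + d (\<rho> z) (\<rho> v)"
      using d_tri rV E_V uv by blast
    then show ?case using edge[OF z(1)] Suc.IH[OF z(2)] by linarith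
  qed
  then show ?thesis using d_walk uv by blast
qed

text \<open>If the inequality from folding were an equality, the reflection in the edge from u to
  r x y u would fix v and exchange x and y, so v would be equidistant from x and y.\<close>
lemma cross_dist:
  assumes xy: "E x y" and V: "u \<in> V" "v \<in> V" and u: "d u x < d u y" and v: "d v x < d v y"
  shows "d (r x y u) v = Suc (d u v)"
proof -
  let ?u = "r x y u"
  have uE: "E u ?u" using r_closer xy V u by blast
  have V': "?u \<in> V" "x \<in> V" "y \<in> V" using E_V uE xy by auto
  have le: "d ?u v \<le> Suc (d u v)" using d_lip E_sym uE V by blast
  \<comment> \<open>Folding sends \<open>r x y u\<close>, which is nearer to \<open>y\<close>, back
    to \<open>u\<close>, and it fixes \<open>v\<close>.\<close>
  have "d (r x y (r x y u)) v \<le> d ?u v"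
    using fold_le[OF xy V'(1) V(2)] u v V xy by (simp add: r_d1 r_d2)
  then have ge: "d u v \<le> d ?u v" using xy V by simp
  have False if eq: "d ?u v = d u v"
  proof -
    have x: "d x u < d x ?u" using r_d2[OF xy V(1)] r_d1[OF xy V(1)] u d_sym V V' by metis
    have y: "d y ?u < d y u" using r_d2[OF xy V(1)] u d_sym V V' by metis
    \<comment> \<open>The edge from \<open>x\<close> to \<open>y\<close> crosses from the side of
      \<open>u\<close> to the side of \<open>r x y u\<close>, and a crossing edge joins mirror
      images.\<close>
    have 1: "y = r u ?u x" using r_unique[OF uE _ _ x y xy] V' by blast
    have 2: "r u ?u v = v" using r_fix[OF uE V(2)] eq d_sym V V' by metis
    have "d v x = d v y" using r_d[OF uE V(2) V'(2)] 1 2 by simp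
    then show False using v by simp
  qed
  then show ?thesis using le ge by (metis le_SucE le_antisym)
qed

text \<open>If distance is half the squared Euclidean distance and all vertices have the same norm,
  this is the inner product of \<open>v\<close> with the root \<open>x - y\<close>.\<close>

definition g where "g x y v = int (d v y) - int (d v x)"

lemma g_cases: "E x y \<Longrightarrow> v \<in> V \<Longrightarrow> g x y v = 1 \<or> g x y v = 0 \<or> g x y v = - 1"
  using d_lip2[of x y v] d_lip2[of y x v] E_sym[of x y] unfolding g_def by linarith

lemma g_x: "E x y \<Longrightarrow> g x y x = 1"
  using d_E E_V d_self by (simp add: g_def)

lemma g_r: "E x y \<Longrightarrow> v \<in> V \<Longrightarrow> g x y (r x y v) = - g x y v"
  by (simp add: g_def r_d1 r_d2)

text \<open>Corresponds to the formula for a reflection in a root of norm 2, with half the squared norm as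
  distance.\<close>
theorem r_dist:
  assumes xy: "E x y" and V: "v \<in> V" "z \<in> V"
  shows "int (d (r x y v) z) = int (d v z) + g x y v * g x y z"
proof -
  \<comment> \<open>This is \<open>cross_dist\<close>. The other sign patterns reduce to it by
    replacing \<open>v\<close> or \<open>z\<close> with its mirror image, which flips the sign of
    \<open>g\<close>.\<close>
  have pos: "int (d (r x y v) z) = int (d v z) + 1" if "g x y v = 1" "g x y z = 1" "v \<in> V" "z \<in> V" for v z
    using cross_dist[OF xy that(3,4)] that by (simp add: g_def)
  let ?v = "r x y v" and ?z = "r x y z"
  have V': "?v \<in> V" "?z \<in> V" using xy V by auto
  have eq: "d ?v ?z = d v z" "d ?v z = d v ?z"
    using r_d[OF xy V] r_d[OF xy V(1) V'(2)] xy V by auto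
  have fixv: "?v = v" if "g x y v = 0" using r_fix[OF xy V(1)] that by (simp add: g_def)
  have fixz: "?z = z" if "g x y z = 0" using r_fix[OF xy V(2)] that by (simp add: g_def)
  have gg: "g x y ?v = - g x y v" "g x y ?z = - g x y z" using g_r xy V by auto
  consider "g x y v = 0" | "g x y z = 0" | "g x y v = 1" "g x y z = 1" | "g x y v = 1" "g x y z = -1"
    | "g x y v = -1" "g x y z = 1" | "g x y v = -1" "g x y z = -1"
    using g_cases[OF xy V(1)] g_cases[OF xy V(2)] by auto
  then show ?thesis
  proof cases
    case 1 then show ?thesis using fixv by simp
  next
    case 2 then show ?thesis using fixz eq by simp
  next
    case 3 then show ?thesis using pos V by simp
  next
    case 4
    then have "int (d ?v ?z) = int (d v ?z) + 1" using pos gg V' V by simp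
    then show ?thesis using 4 eq by simp
  next
    case 5
    then have "int (d (r x y ?v) z) = int (d ?v z) + 1" using pos gg V' V by simp
    then show ?thesis using 5 xy V by simp
  next
    case 6
    then have "int (d (r x y ?v) ?z) = int (d ?v ?z) + 1" using pos gg V' V by simp
    then show ?thesis using 6 xy V eq by simp
  qed
qed

text \<open>For z ranging over the neighbours of x, these are coordinates of the vertex v.\<close>
definition F where "F x v z = int (d v z) - int (d v x)"

text \<open>For a neighbour \<open>z\<close> of \<open>x\<close>, \<open>g x y z\<close> is
  \<open>d y z - 1\<close>, while \<open>g x y x\<close> is 1; subtracting two instances of
  \<open>r_dist\<close> leaves the factor \<open>d y z - 2\<close>. In particular a reflection in
  the edge to \<open>y\<close> leaves the coordinates at neighbours at distance 2 from
  \<open>y\<close> unchanged.\<close>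

lemma F_r:
  assumes "E x y" "E x z" "v \<in> V"
  shows "F x (r x y v) z = F x v z + F x v y * (int (d y z) - 2)"
proof -
  have V: "x \<in> V" "y \<in> V" "z \<in> V" using E_V assms by auto
  have gz: "g x y z = int (d y z) - 1"
    using d_E[OF E_sym[OF assms(2)]] d_sym V by (simp add: g_def)
  have "F x v y = g x y v" by (simp add: F_def g_def)
  then show ?thesis
    unfolding F_def[of _ _ z] F_def[of _ "r x y v"] r_dist[OF assms(1,3) V(3)] r_dist[OF assms(1,3) V(1)]
      gz g_x[OF assms(1)] by (simp add: algebra_simps)
qed

lemma connected_induct [consumes 2, case_names base step]:
  assumes "x \<in> V" "v \<in> V" "P x" "\<And>u w. E u w \<Longrightarrow> P u \<Longrightarrow> P w"
  shows "P v"
proof -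
  have "P u \<longrightarrow> P v" if "walk V E n u v" for n u
    using that
  proof (induction n arbitrary: u)
    case (Suc n) then show ?case using assms(4) by auto
  qed auto
  then show ?thesis using d_walk assms by blast
qed

lemma r_nbr: "E u w \<Longrightarrow> E w z \<Longrightarrow> E u (r u w z) \<and> r u w (r u w z) = z"
  using r_E[of u w w z] E_V by auto

text \<open>The coordinates at a neighbour are an affine function of those at x, so agreement spreads to
  every base point; then the difference of the distances to u and to v is constant.\<close>
lemma F_inj:
  assumes x: "x \<in> V" and u: "u \<in> V" and v: "v \<in> V" and eq: "\<And>z. E x z \<Longrightarrow> F x u z = F x v z"
  shows "u = v"
proof -
  have all: "\<forall>z. E w z \<longrightarrow> F w u z = F w v z" if "w \<in> V" for w
    using x that
  proof (induction rule: connected_induct)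
    case (step s w)
    show ?case
    proof (intro allI impI)
      fix z assume z: "E w z"
      let ?z = "r s w z"
      have z': "E s ?z" "r s w ?z = z" using r_nbr step z by auto
      have tr: "F w t z = F s (r s w t) ?z" if "t \<in> V" for t
        using r_d[OF step(1) that] r_d[OF step(1) that, of w] step(1) E_V[OF z] E_V[OF step(1)]
        unfolding F_def by simp
      show "F w u z = F w v z"
        unfolding tr[OF u] tr[OF v] F_r[OF step(1) z'(1) u] F_r[OF step(1) z'(1) v]
        using step z' by simp
    qed
  qed (use eq in auto)
  have "int (d u w) - int (d v w) = int (d u x) - int (d v x)" if "w \<in> V" for w
    using x that
  proof (induction rule: connected_induct)
    case (step s w)
    then show ?case using all[of s] E_V[OF step(1)] unfolding F_def by fastforce
  qed simp
  \<comment> \<open>The constant equals \<open>- d v u\<close> at \<open>w = u\<close> and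
    \<open>d u v\<close> at \<open>w = v\<close>, so it vanishes.\<close>
  from this[OF u] this[OF v] have "d u v = 0" using u v by simp
  then show ?thesis using d_0 u v by blast
qed

text \<open>By \<open>r_dist\<close> both sides have the same distance to every vertex
  \<open>t\<close>; choosing one side as \<open>t\<close> makes this distance 0.\<close>

lemma r_conj:
  assumes E: "E x y" "E x z" and v: "v \<in> V"
  shows "r y (r x y z) v = r x y (r x z (r x y v))"
proof -
  let ?s = "r x y"
  have V: "x \<in> V" "y \<in> V" "z \<in> V" using E E_V by auto
  have E': "E y (?s z)" using r_E[OF E(1) V(1) V(3)] E by simp
  have gg: "g x z (?s t) = g y (?s z) t" if "t \<in> V" for t
    using r_d[OF E(1) that, of "?s z"] r_d[OF E(1) that, of y] E V that unfolding g_def by simp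
  let ?a = "?s (r x z (?s v))"
  have aV: "?a \<in> V" using E v by simp
  have "int (d ?a t) = int (d (r y (?s z) v) t)" if t: "t \<in> V" for t
  proof -
    have "d ?a t = d (r x z (?s v)) (?s t)"
      using r_d[OF E(1), of "r x z (?s v)" "?s t"] E v t by simp
    also have "int \<dots> = int (d (?s v) (?s t)) + g x z (?s v) * g x z (?s t)"
      using r_dist E v t by simp
    also have "\<dots> = int (d (r y (?s z) v) t)"
      using r_dist[OF E' v t] gg v t r_d[OF E(1) v t] by simp
    finally show ?thesis .
  qed
  from this[OF aV] have "d (r y (?s z) v) ?a = 0" using aV by simp
  then show ?thesis using d_0 aV E' v by simp
qed

text \<open>The vertex set is the orbit of \<open>x\<close> under the reflections in the edges at
  \<open>x\<close> alone. By \<open>r_conj\<close> a reflection at a neighbour of \<open>s\<close>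
  is a product of three reflections at \<open>s\<close>, so closure of \<open>P\<close> spreads from
  base point to base point; and a neighbour \<open>w\<close> of \<open>u\<close> is
  \<open>r u w u\<close>.\<close>

lemma generation [consumes 2, case_names base step]:
  assumes x: "x \<in> V" and v: "v \<in> V" and P: "P x"
    and step: "\<And>y u. E x y \<Longrightarrow> u \<in> V \<Longrightarrow> P u \<Longrightarrow> P (r x y u)"
  shows "P v"
proof -
  have cl: "\<forall>y u. E w y \<longrightarrow> u \<in> V \<longrightarrow> P u \<longrightarrow> P (r w y u)" if "w \<in> V" for w
    using x that
  proof (induction rule: connected_induct)
    case (step s w)
    show ?case
    proof (intro allI impI)
      fix y u assume a: "E w y" "u \<in> V" "P u"
      let ?y = "r s w y"
      have y: "E s ?y" "r s w ?y = y" using r_nbr step a by auto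
      have "P (r s w (r s ?y (r s w u)))" using step a y by simp
      then show "P (r w y u)" using r_conj[OF step(1) y(1) a(2)] y by simp
    qed
  qed (use step in auto)
  show ?thesis
    using x v
  proof (induction rule: connected_induct)
    case (step u w) then show ?case using cl[of u] E_V[OF step(1)] step r_x by metis
  qed (rule P)
qed

lemma F_base: "E x z \<Longrightarrow> F x x z = 1"
  using d_E E_V by (simp add: F_def)

lemma F_nbr: "E x y \<Longrightarrow> E x z \<Longrightarrow> F x y z = int (d y z) - 1"
  using d_E E_sym by (simp add: F_def)

lemma nbr_d:
  assumes "E x y" "E x z"
  shows "d y z = (if y = z then 0 else if E y z then 1 else 2)"
  using d_2[OF E_V(2)[OF assms(1)] E_V(2)[OF assms(2)] _ _ E_sym[OF assms(1)] assms(2)]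
    d_E[of y z] d_self[OF E_V(2)[OF assms(1)]] by presburger

end

section \<open>Reconstruction from a local graph\<close>

text \<open>\<open>T\<close> relates vertices with matching coordinates. It holds for the base
  points, and \<open>F_r\<close> shows that corresponding reflections on both sides preserve it, so
  \<open>generation\<close> reaches every vertex. Edges are matched at \<open>x\<close> and then
  carried along by the reflections. The two-sided inverse \<open>\<tau>\<close> keeps the hypotheses
  symmetric, so the lemma can be applied in both directions.\<close>

lemma local_iso_edge:
  assumes A: "rgraph V E" and B: "rgraph V' E'"
    and x: "x \<in> V" "x' \<in> V'"
    and s: "\<forall>y. E x y \<longrightarrow> E' x' (\<sigma> y) \<and> \<tau> (\<sigma> y) = y"
    and t: "\<forall>y. E' x' y \<longrightarrow> E x (\<tau> y) \<and> \<sigma> (\<tau> y) = y"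
    and adj: "\<forall>y z. E x y \<longrightarrow> E x z \<longrightarrow> (E y z \<longleftrightarrow> E' (\<sigma> y) (\<sigma> z))"
  defines "T \<equiv> \<lambda>v v'. \<forall>z. E x z \<longrightarrow> rgraph.F V E x v z = rgraph.F V' E' x' v' (\<sigma> z)"
  shows "v \<in> V \<Longrightarrow> \<exists>v'\<in>V'. T v v'"
    and "E u w \<Longrightarrow> u' \<in> V' \<Longrightarrow> w' \<in> V' \<Longrightarrow> T u u' \<Longrightarrow> T w w' \<Longrightarrow> E' u' w'"
proof -
  interpret A: rgraph V E by fact
  interpret B: rgraph V' E' by fact
  have dd: "A.d y z = B.d (\<sigma> y) (\<sigma> z)" if "E x y" "E x z" for y z
  proof -
    have "\<sigma> y = \<sigma> z \<longleftrightarrow> y = z" using s that by metis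
    then show ?thesis
      using A.nbr_d[OF that] B.nbr_d[of x' "\<sigma> y" "\<sigma> z"] s that adj by simp
  qed
  have Tr: "T (A.r x y v) (B.r x' (\<sigma> y) v')" if "T v v'" "v \<in> V" "v' \<in> V'" "E x y" for y v v'
    unfolding T_def
  proof (intro allI impI)
    fix z assume z: "E x z"
    show "A.F x (A.r x y v) z = B.F x' (B.r x' (\<sigma> y) v') (\<sigma> z)"
      using A.F_r[OF that(4) z that(2)] B.F_r[of x' "\<sigma> y" "\<sigma> z" v'] s that(4) z that(3) dd[OF that(4) z] that(1)
      unfolding T_def by simp
  qed
  have Tx: "T x x'" unfolding T_def using A.F_base B.F_base s by simp
  show "\<exists>v'\<in>V'. T v v'" if "v \<in> V" for v
    using x(1) that
  proof (induction rule: A.generation)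
    case (step y u)
    then obtain u' where "u' \<in> V'" "T u u'" by blast
    then show ?case using Tr step s B.r_V by blast
  qed (use Tx x in auto)
  have inj: "u' = w'" if "T u u'" "T u w'" "u' \<in> V'" "w' \<in> V'" for u u' w'
  proof (rule B.F_inj[OF x(2) that(3,4)])
    fix z assume z: "E' x' z"
    then show "B.F x' u' z = B.F x' w' z"
      using that(1,2) t z unfolding T_def by metis
  qed
  have "\<forall>w u' w'. E u w \<longrightarrow> u' \<in> V' \<longrightarrow> w' \<in> V' \<longrightarrow> T u u' \<longrightarrow> T w w' \<longrightarrow> E' u' w'" if "u \<in> V" for u
    using x(1) that
  proof (induction rule: A.generation)
    case base
    show ?case
    proof (intro allI impI)
      fix w u' w' assume a: "E x w" "u' \<in> V'" "w' \<in> V'" "T x u'" "T w w'"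
      have "T w (\<sigma> w)"
        using A.F_nbr[OF a(1)] B.F_nbr[of x' "\<sigma> w"] s a dd[OF a(1)] unfolding T_def by simp
      then have "w' = \<sigma> w" using inj a s B.E_V by blast
      moreover have "u' = x'" using inj a Tx x by blast
      ultimately show "E' u' w'" using s a by simp
    qed
  next
    case (step y u)
    show ?case
    proof (intro allI impI)
      fix w u' w' assume a: "E (A.r x y u) w" "u' \<in> V'" "w' \<in> V'" "T (A.r x y u) u'" "T w w'"
      have wV: "w \<in> V" using A.E_V a by blast
      have e: "E u (A.r x y w)"
        using A.r_E[OF step(1), of "A.r x y u" w] a(1) step(1,2) wV by simp
      have y': "E' x' (\<sigma> y)" using s step by blast
      let ?r = "B.r x' (\<sigma> y)"
      have "T u (?r u')" using Tr[OF a(4) _ a(2) step(1)] step by simp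
      moreover have "T (A.r x y w) (?r w')" using Tr[OF a(5) wV a(3) step(1)] by simp
      ultimately have "E' (?r u') (?r w')" using step(3) e a y' B.r_V by blast
      then show "E' u' w'" using B.r_E[OF y' a(2,3)] by simp
    qed
  qed
  then show "E u w \<Longrightarrow> u' \<in> V' \<Longrightarrow> w' \<in> V' \<Longrightarrow> T u u' \<Longrightarrow> T w w' \<Longrightarrow> E' u' w'"
    using A.E_V by blast
qed

text \<open>The relation \<open>T\<close> is total in both directions by
  \<open>local_iso_edge\<close>, and \<open>F_inj\<close> on either side makes it single-valued and
  injective; the isomorphism is the function with graph \<open>T\<close>.\<close>

theorem local_iso_extends:
  assumes A: "rgraph V E" and B: "rgraph V' E'"
    and x: "x \<in> V" "x' \<in> V'"
    and bij: "bij_betw \<sigma> {y. E x y} {y. E' x' y}"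
    and adj: "\<And>y z. E x y \<Longrightarrow> E x z \<Longrightarrow> E y z \<longleftrightarrow> E' (\<sigma> y) (\<sigma> z)"
  shows "graph_iso V E V' E'"
proof -
  interpret A: rgraph V E by fact
  interpret B: rgraph V' E' by fact
  define \<tau> where "\<tau> = inv_into {y. E x y} \<sigma>"
  have s: "\<forall>y. E x y \<longrightarrow> E' x' (\<sigma> y) \<and> \<tau> (\<sigma> y) = y"
    using bij by (auto simp: bij_betw_def \<tau>_def)
  have t: "\<forall>y. E' x' y \<longrightarrow> E x (\<tau> y) \<and> \<sigma> (\<tau> y) = y"
    using bij bij_betw_inv_into[OF bij] bij_betw_inv_into_right[OF bij]
    by (auto simp: bij_betw_def \<tau>_def)
  have adj0: "\<forall>y z. E x y \<longrightarrow> E x z \<longrightarrow> (E y z \<longleftrightarrow> E' (\<sigma> y) (\<sigma> z))"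
    using adj by blast
  have adj': "\<forall>y z. E' x' y \<longrightarrow> E' x' z \<longrightarrow> (E' y z \<longleftrightarrow> E (\<tau> y) (\<tau> z))"
    using adj t by metis
  define T where "T v v' \<longleftrightarrow> (\<forall>z. E x z \<longrightarrow> A.F x v z = B.F x' v' (\<sigma> z))" for v v'
  have T': "T v v' \<longleftrightarrow> (\<forall>z. E' x' z \<longrightarrow> B.F x' v' z = A.F x v (\<tau> z))" for v v'
    unfolding T_def using s t by metis
  note m = local_iso_edge[OF A B x s t adj0, folded T_def]
  note m' = local_iso_edge[OF B A x(2,1) t s adj', folded T']
  have inj: "u = w" if "T u u'" "T w u'" "u \<in> V" "w \<in> V" for u w u'
    using A.F_inj[OF x(1) that(3,4)] that(1,2) unfolding T_def by simp
  have inj': "u' = w'" if "T u u'" "T u w'" "u' \<in> V'" "w' \<in> V'" for u u' w'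
    using B.F_inj[OF x(2) that(3,4)] that(1,2) unfolding T' by simp
  define f where "f v = (SOME v'. v' \<in> V' \<and> T v v')" for v
  have f: "f v \<in> V' \<and> T v (f v)" if "v \<in> V" for v
    unfolding f_def by (rule someI_ex) (use m(1)[OF that] in blast)
  have "bij_betw f V V'"
  proof (rule bij_betw_imageI)
    show "inj_on f V" by (rule inj_onI) (metis f inj)
    show "f ` V = V'"
    proof (intro equalityI subsetI)
      fix v' assume v': "v' \<in> V'"
      then obtain v where "v \<in> V" "T v v'" using m'(1) by blast
      then have "f v = v'" using inj' f v' by blast
      then show "v' \<in> f ` V" using \<open>v \<in> V\<close> by blast
    qed (use f in auto)
  qed
  moreover have "E u w \<longleftrightarrow> E' (f u) (f w)" if "u \<in> V" "w \<in> V" for u w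
    using m(2)[of u w "f u" "f w"] m'(2)[of "f u" "f w" u w] f[OF that(1)] f[OF that(2)] that by blast
  ultimately show ?thesis unfolding graph_iso_def by blast
qed

section \<open>Isometric subgraphs and connected local graphs\<close>

definition E_on :: "('a \<Rightarrow> 'a \<Rightarrow> bool) \<Rightarrow> 'a set \<Rightarrow> 'a \<Rightarrow> 'a \<Rightarrow> bool" where
  "E_on E S u v \<longleftrightarrow> u \<in> S \<and> v \<in> S \<and> E u v"

context rgraph
begin

text \<open>\<open>step\<close> makes \<open>S\<close> isometric by \<open>graph_dist\<close>. The
  sides of an edge of \<open>S\<close> are then the traces on \<open>S\<close> of its sides in
  \<open>V\<close>, and a reflection preserving \<open>S\<close> restricts to a reflection.\<close>

lemma isometric_subgraph:
  assumes "S \<subseteq> V" "S \<noteq> {}"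
    and step: "\<And>u v n. u \<in> S \<Longrightarrow> v \<in> S \<Longrightarrow> d u v = Suc n \<Longrightarrow> \<exists>w\<in>S. E u w \<and> d w v = n"
    and refl: "\<And>a b v. a \<in> S \<Longrightarrow> b \<in> S \<Longrightarrow> E a b \<Longrightarrow> v \<in> S \<Longrightarrow> r a b v \<in> S"
  shows "rgraph S (E_on E S)"
proof -
  have gd: "walk S (E_on E S) (d u v) u v" "gdist S (E_on E S) u v = d u v" if "u \<in> S" "v \<in> S" for u v
  proof -
    have *: "d v v = 0" if "v \<in> S" for v using assms(1) that by auto
    have **: "u = v" if "u \<in> S" "v \<in> S" "d u v = 0" for u v
      using d_0[of u v] assms(1) that by auto
    have ***: "d u v \<le> Suc (d w v)" if "u \<in> S" "w \<in> S" "v \<in> S" "E_on E S u w" for u v w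
      using d_lip[of u w v] assms(1) that by (auto simp: E_on_def)
    have ****: "\<exists>w\<in>S. E_on E S u w \<and> d w v = n" if "u \<in> S" "v \<in> S" "d u v = Suc n" for u v n
      using step[OF that] that by (auto simp: E_on_def)
    show "walk S (E_on E S) (d u v) u v"
      by (rule graph_dist(1)) (fact * ** *** **** that)+
    show "gdist S (E_on E S) u v = d u v"
      by (rule graph_dist(2)) (fact * ** *** **** that)+
  qed
  show ?thesis
  proof
    show "simple_graph S (E_on E S)"
      using simple by (auto simp: simple_graph_def E_on_def)
    show "connected_graph S (E_on E S)"
      unfolding connected_graph_def using assms(2) gd by blast
    show "Defs.reflective S (E_on E S)"
      unfolding reflective_def
    proof (intro ballI impI)
      fix a b assume ab: "a \<in> S" "b \<in> S" "E_on E S a b"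
      then have e: "E a b" by (simp add: E_on_def)
      have rS: "r a b v \<in> S" if "v \<in> S" for v using refl ab e that by blast
      have rr: "r a b (r a b v) = v" if "v \<in> S" for v using r_r e that assms(1) by blast
      have cl: "v \<in> closer S (E_on E S) y z \<longleftrightarrow> v \<in> S \<and> d v y < d v z" if "y \<in> S" "z \<in> S" for v y z
        using gd that by (auto simp: closer_def)
      have rd: "d (r a b v) b < d (r a b v) a \<longleftrightarrow> d v a < d v b" if "v \<in> S" for v
        using r_d1[OF e] r_d2[OF e] that assms(1) by auto
      have "bij_betw (r a b) S S"
        by (rule bij_betw_byWitness[where f'="r a b"]) (use rS rr in auto)
      moreover have "E_on E S u v \<longleftrightarrow> E_on E S (r a b u) (r a b v)" if "u \<in> S" "v \<in> S" for u v
        using r_E[OF e, of u v] rS that assms(1) by (auto simp: E_on_def)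
      ultimately have aut: "is_automorphism S (E_on E S) (r a b)"
        unfolding is_automorphism_def by blast
      have "is_reflection S (E_on E S) a b (r a b)"
        unfolding is_reflection_def
      proof (intro conjI ballI impI)
        fix v assume "v \<in> closer S (E_on E S) a b"
        then have v: "v \<in> S" "v \<in> V" "d v a < d v b" using cl[OF ab(1,2)] assms(1) by auto
        show "r a b v \<in> closer S (E_on E S) b a" using v rS rd cl ab by simp
        show "E_on E S v (r a b v)" using v rS r_closer[OF e] by (simp add: E_on_def)
        fix w assume "w \<in> closer S (E_on E S) b a" and vw: "E_on E S v w"
        then have "w \<in> V" "d w b < d w a" using cl[OF ab(2,1)] assms(1) by auto
        then show "w = r a b v" using r_unique[OF e v(2) _ v(3)] vw by (simp add: E_on_def)
      next
        fix v assume "v \<in> S" "gdist S (E_on E S) v a = gdist S (E_on E S) v b"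
        then show "r a b v = v" using r_fix[OF e, of v] gd ab assms(1) by auto
      qed (use aut rr r_x[OF e] in auto)
      then show "\<exists>\<phi>. is_reflection S (E_on E S) a b \<phi>" by blast
    qed
  qed
qed

text \<open>Along an induced path y, w, u, z in the local graph, the reflection in the edge from w to u moves
  y to a common neighbour of y and z.\<close>
lemma local_diameter:
  assumes con: "connected_graph {y. E x y} (E_on E {y. E x y})"
    and y: "E x y" and z: "E x z" and n: "y \<noteq> z" "\<not> E y z"
  shows "\<exists>w. E x w \<and> E y w \<and> E w z"
proof -
  let ?P = "\<lambda>z. y = z \<or> E y z \<or> (\<exists>w. E x w \<and> E y w \<and> E w z)"
  have st: "?P z" if zz: "E u z" "E x u" "E x z" "?P u" for u z
  proof (cases "y = u \<or> E y u \<or> y = z \<or> E y z")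
    case True then show ?thesis using that by blast
  next
    case False
    then obtain w where w: "E x w" "E y w" "E w u" using zz(4) by blast
    show ?thesis
    proof (cases "E w z \<or> w = z")
      case True then show ?thesis using w by auto
    next
      case wz: False
      have Vs: "y \<in> V" "u \<in> V" "z \<in> V" "w \<in> V" "x \<in> V" using E_V y that w by auto
      let ?y = "r w u y"
      have gy: "g w u y = 1" using nbr_d[OF y that(2)] nbr_d[OF y w(1)] False w E_neq[OF w(2)] by (simp add: g_def)
      have gz: "g w u z = - 1"
        using nbr_d[OF that(3,2)] nbr_d[OF that(3) w(1)] E_sym[of z w] E_sym[OF that(1)] wz E_neq[OF that(1)]
        by (auto simp: g_def)
      have 1: "E y ?y" using r_closer[OF w(3) Vs(1)] gy by (simp add: g_def)
      \<comment> \<open>\<open>x\<close> is equidistant from its neighbours \<open>w\<close> and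
        \<open>u\<close>, so it is fixed and the image of \<open>y\<close> is again a neighbour of
        \<open>x\<close>.\<close>
      have "r w u x = x"
        using r_fix[OF w(3) Vs(5)] d_E w(1) that(2) by simp
      then have 2: "E x ?y" using r_E[OF w(3) Vs(5) Vs(1)] y by simp
      have "int (d ?y z) = int (d y z) - 1" using r_dist[OF w(3) Vs(1) Vs(3)] gy gz by simp
      moreover have "d y z = 2" using nbr_d[OF y that(3)] False by simp
      ultimately have "d ?y z = 1" by simp
      then have "E ?y z" using d_1 Vs E_V 2 by blast
      then show ?thesis using 1 2 by blast
    qed
  qed
  have wk: "?P b" if "walk {y. E x y} (E_on E {y. E x y}) n a b" "?P a" for n a b
    using that
  proof (induction n arbitrary: a)
    case (Suc n)
    then obtain w where w: "E_on E {y. E x y} a w" "walk {y. E x y} (E_on E {y. E x y}) n w b" by auto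
    then have "?P w" using st[of a w] Suc.prems(2) by (simp add: E_on_def)
    then show ?case using Suc.IH[OF w(2)] by blast
  qed simp
  then have "?P z" using con y z unfolding connected_graph_def by blast
  then show ?thesis using n by blast
qed

text \<open>Neighbours of \<open>x\<close> are at distance at most 2, and
  \<open>local_diameter\<close> joins those at distance 2 inside the local graph, so it is
  isometric. A reflection in an edge between neighbours of \<open>x\<close> fixes \<open>x\<close>
  and hence preserves its neighbourhood.\<close>

lemma local_rgraph:
  assumes con: "connected_graph {y. E x y} (E_on E {y. E x y})"
  shows "rgraph {y. E x y} (E_on E {y. E x y})"
proof (rule isometric_subgraph)
  show "{y. E x y} \<subseteq> V" using E_V by blast
  show "{y. E x y} \<noteq> {}" using con by (simp add: connected_graph_def)
next
  fix u v n assume a: "u \<in> {y. E x y}" "v \<in> {y. E x y}" "d u v = Suc n"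
  then have uv: "E x u" "E x v" by auto
  show "\<exists>w\<in>{y. E x y}. E u w \<and> d w v = n"
  proof (cases "E u v")
    case True
    then show ?thesis using a d_E[OF True] E_V[OF True] by (intro bexI[of _ v]) auto
  next
    case False
    have ne: "u \<noteq> v" using a E_V(2)[OF uv(1)] by auto
    then obtain w where w: "E x w" "E u w" "E w v" using local_diameter[OF con uv] False by blast
    have "d u v = 2" using nbr_d[OF uv] ne False by simp
    then show ?thesis using a(3) w d_E by (intro bexI[of _ w]) auto
  qed
next
  fix a b v assume "a \<in> {y. E x y}" "b \<in> {y. E x y}" "E a b" "v \<in> {y. E x y}"
  then have a: "E x a" "E x b" "E a b" "E x v" by auto
  have "r a b x = x" using r_fix[OF a(3)] d_E a E_V by simp
  then have "E x (r a b v)" using r_E[OF a(3), of x v] E_V a by simp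
  then show "r a b v \<in> {y. E x y}" by simp
qed

end

section \<open>Product decomposition\<close>

text \<open>\<open>C1\<close> and \<open>C2\<close> are unions of components of the local graph at
  \<open>x\<close>. The coordinates of a vertex split into two blocks accordingly, and each factor
  will consist of the vertices sharing one block with \<open>x\<close>.\<close>

locale split_rgraph = rgraph V E for V :: "'a set" and E +
  fixes x :: 'a and C1 C2 :: "'a set"
  assumes x: "x \<in> V"
    and nbr: "E x y \<longleftrightarrow> y \<in> C1 \<or> y \<in> C2"
    and sep: "y \<in> C1 \<Longrightarrow> z \<in> C2 \<Longrightarrow> y \<noteq> z \<and> \<not> E y z"
begin

lemma C_E: "y \<in> C1 \<Longrightarrow> E x y" "y \<in> C2 \<Longrightarrow> E x y"
  using nbr by auto

lemma C_d: "y \<in> C1 \<Longrightarrow> z \<in> C2 \<Longrightarrow> d y z = 2" "y \<in> C1 \<Longrightarrow> z \<in> C2 \<Longrightarrow> d z y = 2"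
  using nbr_d[of x y z] nbr_d[of x z y] C_E sep E_sym by metis+

definition agree where "agree C u v \<longleftrightarrow> (\<forall>z\<in>C. F x u z = F x v z)"

lemma agree_sym: "agree C u v \<Longrightarrow> agree C v u"
  and agree_trans: "agree C u v \<Longrightarrow> agree C v w \<Longrightarrow> agree C u w"
  and agree_self [simp]: "agree C u u"
  by (auto simp: agree_def)

lemma agree_eq: "u \<in> V \<Longrightarrow> v \<in> V \<Longrightarrow> agree C1 u v \<Longrightarrow> agree C2 u v \<Longrightarrow> u = v"
  using F_inj[OF x] nbr unfolding agree_def by blast

text \<open>Neighbours from different blocks are at distance 2, where the correction factor in
  \<open>F_r\<close> is 0: a reflection acts on the block of its own edge only.\<close>

lemma agree_other1: "y \<in> C2 \<Longrightarrow> u \<in> V \<Longrightarrow> agree C1 (r x y u) u"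
  and agree_other2: "y \<in> C1 \<Longrightarrow> u \<in> V \<Longrightarrow> agree C2 (r x y u) u"
  using F_r C_E C_d unfolding agree_def by auto

lemma agree_r: "E x y \<Longrightarrow> C = C1 \<or> C = C2 \<Longrightarrow> u \<in> V \<Longrightarrow> v \<in> V \<Longrightarrow> agree C u v \<Longrightarrow> agree C (r x y u) (r x y v)"
proof (cases "y \<in> C")
  case True
  assume "E x y" "C = C1 \<or> C = C2" "u \<in> V" "v \<in> V" "agree C u v"
  then show ?thesis using True F_r[of x y] C_E unfolding agree_def by auto
next
  case False
  assume a: "E x y" "C = C1 \<or> C = C2" "u \<in> V" "v \<in> V" "agree C u v"
  have "agree C (r x y w) w" if "w \<in> V" for w
    using False a(1,2) nbr agree_other1 agree_other2 that by blast
  then show ?thesis using a agree_sym agree_trans by meson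
qed

text \<open>Following the generation of \<open>u\<close> from \<open>x\<close> with only the
  reflections in \<open>C1\<close> gives the case \<open>t = x\<close>; following the generation of
  \<open>t\<close> with only those in \<open>C2\<close> then adjusts the second block.\<close>

lemma combine_ex:
  assumes "u \<in> V" "t \<in> V"
  shows "\<exists>v\<in>V. agree C1 v u \<and> agree C2 v t"
proof -
  have 1: "\<exists>v\<in>V. agree C1 v u \<and> agree C2 v x" if "u \<in> V" for u
    using x that
  proof (induction rule: generation)
    case base then show ?case using x agree_self by blast
  next
    case (step y u)
    then obtain v where v: "v \<in> V" "agree C1 v u" "agree C2 v x" by blast
    show ?case
    proof (cases "y \<in> C1")
      case True
      have "agree C1 (r x y v) (r x y u)" using agree_r step v by blast
      moreover have "agree C2 (r x y v) x" using agree_other2[OF True v(1)] v(3) agree_trans by blast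
      ultimately show ?thesis using step v r_V by blast
    next
      case False
      then have "agree C1 u (r x y u)" using agree_other1 step nbr agree_sym by blast
      then show ?thesis using v agree_trans by blast
    qed
  qed
  show ?thesis
    using x assms(2)
  proof (induction rule: generation)
    case base then show ?case using 1 assms by blast
  next
    case (step y t)
    then obtain v where v: "v \<in> V" "agree C1 v u" "agree C2 v t" by blast
    show ?case
    proof (cases "y \<in> C2")
      case True
      have "agree C2 (r x y v) (r x y t)" using agree_r step v by blast
      moreover have "agree C1 (r x y v) u" using agree_other1[OF True v(1)] v(2) agree_trans by blast
      ultimately show ?thesis using step v r_V by blast
    next
      case False
      then have "agree C2 t (r x y t)" using agree_other2 step nbr agree_sym by blast
      then show ?thesis using v agree_trans by blast
    qed
  qed
qed

text \<open>The product coordinates: \<open>c v x\<close> and \<open>c x v\<close> are the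
  projections of \<open>v\<close> to the two factors.\<close>

definition c where "c u t = (SOME v. v \<in> V \<and> agree C1 v u \<and> agree C2 v t)"

lemma c: "u \<in> V \<Longrightarrow> t \<in> V \<Longrightarrow> c u t \<in> V \<and> agree C1 (c u t) u \<and> agree C2 (c u t) t"
  unfolding c_def by (rule someI_ex) (use combine_ex in blast)

lemma c_eqI: "u \<in> V \<Longrightarrow> t \<in> V \<Longrightarrow> v \<in> V \<Longrightarrow> agree C1 v u \<Longrightarrow> agree C2 v t \<Longrightarrow> c u t = v"
  using c[of u t] agree_eq[of "c u t" v] agree_trans agree_sym by meson

lemma c_self: "u \<in> V \<Longrightarrow> c u u = u"
  using c_eqI by simp

lemma c_cong: "u \<in> V \<Longrightarrow> u' \<in> V \<Longrightarrow> t \<in> V \<Longrightarrow> t' \<in> V \<Longrightarrow> agree C1 u u' \<Longrightarrow> agree C2 t t' \<Longrightarrow> c u t = c u' t'"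
  using c[of u' t'] c_eqI[of u t "c u' t'"] agree_trans agree_sym by meson

lemma c_r2: "y \<in> C2 \<Longrightarrow> u \<in> V \<Longrightarrow> t \<in> V \<Longrightarrow> c u (r x y t) = r x y (c u t)"
  using c_eqI[of u "r x y t" "r x y (c u t)"] c[of u t] agree_r[of y C2 "c u t" t]
    agree_other1[of y "c u t"] agree_trans C_E r_V by meson

lemma c_r1: "y \<in> C1 \<Longrightarrow> u \<in> V \<Longrightarrow> t \<in> V \<Longrightarrow> c (r x y u) t = r x y (c u t)"
  using c_eqI[of "r x y u" t "r x y (c u t)"] c[of u t] agree_r[of y C1 "c u t" u]
    agree_other2[of y "c u t"] agree_trans C_E r_V by meson

text \<open>A neighbour of \<open>x\<close> in one part has coordinate 1 throughout the other part,
  exactly like \<open>x\<close>. Reflections preserve both edges and agreement, which carries this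
  to all vertices.\<close>

lemma edge_agree:
  assumes "E u v"
  shows "agree C1 u v \<or> agree C2 u v"
proof -
  have "\<forall>v. E u v \<longrightarrow> agree C1 u v \<or> agree C2 u v" if "u \<in> V" for u
    using x that
  proof (induction rule: generation)
    case base
    show ?case
      using F_base F_nbr C_E C_d nbr unfolding agree_def by fastforce
  next
    case (step y u)
    show ?case
    proof (intro allI impI)
      fix v assume e: "E (r x y u) v"
      have vV: "v \<in> V" using e E_V by blast
      have e': "E u (r x y v)" using r_E[OF step(1), of "r x y u" v] e step vV by simp
      then have "agree C1 u (r x y v) \<or> agree C2 u (r x y v)" using step by blast
      then show "agree C1 (r x y u) v \<or> agree C2 (r x y u) v"
        using agree_r[OF step(1) _ step(2) E_V(2)[OF e']] r_r[OF step(1) vV] by metis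
    qed
  qed
  then show ?thesis using assms E_V by blast
qed

text \<open>Generate \<open>t\<close> from \<open>x\<close>: a reflection in \<open>C2\<close>
  passes through \<open>c\<close> in its second argument and preserves edges, one in
  \<open>C1\<close> does not affect the second block. So edges in the first direction may be
  transported along the second.\<close>

lemma edge_move2:
  assumes "u \<in> V" "v \<in> V" "t \<in> V"
  shows "E (c u t) (c v t) \<longleftrightarrow> E (c u x) (c v x)"
  using x assms(3)
proof (induction rule: generation)
  case (step y t)
  show ?case
  proof (cases "y \<in> C2")
    case True
    then show ?thesis using c_r2 step assms r_E c by simp
  next
    case False
    then have "agree C2 (r x y t) t" using step nbr agree_other2 by blast
    then have "c w (r x y t) = c w t" if "w \<in> V" for w
      using c_cong[OF that that r_V[OF step(1,2)] step(2) agree_self] by blast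
    then show ?thesis using step assms by simp
  qed
qed simp

lemma edge_move1:
  assumes "u \<in> V" "v \<in> V" "t \<in> V"
  shows "E (c t u) (c t v) \<longleftrightarrow> E (c x u) (c x v)"
  using x assms(3)
proof (induction rule: generation)
  case (step y t)
  show ?case
  proof (cases "y \<in> C1")
    case True
    then show ?thesis using c_r1 step assms r_E c by simp
  next
    case False
    then have "agree C1 (r x y t) t" using step nbr agree_other1 by blast
    then have "c (r x y t) w = c t w" if "w \<in> V" for w
      using c_cong[OF r_V[OF step(1,2)] step(2) that that _ agree_self] by blast
    then show ?thesis using step assms by simp
  qed
qed simp

definition S1 where "S1 = {v \<in> V. agree C2 v x}"
definition S2 where "S2 = {v \<in> V. agree C1 v x}"

lemma c_S: "v \<in> V \<Longrightarrow> c v x \<in> S1" "v \<in> V \<Longrightarrow> c x v \<in> S2"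
  using c x by (auto simp: S1_def S2_def)

text \<open>If \<open>u\<close> and \<open>v\<close> share the second block, they are
  \<open>c u u\<close> and \<open>c v u\<close>, and \<open>edge_move2\<close> replaces the common
  second argument by \<open>x\<close>. Sharing the first block is symmetric, and
  \<open>edge_agree\<close> says that an edge has one of these forms.\<close>

lemma edge_factors:
  assumes u: "u \<in> V" and v: "v \<in> V"
  shows "E u v \<longleftrightarrow> E (c u x) (c v x) \<and> c x u = c x v \<or> c u x = c v x \<and> E (c x u) (c x v)"
proof
  assume e: "E u v"
  show "E (c u x) (c v x) \<and> c x u = c x v \<or> c u x = c v x \<and> E (c x u) (c x v)"
    using edge_agree[OF e]
  proof
    assume "agree C1 u v"
    then have 1: "c u x = c v x" "c u v = v" using c_cong[of u v] c_self u v x agree_sym agree_self by metis+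
    then have "E (c u u) (c u v)" using e c_self u by simp
    then show ?thesis using edge_move1 u v 1 by blast
  next
    assume "agree C2 u v"
    then have 1: "c x u = c x v" "c v u = v" using c_cong[of _ _ u v] c_self u v x agree_sym agree_self by metis+
    then have "E (c u u) (c v u)" using e c_self u by simp
    then show ?thesis using edge_move2 u v 1 by blast
  qed
next
  assume "E (c u x) (c v x) \<and> c x u = c x v \<or> c u x = c v x \<and> E (c x u) (c x v)"
  then show "E u v"
  proof
    assume a: "E (c u x) (c v x) \<and> c x u = c x v"
    then have "agree C2 u v" using c[OF x u] c[OF x v] agree_trans agree_sym by metis
    then have "c v u = v" using c_cong[of v v u v] c_self u v by simp
    then show ?thesis using edge_move2[OF u v u] a c_self[OF u] by simp
  next
    assume a: "c u x = c v x \<and> E (c x u) (c x v)"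
    then have "agree C1 u v" using c[OF u x] c[OF v x] agree_trans agree_sym by metis
    then have "c u v = v" using c_cong[of u v v v] c_self u v by simp
    then show ?thesis using edge_move1[OF u v u] a c_self[OF u] by simp
  qed
qed

lemma factor_bij: "bij_betw (\<lambda>v. (c v x, c x v)) V (S1 \<times> S2)"
proof (rule bij_betw_imageI)
  show "inj_on (\<lambda>v. (c v x, c x v)) V"
  proof (rule inj_onI)
    fix u v assume uv: "u \<in> V" "v \<in> V" "(c u x, c x u) = (c v x, c x v)"
    then have "agree C1 u v" "agree C2 u v"
      using c[OF _ x] c[OF x] agree_trans agree_sym by (metis prod.inject)+
    then show "u = v" using agree_eq uv by blast
  qed
  show "(\<lambda>v. (c v x, c x v)) ` V = S1 \<times> S2"
  proof (intro equalityI subsetI)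
    fix p assume "p \<in> S1 \<times> S2"
    then obtain a b where p: "p = (a, b)" "a \<in> V" "agree C2 a x" "b \<in> V" "agree C1 b x"
      by (auto simp: S1_def S2_def)
    have ab: "c a b \<in> V" "agree C1 (c a b) a" "agree C2 (c a b) b" using c p by auto
    have "c (c a b) x = a" "c x (c a b) = b"
      using c_eqI[of "c a b" x a] c_eqI[of x "c a b" b] ab p x agree_sym by auto
    then show "p \<in> (\<lambda>v. (c v x, c x v)) ` V" using ab p by force
  qed (use c_S in auto)
qed

text \<open>By \<open>edge_factors\<close> the projection turns an edge into an edge or a single
  vertex.\<close>

lemma proj_le: "u \<in> V \<Longrightarrow> v \<in> V \<Longrightarrow> d (c u x) (c v x) \<le> d u v"
proof -
  assume uv: "u \<in> V" "v \<in> V"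
  have cV: "c w x \<in> V" if "w \<in> V" for w using c x that by blast
  have "d (c u x) (c v x) \<le> n" if "walk V E n u v" for n u
    using that
  proof (induction n arbitrary: u)
    case 0
    then show ?case using d_self[OF cV[OF uv(2)]] by auto
  next
    case (Suc n)
    then obtain z where z: "u \<in> V" "z \<in> V" "E u z" "walk V E n z v" by auto
    then have "c u x = c z x \<or> E (c u x) (c z x)" using edge_factors by blast
    then have "d (c u x) (c v x) \<le> Suc (d (c z x) (c v x))" using d_lip cV uv by fastforce
    then show ?case using Suc.IH[OF z(4)] by linarith
  qed
  then show ?thesis using d_walk uv by blast
qed

lemma rgraph_S1: "rgraph S1 (E_on E S1)"
proof (rule isometric_subgraph)
  show "S1 \<subseteq> V" "S1 \<noteq> {}" using x by (auto simp: S1_def)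
next
  fix u v n assume a: "u \<in> S1" "v \<in> S1" "d u v = Suc n"
  then have V: "u \<in> V" "v \<in> V" "agree C2 u x" "agree C2 v x" by (auto simp: S1_def)
  have cu: "c u x = u" "c v x = v" using c_eqI V x by auto
  obtain w where w: "w \<in> V" "E u w" "d w v = n" using d_step V a by blast
  show "\<exists>w\<in>S1. E u w \<and> d w v = n"
    using edge_agree[OF w(2)]
  proof
    \<comment> \<open>A step out of \<open>S1\<close> projects back to \<open>u\<close>, so
      projecting the rest of the shortest path would give \<open>d u v\<close> at most
      \<open>n\<close>.\<close>
    assume "agree C1 u w"
    then have "c w x = u" using c_cong[of u w x x] w V x cu by simp
    then have "d u v \<le> n" using proj_le[OF w(1) V(2)] cu w by simp
    then show ?thesis using a by simp
  next
    assume "agree C2 u w"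
    then have "agree C2 w x" using V agree_sym agree_trans by blast
    then show ?thesis using w by (auto simp: S1_def)
  qed
next
  fix a b v assume a: "a \<in> S1" "b \<in> S1" "E a b" "v \<in> S1"
  then have V: "a \<in> V" "b \<in> V" "v \<in> V" by (auto simp: S1_def)
  \<comment> \<open>The last factor does not depend on \<open>t\<close>. For \<open>t = a\<close>
    the left side is \<open>F x b z - F x a z\<close>, which is 0 for \<open>z\<close> in
    \<open>C2\<close>, and \<open>g a b a\<close> is 1; hence that factor is 0 and the coordinates
    of \<open>v\<close> in \<open>C2\<close> stay fixed too.\<close>
  have eq: "F x (r a b t) z - F x t z = g a b t * (g a b z - g a b x)" if "t \<in> V" "z \<in> V" for t z
    using r_dist[OF a(3) that] r_dist[OF a(3) that(1) x] unfolding F_def by (simp add: algebra_simps)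
  have "F x (r a b v) z = F x x z" if "z \<in> C2" for z
  proof -
    have zV: "z \<in> V" using that C_E E_V by blast
    have "F x a z = F x x z" "F x b z = F x x z" "F x v z = F x x z"
      using a that by (auto simp: S1_def agree_def)
    then show ?thesis using eq[OF V(1) zV] eq[OF V(3) zV] g_x[OF a(3)] a(3) by simp
  qed
  then show "r a b v \<in> S1" using a V by (simp add: S1_def agree_def)
qed

lemma S1_psubset: "C2 \<noteq> {} \<Longrightarrow> S1 \<subset> V"
proof -
  assume "C2 \<noteq> {}"
  then obtain z where z: "z \<in> C2" by blast
  have zV: "z \<in> V" using z C_E E_V by blast
  have "F x z z = -1" using F_nbr C_E z zV by simp
  moreover have "F x x z = 1" using F_base C_E z by simp
  ultimately have "F x z z \<noteq> F x x z" by simp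
  then have "z \<notin> S1" using z unfolding S1_def agree_def by blast
  then show ?thesis using zV by (auto simp: S1_def)
qed

lemma swap: "split_rgraph V E x C2 C1"
  by unfold_locales (use x nbr sep E_sym in blast)+

end

lemma (in split_rgraph) swap_S: "split_rgraph.S1 V E x C1 = S2"
proof -
  interpret s: split_rgraph V E x C2 C1 by (rule swap)
  show ?thesis unfolding s.S1_def S2_def s.agree_def agree_def ..
qed

context split_rgraph
begin

lemma rgraph_S2: "rgraph S2 (E_on E S2)"
  and S2_psubset: "C1 \<noteq> {} \<Longrightarrow> S2 \<subset> V"
  using split_rgraph.rgraph_S1[OF swap] split_rgraph.S1_psubset[OF swap] swap_S by auto

end

section \<open>Reflective sets of vectors\<close>

definition qd :: "nat \<Rightarrow> int list \<Rightarrow> int list \<Rightarrow> int" where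
  "qd N u v = (\<Sum>i<N. (u ! i - v ! i)\<^sup>2)"

text \<open>This is \<open>u - (a - b)\<close>: the image of \<open>u\<close> under the reflection
  exchanging \<open>a\<close> and \<open>b\<close>, when \<open>u\<close> lies on the side of
  \<open>a\<close> at the only possible nonzero height.\<close>

definition translate :: "nat \<Rightarrow> int list \<Rightarrow> int list \<Rightarrow> int list \<Rightarrow> int list" where
  "translate N u a b = map (\<lambda>i. u ! i - a ! i + b ! i) [0..<N]"

lemma length_translate [simp]: "length (translate N u a b) = N"
  and nth_translate [simp]: "i < N \<Longrightarrow> translate N u a b ! i = u ! i - a ! i + b ! i"
  by (simp_all add: translate_def)

lemma qd_sym: "qd N u v = qd N v u"
  by (simp add: qd_def power2_commute)

lemma qd_nonneg: "qd N u v \<ge> 0"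
  by (simp add: qd_def sum_nonneg)

lemma qd_0: "length u = N \<Longrightarrow> length v = N \<Longrightarrow> qd N u v = 0 \<longleftrightarrow> u = v"
  by (auto simp: qd_def sum_nonneg_eq_0_iff intro: nth_equalityI)

definition ip where "ip N u v a b = (\<Sum>i<N. (u ! i - v ! i) * (a ! i - b ! (i::nat)))" for u v a b :: "int list"

lemma qd_ip: "2 * ip N u v a b = (qd N u b - qd N u a) - (qd N v b - qd N v a)"
  unfolding ip_def qd_def sum_distrib_left sum_subtractf [symmetric]
  by (intro sum.cong refl) (simp add: power2_eq_square algebra_simps)

text \<open>For \<open>ip N u v a b = c * (s - t)\<close> and \<open>qd N a b = 2 * c\<close> the
  two correction terms cancel: moving every vector by its own multiple of the root is then an
  isometry.\<close>

lemma qd_moved: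
  assumes "\<And>i. i < N \<Longrightarrow> u' ! i = u ! i - s * (a ! i - b ! i)" "\<And>i. i < N \<Longrightarrow> v' ! i = v ! i - t * (a ! i - b ! i)"
  shows "qd N u' v' = qd N u v - 2 * (s - t) * ip N u v a b + (s - t)\<^sup>2 * qd N a b"
  unfolding ip_def qd_def sum_distrib_left sum_subtractf [symmetric] sum.distrib [symmetric]
  by (intro sum.cong refl) (simp add: assms power2_eq_square algebra_simps)

text \<open>The affine function qd N u b - qd N u a of u is twice the inner product of u with the edge
  vector a - b, up to a constant.\<close>
lemma vector_rgraph:
  fixes W :: "int list set" and c :: int
  assumes len: "\<And>u. u \<in> W \<Longrightarrow> length u = N" and c: "c > 0" and ne: "W \<noteq> {}"
    and R: "\<And>a b u. a \<in> W \<Longrightarrow> b \<in> W \<Longrightarrow> u \<in> W \<Longrightarrow> qd N a b = 2 * c \<Longrightarrow> qd N u b - qd N u a \<in> {- 2 * c, 0, 2 * c}"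
    and T: "\<And>a b u. a \<in> W \<Longrightarrow> b \<in> W \<Longrightarrow> u \<in> W \<Longrightarrow> qd N a b = 2 * c \<Longrightarrow> qd N u b - qd N u a = 2 * c \<Longrightarrow> translate N u a b \<in> W"
    and G: "\<And>u v. u \<in> W \<Longrightarrow> v \<in> W \<Longrightarrow> u \<noteq> v \<Longrightarrow> \<exists>w\<in>W. qd N u w = 2 * c \<and> qd N w v = qd N u v - 2 * c"
  shows "rgraph W (\<lambda>u v. u \<in> W \<and> v \<in> W \<and> qd N u v = 2 * c)" (is "rgraph W ?E")
proof -
  let ?q = "qd N"
  \<comment> \<open>The candidate for the graph distance. The division is exact: by \<open>G\<close>
    one can descend to 0 lowering the squared distance by \<open>2 * c\<close> each time.\<close>
  define D where "D u v = nat (?q u v div (2 * c))" for u v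
  have dv: "2 * c dvd ?q u v" if "u \<in> W" "v \<in> W" for u v
    using that
  proof (induction "nat (?q u v)" arbitrary: u rule: less_induct)
    case less
    show ?case
    proof (cases "u = v")
      case True then show ?thesis using qd_0[of v N v] len[of v] less.prems by simp
    next
      case False
      then obtain w where w: "w \<in> W" "?q w v = ?q u v - 2 * c" using G less.prems by blast
      then have "2 * c dvd ?q w v"
        using c qd_nonneg[of N w v] by (intro less.hyps[OF _ w(1) less.prems(2)]) linarith
      then show ?thesis using w(2) by (metis diff_add_cancel dvd_add dvd_refl)
    qed
  qed
  have Dq: "?q u v = 2 * c * int (D u v)" if "u \<in> W" "v \<in> W" for u v
    using dv[OF that] qd_nonneg[of N u v] c by (simp add: D_def pos_imp_zdiv_nonneg_iff)
  have D_eq: "D u v = n" if "u \<in> W" "v \<in> W" "?q u v = 2 * c * int n" for u v n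
    using Dq[OF that(1,2)] that(3) c by simp
  have gd: "walk W ?E (D u v) u v" "gdist W ?E u v = D u v" if "u \<in> W" "v \<in> W" for u v
  proof -
    have 1: "D v v = 0" if "v \<in> W" for v using D_eq[OF that that, of 0] qd_0 len that by simp
    have 2: "u = v" if "u \<in> W" "v \<in> W" "D u v = 0" for u v
      using Dq[OF that(1,2)] that(3) qd_0[OF len[OF that(1)] len[OF that(2)]] by simp
    have 3: "D u v \<le> Suc (D w v)" if "u \<in> W" "w \<in> W" "v \<in> W" "?E u w" for u w v
    proof -
      \<comment> \<open>The Lipschitz condition is \<open>R\<close> for the edge from
        \<open>u\<close> to \<open>w\<close>, evaluated at \<open>v\<close>.\<close>
      have "?q v u \<le> ?q v w + 2 * c" using R[of u w v] that c by auto
      then have "2 * c * int (D u v) \<le> 2 * c * int (Suc (D w v))"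
        using Dq[of u v] Dq[of w v] that qd_sym[of N v] by (simp add: algebra_simps)
      then show ?thesis using c by simp
    qed
    have 4: "\<exists>w\<in>W. ?E u w \<and> D w v = n" if a: "u \<in> W" "v \<in> W" "D u v = Suc n" for u v n
    proof -
      have "u \<noteq> v" using 1 a by auto
      then obtain w where w: "w \<in> W" "?q u w = 2 * c" "?q w v = ?q u v - 2 * c" using G a by blast
      then have "D w v = n" using D_eq[of w v n] Dq[of u v] a by (simp add: algebra_simps)
      then show ?thesis using w a by blast
    qed
    show "walk W ?E (D u v) u v"
      by (rule graph_dist(1)) (fact 1 2 3 4 that)+
    show "gdist W ?E u v = D u v"
      by (rule graph_dist(2)) (fact 1 2 3 4 that)+
  qed
  show ?thesis
  proof
    show "simple_graph W ?E"
      using qd_sym[of N] c qd_0[of _ N] len by (fastforce simp: simple_graph_def)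
    show "connected_graph W ?E" using gd(1) ne unfolding connected_graph_def by blast
    show "reflective W ?E"
      unfolding reflective_def
    proof (intro ballI impI)
      fix a b assume W: "a \<in> W" "b \<in> W" and e: "?E a b"
      then have ab: "?q a b = 2 * c" by simp
      define t where "t u = ?q u b - ?q u a" for u
      \<comment> \<open>\<open>s u\<close> plays the role of \<open>g a b u\<close>; the reflection
        is \<open>u - s u (a - b)\<close>, and \<open>T\<close> keeps it inside
        \<open>W\<close>.\<close>
      define s where "s u = (if t u = 2 * c then 1 else if t u = - 2 * c then - 1 else (0::int))" for u
      define f where "f u = (if t u = 2 * c then translate N u a b else if t u = - 2 * c then translate N u b a else u)" for u
      have t3: "t u = 2 * c \<or> t u = 0 \<or> t u = - 2 * c" if "u \<in> W" for u
        using R[OF W that ab] by (auto simp: t_def)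
      have ts: "t u = 2 * c * s u" if "u \<in> W" for u using t3[OF that] c by (auto simp: s_def)
      have fW: "f u \<in> W" if "u \<in> W" for u
        using T[OF W that ab] T[OF W(2,1) that] ab qd_sym[of N a b] that by (auto simp: f_def t_def)
      have fn: "f u ! i = u ! i - s u * (a ! i - b ! i)" if "u \<in> W" "i < N" for u i
        using that c by (auto simp: f_def s_def)
      have ip: "ip N u v a b = c * (s u - s v)" if "u \<in> W" "v \<in> W" for u v
        using qd_ip[of N u v a b] ts that by (simp add: t_def algebra_simps)
      have fq: "?q (f u) (f v) = ?q u v" if "u \<in> W" "v \<in> W" for u v
        using qd_moved[of N "f u" u "s u" a b "f v" v "s v"] fn that ip ab by (simp add: power2_eq_square algebra_simps)
      have ta: "t a = 2 * c" "t b = - 2 * c" using ab W qd_sym[of N a b] qd_0 len by (auto simp: t_def)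
      have fa: "f a = b" using ta len W by (auto simp: f_def intro!: nth_equalityI)
      have fb: "f b = a" using ta len W c by (auto simp: f_def intro!: nth_equalityI)
      have tf: "t (f u) = - t u" if "u \<in> W" for u
        using fq[OF that W(1)] fq[OF that W(2)] fa fb by (simp add: t_def)
      have sf: "s (f u) = - s u" if "u \<in> W" for u
      proof -
        have "2 * c * s (f u) = 2 * c * (- s u)" using ts[of u] ts[of "f u"] fW[of u] tf[of u] that by simp
        then show ?thesis using c by (metis mult_cancel_left mult_eq_0_iff order_less_irrefl zero_neq_numeral)
      qed
      have ff: "f (f u) = u" if "u \<in> W" for u
        by (rule nth_equalityI) (use fn fW that sf len in auto)
      have cl: "v \<in> closer W ?E a b \<longleftrightarrow> v \<in> W \<and> t v = 2 * c"
        and cl': "v \<in> closer W ?E b a \<longleftrightarrow> v \<in> W \<and> t v = - 2 * c" for v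
      proof -
        have "D v a < D v b \<longleftrightarrow> t v > 0" "D v b < D v a \<longleftrightarrow> t v < 0" if "v \<in> W"
          using Dq[OF that W(1)] Dq[OF that W(2)] c unfolding t_def by auto
        then show "v \<in> closer W ?E a b \<longleftrightarrow> v \<in> W \<and> t v = 2 * c" "v \<in> closer W ?E b a \<longleftrightarrow> v \<in> W \<and> t v = - 2 * c"
          using t3[of v] c gd W by (auto simp: closer_def)
      qed
      have "bij_betw f W W" by (rule bij_betw_byWitness[where f' = f]) (use fW ff in auto)
      then have aut: "is_automorphism W ?E f" using fq fW by (simp add: is_automorphism_def)
      have "is_reflection W ?E a b f"
        unfolding is_reflection_def
      proof (intro conjI ballI impI)
        fix v assume "v \<in> closer W ?E a b"
        then have v: "v \<in> W" "t v = 2 * c" using cl by auto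
        then have sv: "s v = 1" by (simp add: s_def)
        show "f v \<in> closer W ?E b a" using v cl' fW tf by simp
        have "?q v (f v) = 2 * c"
          using qd_moved[of N v v 0 a b "f v" v "s v"] fn v sv ip[OF v(1,1)] ab
            qd_0[of v N v] len[of v] by simp
        then show "v \<in> W" "f v \<in> W" "?q v (f v) = 2 * c" using v fW by simp_all
        fix w assume "w \<in> closer W ?E b a" and vw: "?E v w"
        then have w: "w \<in> W" "t w = - 2 * c" using cl' by auto
        then have sw: "s w = - 1" using c by (simp add: s_def)
        \<comment> \<open>Here \<open>ip N v w a b\<close> is \<open>2 * c\<close>, so
          \<open>qd_moved\<close> gives \<open>2c - 4c + 2c\<close>.\<close>
        have "?q (f v) w = 0"
          using qd_moved[of N "f v" v "s v" a b w w 0] fn v sv ip[OF v(1) w(1)] sw ab vw by simp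
        then show "w = f v" using qd_0 len fW w v by simp
      next
        fix v assume v: "v \<in> W" "gdist W ?E v a = gdist W ?E v b"
        then have "t v = 0" using gd W Dq by (simp add: t_def)
        then show "f v = v" using c by (simp add: f_def)
      qed (use aut ff fa in auto)
      then show "\<exists>\<phi>. is_reflection W ?E a b \<phi>" by blast
    qed
  qed
qed

section \<open>Johnson graphs and halved cubes as sets of 0/1 vectors\<close>

definition bits :: "nat \<Rightarrow> int list set" where
  "bits n = {xs. length xs = n \<and> (\<forall>i<n. xs ! i \<in> {0, 1})}"

lemma bits_len: "u \<in> bits n \<Longrightarrow> length u = n"
  and bits_nth: "u \<in> bits n \<Longrightarrow> i < n \<Longrightarrow> u ! i = 0 \<or> u ! i = 1"
  by (auto simp: bits_def)

lemma card_filter_sum: "int (card {i. i < (n::nat) \<and> P i}) = (\<Sum>i<n. if P i then 1 else 0)"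
proof -
  have "(\<Sum>i<n. if P i then 1 else 0) = (\<Sum>i\<in>{i \<in> {..<n}. P i}. 1 :: int)"
    by (rule sum.inter_filter [symmetric]) simp
  then show ?thesis by simp
qed

lemma bits_weight: "u \<in> bits n \<Longrightarrow> int (card {i. i < n \<and> u ! i = 1}) = (\<Sum>i<n. u ! i)"
  unfolding card_filter_sum by (intro sum.cong refl) (use bits_nth in force)

lemma bits_qd: "u \<in> bits n \<Longrightarrow> v \<in> bits n \<Longrightarrow> qd n u v = int (hdist u v)"
  unfolding hdist_def qd_def card_filter_sum bits_len
proof (intro sum.cong refl)
  fix i assume "u \<in> bits n" "v \<in> bits n" "i \<in> {..<n}"
  then show "(u ! i - v ! i)\<^sup>2 = (if u ! i \<noteq> v ! i then 1 else 0)"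
    using bits_nth[of u n i] bits_nth[of v n i] by auto
qed

lemma johnson_V_bits: "johnson_V n k = {u \<in> bits n. (\<Sum>i<n. u ! i) = int k}"
  using bits_weight unfolding johnson_V_def bits_def by force

lemma halved_cube_V_bits: "halved_cube_V n = {u \<in> bits n. even (\<Sum>i<n. u ! i)}"
proof -
  have "even (card {i. i < n \<and> u ! i = 1}) \<longleftrightarrow> even (\<Sum>i<n. u ! i)" if "u \<in> bits n" for u
    unfolding bits_weight[OF that, symmetric] by simp
  then show ?thesis unfolding halved_cube_V_def bits_def by blast
qed

lemma sum_two:
  fixes f :: "nat \<Rightarrow> int"
  assumes "i < n" "j < n" "i \<noteq> j" "\<And>k. k < n \<Longrightarrow> k \<noteq> i \<Longrightarrow> k \<noteq> j \<Longrightarrow> f k = 0"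
  shows "(\<Sum>k<n. f k) = f i + f j"
proof -
  have "(\<Sum>k<n. f k) = sum f {i, j}"
    by (rule sum.mono_neutral_right) (use assms in auto)
  then show ?thesis using assms by simp
qed

lemma hdist_2E:
  assumes "hdist a b = 2" "length a = n"
  obtains i j where "i < n" "j < n" "i \<noteq> j" "a ! i \<noteq> b ! i" "a ! j \<noteq> b ! j"
    "\<And>k. k < n \<Longrightarrow> k \<noteq> i \<Longrightarrow> k \<noteq> j \<Longrightarrow> a ! k = b ! k"
proof -
  obtain i j where ij: "{i. i < length a \<and> a ! i \<noteq> b ! i} = {i, j}" "i \<noteq> j"
    using assms(1) unfolding hdist_def card_2_iff by blast
  then have "i \<in> {i. i < length a \<and> a ! i \<noteq> b ! i}" "j \<in> {i. i < length a \<and> a ! i \<noteq> b ! i}" by simp_all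
  then show thesis using that[of i j] ij assms(2) by blast
qed

text \<open>Each of the two positions where \<open>a\<close> and \<open>b\<close> differ contributes
  1 if \<open>u\<close> agrees with \<open>a\<close> there and -1 otherwise. The value 2 means
  agreement at both, and then translating just writes the entries of \<open>b\<close> there.\<close>

lemma bits_edge:
  assumes "a \<in> bits n" "b \<in> bits n" "u \<in> bits n" "hdist a b = 2"
  shows "qd n u b - qd n u a \<in> {- 2, 0, 2}"
    and "qd n u b - qd n u a = 2 \<Longrightarrow> translate n u a b \<in> bits n"
proof -
  obtain i j where ij: "i < n" "j < n" "i \<noteq> j" "a ! i \<noteq> b ! i" "a ! j \<noteq> b ! j"
    and eq: "\<And>k. k < n \<Longrightarrow> k \<noteq> i \<Longrightarrow> k \<noteq> j \<Longrightarrow> a ! k = b ! k"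
    using hdist_2E[OF assms(4) bits_len[OF assms(1)]] by metis
  let ?h = "\<lambda>k. (u ! k - b ! k)\<^sup>2 - (u ! k - a ! k)\<^sup>2"
  have h: "qd n u b - qd n u a = ?h i + ?h j"
    unfolding qd_def sum_subtractf [symmetric] by (rule sum_two) (use ij eq in auto)
  have hk: "?h k = (if u ! k = a ! k then 1 else - 1)" if "k < n" "a ! k \<noteq> b ! k" for k
    using bits_nth[OF assms(1), of k] bits_nth[OF assms(2), of k] bits_nth[OF assms(3), of k] that by auto
  show "qd n u b - qd n u a \<in> {- 2, 0, 2}"
    unfolding h using hk[of i] hk[of j] ij by simp
  assume "qd n u b - qd n u a = 2"
  then have uij: "u ! i = a ! i" "u ! j = a ! j"
    unfolding h using hk[of i] hk[of j] ij by (simp_all split: if_splits)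
  have "u ! k - a ! k + b ! k \<in> {0, 1}" if "k < n" for k
  proof (cases "k = i \<or> k = j")
    case True then show ?thesis using uij bits_nth[OF assms(2) that] by auto
  next
    case False then show ?thesis using eq[OF that] bits_nth[OF assms(3) that] by auto
  qed
  then show "translate n u a b \<in> bits n" by (simp add: bits_def)
qed

lemma bits_step:
  assumes "u \<in> bits n" "v \<in> bits n" "i < n" "j < n" "i \<noteq> j" "u ! i \<noteq> v ! i" "u ! j \<noteq> v ! j"
  defines "w \<equiv> u[i := v ! i, j := v ! j]"
  shows "w \<in> bits n" "qd n u w = 2" "qd n w v = qd n u v - 2"
    "(\<Sum>k<n. w ! k) = (\<Sum>k<n. u ! k) + (v ! i - u ! i) + (v ! j - u ! j)"
proof -
  have wk: "w ! k = (if k = i \<or> k = j then v ! k else u ! k)" if "k < n" for k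
    using assms that bits_len[OF assms(1)] by (auto simp: nth_list_update)
  have "length w = n" using bits_len[OF assms(1)] by (simp add: w_def)
  then show wb: "w \<in> bits n"
    using wk bits_nth[OF assms(1)] bits_nth[OF assms(2)] by (auto simp: bits_def)
  have sq: "(u ! k - v ! k)\<^sup>2 = 1" if "k < n" "u ! k \<noteq> v ! k" for k
    using bits_nth[OF assms(1), of k] bits_nth[OF assms(2), of k] that by auto
  have "qd n u w = (u ! i - w ! i)\<^sup>2 + (u ! j - w ! j)\<^sup>2"
    unfolding qd_def by (rule sum_two) (use wk assms(3-5) in auto)
  then show "qd n u w = 2" using wk sq assms(3-7) by simp
  have "qd n u v - qd n w v = ((u ! i - v ! i)\<^sup>2 - (w ! i - v ! i)\<^sup>2) + ((u ! j - v ! j)\<^sup>2 - (w ! j - v ! j)\<^sup>2)"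
    unfolding qd_def sum_subtractf [symmetric] by (rule sum_two) (use wk assms(3-5) in auto)
  then show "qd n w v = qd n u v - 2" using wk sq assms(3-7) by simp
  have "(\<Sum>k<n. w ! k) - (\<Sum>k<n. u ! k) = (w ! i - u ! i) + (w ! j - u ! j)"
    unfolding sum_subtractf [symmetric] by (rule sum_two) (use wk assms(3-5) in auto)
  then show "(\<Sum>k<n. w ! k) = (\<Sum>k<n. u ! k) + (v ! i - u ! i) + (v ! j - u ! j)"
    using wk assms(3,4) by simp
qed

lemma translate_sum: "(\<Sum>k<n. translate n u a b ! k) = (\<Sum>k<n. u ! k) - (\<Sum>k<n. a ! k) + (\<Sum>k<n. b ! k)"
  by (simp add: sum.distrib sum_subtractf)

text \<open>The case \<open>c = 1\<close> of \<open>vector_rgraph\<close>. \<open>P\<close> is a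
  constraint on the weight, a fixed value for Johnson graphs and evenness for halved cubes; closure
  under \<open>s - a + b\<close> keeps translates in \<open>W\<close>.\<close>

lemma bits_rgraph:
  assumes W: "W = {u \<in> bits n. P (\<Sum>k<n. u ! k)}" "W \<noteq> {}"
    and P: "\<And>a b s. P a \<Longrightarrow> P b \<Longrightarrow> P s \<Longrightarrow> P (s - a + b)"
    and G: "\<And>u v. u \<in> W \<Longrightarrow> v \<in> W \<Longrightarrow> u \<noteq> v \<Longrightarrow> \<exists>i<n. \<exists>j<n. i \<noteq> j \<and> u ! i \<noteq> v ! i \<and> u ! j \<noteq> v ! j \<and>
      P ((\<Sum>k<n. u ! k) + (v ! i - u ! i) + (v ! j - u ! j))"
  shows "rgraph W (\<lambda>u v. u \<in> W \<and> v \<in> W \<and> hdist u v = 2)"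
proof -
  have Wb: "u \<in> bits n" if "u \<in> W" for u using that W by auto
  have q: "qd n u v = int (hdist u v)" if "u \<in> W" "v \<in> W" for u v using bits_qd Wb that by blast
  have "rgraph W (\<lambda>u v. u \<in> W \<and> v \<in> W \<and> qd n u v = 2 * 1)"
  proof (rule vector_rgraph)
    fix a b u assume a: "a \<in> W" "b \<in> W" "u \<in> W" "qd n a b = 2 * 1"
    note e = bits_edge[OF Wb Wb Wb, OF a(1-3)]
    show "qd n u b - qd n u a \<in> {- 2 * 1, 0, 2 * 1}" using e(1) q a by simp
    assume "qd n u b - qd n u a = 2 * 1"
    then have "translate n u a b \<in> bits n" using e(2) q a by simp
    moreover have "P (\<Sum>k<n. translate n u a b ! k)"
      unfolding translate_sum using P a W by blast
    ultimately show "translate n u a b \<in> W" using W by blast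
  next
    fix u v assume a: "u \<in> W" "v \<in> W" "u \<noteq> v"
    obtain i j where ij: "i < n" "j < n" "i \<noteq> j" "u ! i \<noteq> v ! i" "u ! j \<noteq> v ! j"
      "P ((\<Sum>k<n. u ! k) + (v ! i - u ! i) + (v ! j - u ! j))" using G[OF a] by blast
    note s = bits_step[OF Wb[OF a(1)] Wb[OF a(2)] ij(1-5)]
    have "u[i := v ! i, j := v ! j] \<in> W" using s(1,4) ij(6) W by simp
    then show "\<exists>w\<in>W. qd n u w = 2 * 1 \<and> qd n w v = qd n u v - 2 * 1" using s by auto
  qed (use W bits_len in auto)
  moreover have "(\<lambda>u v. u \<in> W \<and> v \<in> W \<and> qd n u v = 2 * 1) = (\<lambda>u v. u \<in> W \<and> v \<in> W \<and> hdist u v = 2)"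
    by (intro ext) (use q in auto)
  ultimately show ?thesis by simp
qed

lemma int_sum_zero:
  fixes f :: "nat \<Rightarrow> int"
  assumes "(\<Sum>k<n. f k) = 0" "i < n" "f i \<noteq> 0"
  shows "\<exists>k<n. f k > 0" "\<exists>k<n. f k < 0"
proof -
  show "\<exists>k<n. f k > 0"
  proof (rule ccontr)
    assume "\<not> ?thesis"
    then have "\<forall>k\<in>{..<n}. 0 \<le> - f k" by (meson lessThan_iff neg_0_le_iff_le not_le)
    then have "\<forall>k\<in>{..<n}. - f k = 0"
      using sum_nonneg_eq_0_iff[of "{..<n}" "\<lambda>k. - f k"] assms(1) by (simp add: sum_negf)
    then show False using assms by auto
  qed
  show "\<exists>k<n. f k < 0"
  proof (rule ccontr)
    assume "\<not> ?thesis"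
    then have "\<forall>k\<in>{..<n}. 0 \<le> f k" by (meson lessThan_iff not_le)
    then have "\<forall>k\<in>{..<n}. f k = 0"
      using sum_nonneg_eq_0_iff[of "{..<n}" f] assms(1) by simp
    then show False using assms by auto
  qed
qed

lemma lists_neqE: "length u = n \<Longrightarrow> length v = n \<Longrightarrow> u \<noteq> v \<Longrightarrow> \<exists>i<n. u ! i \<noteq> v ! (i::nat)"
  by (metis nth_equalityI)

lemma johnson_rgraph:
  assumes "k \<le> n"
  shows "rgraph (fst (johnson n k)) (snd (johnson n k))"
proof -
  let ?W = "johnson_V n k"
  have "map (\<lambda>i. if i < k then 1 else 0) [0..<n] \<in> ?W"
  proof -
    have "{i. i < n \<and> i < k} = {..<k}" using assms by auto
    then have "card {i. i < n \<and> i < k} = k" by simp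
    moreover have "{i. i < n \<and> map (\<lambda>i. if i < k then 1 else 0::int) [0..<n] ! i = 1} = {i. i < n \<and> i < k}" by (auto split: if_splits)
    ultimately show ?thesis by (simp add: johnson_V_def)
  qed
  then have "?W \<noteq> {}" by blast
  moreover have "\<exists>i<n. \<exists>j<n. i \<noteq> j \<and> u ! i \<noteq> v ! i \<and> u ! j \<noteq> v ! j \<and>
      (\<Sum>k<n. u ! k) + (v ! i - u ! i) + (v ! j - u ! j) = int k" if "u \<in> ?W" "v \<in> ?W" and ne: "u \<noteq> v" for u v
  proof -
    have uv: "u \<in> bits n" "v \<in> bits n" "(\<Sum>k<n. u ! k) = int k" "(\<Sum>k<n. v ! k) = int k"
      using that by (auto simp: johnson_V_bits)
    obtain i where i: "i < n" "u ! i \<noteq> v ! i" using lists_neqE[OF bits_len[OF uv(1)] bits_len[OF uv(2)] ne] by blast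
    have s: "(\<Sum>k<n. v ! k - u ! k) = 0" using uv by (simp add: sum_subtractf)
    obtain p q where pq: "p < n" "v ! p - u ! p > 0" "q < n" "v ! q - u ! q < 0"
      using int_sum_zero[OF s i(1)] i by auto
    have "v ! p - u ! p = 1" "v ! q - u ! q = - 1"
      using pq bits_nth[OF uv(1)] bits_nth[OF uv(2)] by force+
    then show ?thesis using pq uv by (intro exI[of _ p] conjI exI[of _ q]) auto
  qed
  ultimately have "rgraph ?W (\<lambda>u v. u \<in> ?W \<and> v \<in> ?W \<and> hdist u v = 2)"
    by (intro bits_rgraph[where P = "\<lambda>s. s = int k", OF johnson_V_bits]) simp_all
  then show ?thesis by (simp add: johnson_def)
qed

lemma halved_cube_rgraph: "rgraph (fst (halved_cube n)) (snd (halved_cube n))"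
proof -
  let ?W = "halved_cube_V n"
  have "replicate n 0 \<in> ?W" by (simp add: halved_cube_V_bits bits_def)
  then have "?W \<noteq> {}" by blast
  moreover have "\<exists>i<n. \<exists>j<n. i \<noteq> j \<and> u ! i \<noteq> v ! i \<and> u ! j \<noteq> v ! j \<and>
      even ((\<Sum>k<n. u ! k) + (v ! i - u ! i) + (v ! j - u ! j))" if "u \<in> ?W" "v \<in> ?W" and ne: "u \<noteq> v" for u v
  proof -
    have uv: "u \<in> bits n" "v \<in> bits n" "even (\<Sum>k<n. u ! k)" "even (\<Sum>k<n. v ! k)"
      using that by (auto simp: halved_cube_V_bits)
    have odd: "odd (v ! i - u ! i)" if "i < n" "u ! i \<noteq> v ! i" for i
      using bits_nth[OF uv(1) that(1)] bits_nth[OF uv(2) that(1)] that by auto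
    obtain i where i: "i < n" "u ! i \<noteq> v ! i" using lists_neqE[OF bits_len[OF uv(1)] bits_len[OF uv(2)] ne] by blast
    \<comment> \<open>A single differing position would make the weights of \<open>u\<close> and
      \<open>v\<close> differ by an odd number.\<close>
    have "\<exists>j<n. i \<noteq> j \<and> u ! j \<noteq> v ! j"
    proof (rule ccontr)
      assume "\<not> ?thesis"
      then have "(\<Sum>k<n. v ! k - u ! k) = sum (\<lambda>k. v ! k - u ! k) {i}"
        by (intro sum.mono_neutral_right) (use i in auto)
      then have "(\<Sum>k<n. v ! k) - (\<Sum>k<n. u ! k) = v ! i - u ! i" by (simp add: sum_subtractf)
      then show False using odd[OF i] dvd_diff[OF uv(4,3)] by simp
    qed
    then obtain j where j: "j < n" "i \<noteq> j" "u ! j \<noteq> v ! j" by blast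
    have "even ((\<Sum>k<n. u ! k) + (v ! i - u ! i) + (v ! j - u ! j))"
      using odd[OF i] odd[OF j(1,3)] uv(3) by simp
    then show ?thesis using i j by blast
  qed
  ultimately have "rgraph ?W (\<lambda>u v. u \<in> ?W \<and> v \<in> ?W \<and> hdist u v = 2)"
    by (intro bits_rgraph[where P = even, OF halved_cube_V_bits]) simp_all
  then show ?thesis by (simp add: halved_cube_def)
qed

section \<open>The Gosset and Schlaefli graphs\<close>

definition ip8 :: "int list \<Rightarrow> int list \<Rightarrow> int" where
  "ip8 u v = (\<Sum>i<8. u ! i * v ! i)"

lemma gosset_entry:
  fixes e :: int
  assumes "e\<^sup>2 \<le> 24"
  shows "e mod 4 = 3 \<longleftrightarrow> e \<in> {3, -1}" "e mod 4 = 1 \<longleftrightarrow> e \<in> {-3, 1}"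
proof -
  have "\<bar>e\<bar> < 5" by (rule power_less_imp_less_base[where n = 2]) (use assms in auto)
  then have "e \<in> {-4, -3, -2, -1, 0, 1, 2, 3, 4}" by auto
  then show "e mod 4 = 3 \<longleftrightarrow> e \<in> {3, -1}" "e mod 4 = 1 \<longleftrightarrow> e \<in> {-3, 1}" by auto
qed

text \<open>A form stable under translation: residues modulo 4 are preserved automatically, so only
  the norm has to be checked. With entries of square 9 and 1 the squared norm is 8 plus 8 times the
  number of large entries, so 24 means exactly two; conversely norm 24 bounds the entries so that
  the residue determines the two possible values.\<close>

lemma gosset_V_norm:
  "v \<in> gosset_V \<longleftrightarrow> length v = 8 \<and> (\<Sum>i<8. (v ! i)\<^sup>2) = 24 \<and>
    ((\<forall>i<8. v ! i mod 4 = 3) \<or> (\<forall>i<8. v ! i mod 4 = 1))"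
proof -
  have 1: "card {i. i < 8 \<and> v ! i = e} = 2 \<longleftrightarrow> (\<Sum>i<8. (v ! i)\<^sup>2) = 24"
    if "e\<^sup>2 = 9" "f\<^sup>2 = 1" "\<forall>i<8. v ! i \<in> {e, f}" for e f
  proof -
    have "(\<Sum>i<8. (v ! i)\<^sup>2) = (\<Sum>i<8. 1 + 8 * (if v ! i = e then 1 else 0))"
      by (intro sum.cong refl) (use that in auto)
    also have "\<dots> = 8 + 8 * int (card {i. i < 8 \<and> v ! i = e})"
      unfolding card_filter_sum by (simp add: sum.distrib sum_distrib_left)
    finally show ?thesis by simp
  qed
  have le: "(v ! i)\<^sup>2 \<le> 24" if "(\<Sum>i<8. (v ! i)\<^sup>2) = 24" "i < 8" for i
    using member_le_sum[of i "{..<8::nat}" "\<lambda>i. (v ! i)\<^sup>2"] that by simp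
  have m: "e \<in> {3, -1} \<Longrightarrow> e mod 4 = 3" "e \<in> {-3, 1} \<Longrightarrow> e mod 4 = 1" for e :: int by auto
  have a: "card {i. i < 8 \<and> v ! i = e} = 2 \<and> (\<forall>i<8. v ! i \<in> {e, f}) \<longleftrightarrow>
      (\<Sum>i<8. (v ! i)\<^sup>2) = 24 \<and> (\<forall>i<8. v ! i mod 4 = g)"
    if "e\<^sup>2 = 9" "f\<^sup>2 = 1" "\<And>x. x\<^sup>2 \<le> 24 \<Longrightarrow> x mod 4 = g \<longleftrightarrow> x \<in> {e, f}" for e f g
  proof -
    have g: "x mod 4 = g" if "x \<in> {e, f}" for x
    proof -
      have "x\<^sup>2 \<le> 24" using that \<open>e\<^sup>2 = 9\<close> \<open>f\<^sup>2 = 1\<close> by auto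
      then show ?thesis using that \<open>\<And>x. x\<^sup>2 \<le> 24 \<Longrightarrow> x mod 4 = g \<longleftrightarrow> x \<in> {e, f}\<close> by blast
    qed
    show ?thesis
    proof
      assume l: "card {i. i < 8 \<and> v ! i = e} = 2 \<and> (\<forall>i<8. v ! i \<in> {e, f})"
      show "(\<Sum>i<8. (v ! i)\<^sup>2) = 24 \<and> (\<forall>i<8. v ! i mod 4 = g)"
        using 1[OF that(1,2)] l g by blast
    next
      assume r: "(\<Sum>i<8. (v ! i)\<^sup>2) = 24 \<and> (\<forall>i<8. v ! i mod 4 = g)"
      then have "\<forall>i<8. v ! i \<in> {e, f}" using le that(3) by blast
      then show "card {i. i < 8 \<and> v ! i = e} = 2 \<and> (\<forall>i<8. v ! i \<in> {e, f})"
        using 1[OF that(1,2)] r by blast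
    qed
  qed
  have "card {i. i < 8 \<and> v ! i = 3} = 2 \<and> (\<forall>i<8. v ! i \<in> {3, -1}) \<longleftrightarrow>
      (\<Sum>i<8. (v ! i)\<^sup>2) = 24 \<and> (\<forall>i<8. v ! i mod 4 = 3)"
    by (rule a[OF _ _ gosset_entry(1)]) auto
  moreover have "card {i. i < 8 \<and> v ! i = -3} = 2 \<and> (\<forall>i<8. v ! i \<in> {-3, 1}) \<longleftrightarrow>
      (\<Sum>i<8. (v ! i)\<^sup>2) = 24 \<and> (\<forall>i<8. v ! i mod 4 = 1)"
    by (rule a[OF _ _ gosset_entry(2)]) auto
  ultimately show ?thesis unfolding gosset_V_def by blast
qed

lemma gosset_V_len: "v \<in> gosset_V \<Longrightarrow> length v = 8"
  by (simp add: gosset_V_def)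

text \<open>Vertices are signed pairs: \<open>x\<close> is the indicator of the two large entries,
  and the entries are \<open>3 * s\<close> on the pair and \<open>- s\<close> off it.\<close>

lemma gosset_V_signs:
  assumes "v \<in> gosset_V"
  obtains s :: int and x :: "nat \<Rightarrow> int"
  where "s = 1 \<or> s = -1" "\<And>i. i < 8 \<Longrightarrow> x i = 0 \<or> x i = 1" "\<And>i. i < 8 \<Longrightarrow> v ! i = s * (4 * x i - 1)" "(\<Sum>i<8. x i) = 2"
proof -
  note th = that
  have *: thesis if sp: "s = 1 \<or> s = -1" "card {i. i < 8 \<and> v ! i = 3 * s} = 2" "\<forall>i<8. v ! i \<in> {3 * s, - s}" for s
  proof (rule th[of s "\<lambda>i. if v ! i = 3 * s then 1 else 0"])
    show "(\<Sum>i<8. if v ! i = 3 * s then 1 else 0) = (2::int)"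
      using card_filter_sum[of 8 "\<lambda>i. v ! i = 3 * s"] sp by simp
  qed (use sp in auto)
  show ?thesis using assms *[of 1] *[of "-1"] by (auto simp: gosset_V_def)
qed

lemma qd_8: "qd 8 u v = (\<Sum>i<8. (u ! i)\<^sup>2) + (\<Sum>i<8. (v ! i)\<^sup>2) - 2 * ip8 u v"
  unfolding qd_def ip8_def sum_distrib_left sum.distrib [symmetric] sum_subtractf [symmetric]
  by (intro sum.cong refl) (simp add: power2_eq_square algebra_simps)

lemma gosset_qd: "u \<in> gosset_V \<Longrightarrow> v \<in> gosset_V \<Longrightarrow> qd 8 u v = 48 - 2 * ip8 u v"
  using qd_8 by (simp add: gosset_V_norm)

lemma gosset_ip_signs:
  fixes x y :: "nat \<Rightarrow> int"
  assumes "\<And>i. i < 8 \<Longrightarrow> u ! i = s * (4 * x i - 1)" "\<And>i. i < 8 \<Longrightarrow> v ! i = t * (4 * y i - 1)"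
    "(\<Sum>i<8. x i) = 2" "(\<Sum>i<8. y i) = 2"
  shows "ip8 u v = s * t * (16 * (\<Sum>i<8. x i * y i) - 8)"
proof -
  have "ip8 u v = s * t * (\<Sum>i<8. 16 * (x i * y i) - 4 * x i - 4 * y i + 1)"
    unfolding ip8_def sum_distrib_left by (intro sum.cong refl) (simp add: assms algebra_simps)
  also have "(\<Sum>i<8. 16 * (x i * y i) - 4 * x i - 4 * y i + 1) = 16 * (\<Sum>i<8. x i * y i) - 4 * (\<Sum>i<8. x i) - 4 * (\<Sum>i<8. y i) + 8"
    by (simp add: sum.distrib sum_subtractf sum_distrib_left)
  finally show ?thesis using assms by simp
qed

text \<open>The inner products are plus or minus \<open>16 * m - 8\<close>, with \<open>m\<close>
  the overlap of the two pairs, so all are 8 modulo 16. Squared distances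
  \<open>48 - 2 * ip8 u v\<close> are then multiples of 32, the squared edge length.\<close>

lemma gosset_ip_mod: "u \<in> gosset_V \<Longrightarrow> v \<in> gosset_V \<Longrightarrow> 16 dvd ip8 u v + 8"
proof -
  assume "u \<in> gosset_V" "v \<in> gosset_V"
  obtain s :: int and x :: "nat \<Rightarrow> int" where s: "s = 1 \<or> s = -1"
    "\<And>i. i < 8 \<Longrightarrow> u ! i = s * (4 * x i - 1)" "(\<Sum>i<8. x i) = 2"
    using gosset_V_signs[OF \<open>u \<in> gosset_V\<close>] by metis
  obtain t :: int and y :: "nat \<Rightarrow> int" where t: "t = 1 \<or> t = -1"
    "\<And>i. i < 8 \<Longrightarrow> v ! i = t * (4 * y i - 1)" "(\<Sum>i<8. y i) = 2"
    using gosset_V_signs[OF \<open>v \<in> gosset_V\<close>] by metis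
  have ip: "ip8 u v = s * t * (16 * (\<Sum>i<8. x i * y i) - 8)"
    using gosset_ip_signs[OF s(2) t(2) s(3) t(3)] .
  have "s * t = 1 \<or> s * t = -1" using s(1) t(1) by auto
  then show ?thesis unfolding ip by auto
qed

lemma translate_norm:
  "(\<Sum>i<8. (translate 8 u a b ! i)\<^sup>2) =
    (\<Sum>i<8. (u ! i)\<^sup>2) + qd 8 a b - (qd 8 u b - qd 8 u a) + (\<Sum>i<8. (b ! i)\<^sup>2) - (\<Sum>i<8. (a ! i)\<^sup>2)"
  unfolding qd_def sum.distrib [symmetric] sum_subtractf [symmetric]
  by (intro sum.cong refl) (simp add: power2_eq_square algebra_simps)

text \<open>The squared norm of the translate is \<open>24 + 32\<close> minus the difference in
  question. Since norms are nonnegative, the difference is at most 56, likewise its negative, and it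
  is a multiple of 32. If it is 32, the translate has squared norm 24 again.\<close>

lemma gosset_edge:
  assumes W: "a \<in> gosset_V" "b \<in> gosset_V" "u \<in> gosset_V" and ab: "qd 8 a b = 32"
  shows "qd 8 u b - qd 8 u a \<in> {- 32, 0, 32}"
    and "qd 8 u b - qd 8 u a = 32 \<Longrightarrow> translate 8 u a b \<in> gosset_V"
proof -
  have n: "(\<Sum>i<8. (translate 8 u a b ! i)\<^sup>2) = 56 - (qd 8 u b - qd 8 u a)"
    "(\<Sum>i<8. (translate 8 u b a ! i)\<^sup>2) = 56 - (qd 8 u a - qd 8 u b)"
    unfolding translate_norm using W ab qd_sym[of 8 a b] by (auto simp: gosset_V_norm)
  have nn: "(\<Sum>i<8. (translate 8 u a b ! i)\<^sup>2) \<ge> 0" "(\<Sum>i<8. (translate 8 u b a ! i)\<^sup>2) \<ge> 0"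
    by (simp_all add: sum_nonneg)
  obtain k l where "ip8 u a + 8 = 16 * k" "ip8 u b + 8 = 16 * l"
    using gosset_ip_mod W unfolding dvd_def by meson
  then have kl: "qd 8 u b - qd 8 u a = 32 * (k - l)" using gosset_qd W by simp
  moreover have "qd 8 u b - qd 8 u a \<le> 56" using nn(1) unfolding n by simp
  moreover have "qd 8 u a - qd 8 u b \<le> 56" using nn(2) unfolding n by simp
  ultimately have "k - l < 2" "- 2 < k - l" by (smt (verit))+
  then have "k - l = -1 \<or> k - l = 0 \<or> k - l = 1" by linarith
  then show "qd 8 u b - qd 8 u a \<in> {- 32, 0, 32}" unfolding kl by auto
  assume t: "qd 8 u b - qd 8 u a = 32"
  have "\<exists>m. (m = 3 \<or> m = 1) \<and> (\<forall>i<8. v ! i mod 4 = m)" if "v \<in> {a, b, u}" for v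
    using that W by (auto simp: gosset_V_norm)
  then obtain ca cb cu where cs: "ca = 3 \<or> ca = 1" "cb = 3 \<or> cb = 1" "cu = 3 \<or> cu = 1"
    and m: "\<forall>i<8. a ! i mod 4 = ca" "\<forall>i<8. b ! i mod 4 = cb" "\<forall>i<8. u ! i mod 4 = cu"
    by (metis insert_iff)
  have "translate 8 u a b ! i mod 4 = (cu - ca + cb) mod 4" if "i < 8" for i
  proof -
    have "(u ! i - a ! i + b ! i) mod 4 = (cu - ca + cb) mod 4"
      by (intro mod_add_cong mod_diff_cong) (use m that cs in auto)
    then show ?thesis using that by simp
  qed
  moreover have "(cu - ca + cb) mod 4 = 3 \<or> (cu - ca + cb) mod 4 = 1" using cs by auto
  ultimately have "(\<forall>i<8. translate 8 u a b ! i mod 4 = 3) \<or> (\<forall>i<8. translate 8 u a b ! i mod 4 = 1)"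
    by auto
  then show "translate 8 u a b \<in> gosset_V"
    using n(1) t by (simp add: gosset_V_norm)
qed

text \<open>Exchanging two entries that differ by 4 is a move of squared length
  \<open>2 * 16\<close>; the last hypothesis makes the gain towards \<open>v\<close> equal to
  \<open>2 * 16\<close> as well.\<close>

lemma gosset_swap:
  assumes "u \<in> gosset_V" "i < 8" "j < 8" "(u ! i - u ! j)\<^sup>2 = 16" "(u ! i - u ! j) * (v ! j - v ! i) = 16"
  shows "\<exists>w\<in>gosset_V. qd 8 u w = 32 \<and> qd 8 w v = qd 8 u v - 32"
proof -
  define w where "w = u[i := u ! j, j := u ! i]"
  have ij: "i \<noteq> j" using assms(4) by auto
  have wk: "w ! k = (if k = i then u ! j else if k = j then u ! i else u ! k)" if "k < 8" for k
    using that assms gosset_V_len[OF assms(1)] by (simp add: w_def nth_list_update)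
  have "(\<Sum>k<8. (w ! k)\<^sup>2) - (\<Sum>k<8. (u ! k)\<^sup>2) = ((w ! i)\<^sup>2 - (u ! i)\<^sup>2) + ((w ! j)\<^sup>2 - (u ! j)\<^sup>2)"
    unfolding sum_subtractf [symmetric] by (rule sum_two) (use wk ij assms in auto)
  then have "(\<Sum>k<8. (w ! k)\<^sup>2) = (\<Sum>k<8. (u ! k)\<^sup>2)" using wk assms ij by simp
  moreover have "length w = 8" using gosset_V_len[OF assms(1)] by (simp add: w_def)
  ultimately have "w \<in> gosset_V" using assms(1-3) wk by (auto simp: gosset_V_norm)
  have "qd 8 u w = (u ! i - w ! i)\<^sup>2 + (u ! j - w ! j)\<^sup>2"
    unfolding qd_def by (rule sum_two) (use wk ij assms in auto)
  then have "qd 8 u w = 32" using wk assms ij power2_commute[of "u ! i" "u ! j"] by simp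
  have "qd 8 u v - qd 8 w v = ((u ! i - v ! i)\<^sup>2 - (w ! i - v ! i)\<^sup>2) + ((u ! j - v ! j)\<^sup>2 - (w ! j - v ! j)\<^sup>2)"
    unfolding qd_def sum_subtractf [symmetric] by (rule sum_two) (use wk ij assms in auto)
  also have "\<dots> = ((u ! i - v ! i)\<^sup>2 - (u ! j - v ! i)\<^sup>2) + ((u ! j - v ! j)\<^sup>2 - (u ! i - v ! j)\<^sup>2)"
    using wk assms ij by simp
  also have "\<dots> = 2 * ((u ! i - u ! j) * (v ! j - v ! i))" by (simp add: power2_eq_square algebra_simps)
  finally have "qd 8 w v = qd 8 u v - 32" using assms(5) by simp
  then show ?thesis using \<open>w \<in> gosset_V\<close> \<open>qd 8 u w = 32\<close> by blast
qed

text \<open>For equal signs, replace an element of the pair of \<open>u\<close> missing from that of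
  \<open>v\<close>, as in J(8,2). For opposite signs, overlapping pairs are far apart, so move a
  common element to a position outside both. Opposite signs with disjoint pairs are adjacent, and
  \<open>v\<close> itself is the witness.\<close>

lemma gosset_step:
  assumes "u \<in> gosset_V" "v \<in> gosset_V" "u \<noteq> v"
  shows "\<exists>w\<in>gosset_V. qd 8 u w = 32 \<and> qd 8 w v = qd 8 u v - 32"
proof -
  obtain s x where s: "s = 1 \<or> s = -1" and x: "\<And>i. i < 8 \<Longrightarrow> x i = 0 \<or> x i = 1"
    and u: "\<And>i. i < 8 \<Longrightarrow> u ! i = s * (4 * x i - 1)" and sx: "(\<Sum>i<8. x i) = 2"
    using gosset_V_signs[OF assms(1)] by metis
  obtain t y where t: "t = 1 \<or> t = -1" and y: "\<And>i. i < 8 \<Longrightarrow> y i = 0 \<or> y i = 1"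
    and v: "\<And>i. i < 8 \<Longrightarrow> v ! i = t * (4 * y i - 1)" and sy: "(\<Sum>i<8. y i) = 2"
    using gosset_V_signs[OF assms(2)] by metis
  have sw: ?thesis if ij: "i < 8" "j < 8" "x i = 1" "x j = 0" "s * t * (y j - y i) = 1" for i j
  proof -
    have 1: "u ! i - u ! j = 4 * s" "v ! j - v ! i = 4 * (t * (y j - y i))"
      unfolding u[OF ij(1)] u[OF ij(2)] v[OF ij(1)] v[OF ij(2)] using ij(3,4) by (simp_all add: algebra_simps)
    have "(u ! i - u ! j) * (v ! j - v ! i) = 16 * (s * t * (y j - y i))" unfolding 1 by simp
    moreover have "(u ! i - u ! j)\<^sup>2 = 16" using s unfolding 1 by auto
    ultimately show ?thesis using gosset_swap[OF assms(1) ij(1,2)] ij(5) by simp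
  qed
  show ?thesis
  proof (cases "s = t")
    case True
    obtain i where i: "i < 8" "u ! i \<noteq> v ! i"
      using lists_neqE[OF gosset_V_len[OF assms(1)] gosset_V_len[OF assms(2)] assms(3)] by blast
    have "(\<Sum>k<8. x k - y k) = 0" using sx sy by (simp add: sum_subtractf)
    moreover have "x i - y i \<noteq> 0" using i u v True by auto
    ultimately obtain p q where pq: "p < 8" "x p - y p > 0" "q < 8" "x q - y q < 0"
      using int_sum_zero[of "\<lambda>k. x k - y k" 8 i] i by auto
    have "x p = 1" "y p = 0" "x q = 0" "y q = 1" using pq x[of p] y[of p] x[of q] y[of q] by auto
    moreover have "s * t = 1" using True s by auto
    ultimately show ?thesis using sw[of p q] pq by simp
  next
    case False
    then have st: "s * t = -1" using s t by auto
    show ?thesis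
    proof (cases "\<exists>i<8. x i = 1 \<and> y i = 1")
      case True
      then obtain i where i: "i < 8" "x i = 1" "y i = 1" by blast
      have "\<exists>j<8. x j = 0 \<and> y j = 0"
      proof (rule ccontr)
        assume "\<not> ?thesis"
        then have "1 \<le> x k + y k" if "k < 8" for k using x[OF that] y[OF that] that by auto
        then have "(\<Sum>k<8::nat. 1) \<le> (\<Sum>k<8. x k + y k)" by (intro sum_mono) simp
        then show False using sx sy by (simp add: sum.distrib)
      qed
      then obtain j where "j < 8" "x j = 0" "y j = 0" by blast
      then show ?thesis using sw[of i j] i st by simp
    next
      case False
      then have "x k * y k = 0" if "k < 8" for k using x[OF that] y[OF that] that by auto
      then have "(\<Sum>i<8. x i * y i) = 0" by (intro sum.neutral) simp
      then have "ip8 u v = 8" using gosset_ip_signs[OF u v sx sy] st by simp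
      then have "qd 8 u v = 32" using gosset_qd assms by simp
      then show ?thesis using assms(2) qd_0 gosset_V_len by fastforce
    qed
  qed
qed

lemma gosset_rgraph: "rgraph (fst gosset) (snd gosset)"
proof -
  have "[3, 3, -1, -1, -1, -1, -1, -1] \<in> gosset_V"
    by (simp add: gosset_V_norm eval_nat_numeral less_Suc_eq all_conj_distrib)
  then have ne: "gosset_V \<noteq> {}" by blast
  have "rgraph gosset_V (\<lambda>u v. u \<in> gosset_V \<and> v \<in> gosset_V \<and> qd 8 u v = 2 * 16)"
    by (rule vector_rgraph) (use gosset_V_len ne gosset_edge gosset_step in auto)
  moreover have "(\<lambda>u v. u \<in> gosset_V \<and> v \<in> gosset_V \<and> qd 8 u v = 2 * 16) = snd gosset"
    unfolding gosset_def using gosset_qd by (auto simp: fun_eq_iff ip8_def)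
  ultimately show ?thesis by (simp add: gosset_def)
qed

section \<open>The Schlaefli graph as a local graph of the Gosset graph, by evaluation\<close>

definition dot :: "int list \<Rightarrow> int list \<Rightarrow> int" where
  "dot u v = sum_list (map2 times u v)"

lemma dot_ip8: "length u = 8 \<Longrightarrow> length v = 8 \<Longrightarrow> dot u v = ip8 u v"
  unfolding dot_def ip8_def by (simp add: sum_list_sum_nth atLeast0LessThan)

definition v0 :: "int list" where "v0 = [3, 3, -1, -1, -1, -1, -1, -1]"
definition u0 :: "int list" where "u0 = [3, -1, 3, -1, -1, -1, -1, -1]"

text \<open>An executable enumeration of the neighbours of \<open>v0\<close> in the Gosset graph,
  over both signs; \<open>u0\<close> is one of them, since \<open>9 - 3 - 3 + 5 = 8\<close>.\<close>

definition schlaefli_list :: "int list list" where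
  "schlaefli_list = filter (\<lambda>v. dot v0 v = 8)
     (filter (\<lambda>v. length (filter (\<lambda>e. e = 3) v) = 2) (List.n_lists 8 [3, -1]) @
      filter (\<lambda>v. length (filter (\<lambda>e. e = -3) v) = 2) (List.n_lists 8 [-3, 1]))"

definition halved5_list :: "int list list" where
  "halved5_list = filter (\<lambda>v. even (sum_list v)) (List.n_lists 5 [0, 1])"

text \<open>A vertex of the Gosset graph is a signed pair of coordinates. With the five points at the
  coordinates 3 to 7, the empty set goes to +{1,2}, a pair P to -P, and the 4-subset omitting j to
  +{0,j}.\<close>
definition halved5_map :: "int list \<Rightarrow> int list" where
  "halved5_map u = (let s = sum_list u in [s - 1, 3 - s, 3 - s] @ map (\<lambda>x. s - 1 - 4 * x) u)"

text \<open>Filtering \<open>N\<close> by the neighbours of \<open>y\<close> counts the common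
  neighbours of \<open>y\<close> and \<open>u0\<close>; the entry 16 at \<open>y = u0\<close> is the
  degree. The last conjunct prepares the identification of the local graph at \<open>u0\<close> with
  the halved 5-cube.\<close>

lemma schlaefli_list_srg:
  "length schlaefli_list = 27 \<and> u0 \<in> set schlaefli_list \<and>
    (let N = filter (\<lambda>v. dot u0 v = 8) schlaefli_list in
      length N = 16 \<and>
      list_all (\<lambda>y. length (filter (\<lambda>v. dot y v = 8) N) = (if y = u0 then 16 else if y \<in> set N then 10 else 8)) schlaefli_list \<and>
      set N = set (map halved5_map halved5_list))"
  by code_simp

lemma schlaefli_list_distinct: "distinct schlaefli_list"
  unfolding schlaefli_list_def
  by code_simp

lemma set_n_lists_nth: "set (List.n_lists n xs) = {v. length v = n \<and> (\<forall>i<n. v ! i \<in> set xs)}"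
  by (auto simp: set_n_lists subset_code(1) all_set_conv_all_nth)

lemma schlaefli_list_set: "set schlaefli_list = {v. snd gosset v0 v}"
proof -
  have n: "set (List.n_lists 8 [e, f]) = {v. length v = 8 \<and> (\<forall>i<8. v ! i \<in> {e, f})}" for e f :: int
    by (simp add: set_n_lists_nth)
  have c: "length (filter (\<lambda>x. x = e) v) = card {i. i < 8 \<and> v ! i = e}" if "length v = 8" for v :: "int list" and e
    using that by (simp add: length_filter_conv_card)
  have l0: "length v0 = 8" by (simp add: v0_def)
  have "set schlaefli_list = {v \<in> gosset_V. dot v0 v = 8}"
    unfolding schlaefli_list_def gosset_V_def set_filter set_append n using c by auto
  moreover have "v0 \<in> gosset_V"
    by (simp add: gosset_V_norm v0_def eval_nat_numeral less_Suc_eq all_conj_distrib)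
  ultimately show ?thesis
    using dot_ip8[OF l0 gosset_V_len] by (auto simp: gosset_def ip8_def)
qed

text \<open>With this choice the local graph of the Gosset graph at \<open>v0\<close> is the
  Schlaefli graph by definition, and \<open>local_rgraph\<close> can supply its
  reflectivity.\<close>

definition schlaefli :: "int list graph" where
  "schlaefli = ({v. snd gosset v0 v}, E_on (snd gosset) {v. snd gosset v0 v})"

lemma schlaefli_V: "fst schlaefli = set schlaefli_list"
  and schlaefli_E: "u \<in> fst schlaefli \<Longrightarrow> v \<in> fst schlaefli \<Longrightarrow> snd schlaefli u v \<longleftrightarrow> dot u v = 8"
proof -
  show V: "fst schlaefli = set schlaefli_list" by (simp add: schlaefli_def schlaefli_list_set)
  assume "u \<in> fst schlaefli" "v \<in> fst schlaefli"
  then show "snd schlaefli u v \<longleftrightarrow> dot u v = 8"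
    using dot_ip8[of u v] gosset_V_len[of u] gosset_V_len[of v]
    by (auto simp: schlaefli_def E_on_def gosset_def ip8_def)
qed

lemma schlaefli_nbr: "u \<in> set schlaefli_list \<Longrightarrow> {v. snd schlaefli u v} = set (filter (\<lambda>v. dot u v = 8) schlaefli_list)"
  using schlaefli_E[of u] schlaefli_V by (auto simp: schlaefli_def E_on_def)

lemma schlaefli_u0: "u0 \<in> set schlaefli_list"
  using schlaefli_list_srg by blast

lemma schlaefli_common:
  assumes "y \<in> fst schlaefli"
  shows "card {w \<in> fst schlaefli. snd schlaefli u0 w \<and> snd schlaefli y w} =
    (if y = u0 then 16 else if snd schlaefli u0 y then 10 else 8)"
proof -
  let ?N = "filter (\<lambda>v. dot u0 v = 8) schlaefli_list"
  have y: "y \<in> set schlaefli_list" using assms schlaefli_V by simp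
  have "{w \<in> fst schlaefli. snd schlaefli u0 w \<and> snd schlaefli y w} = set (filter (\<lambda>v. dot y v = 8) ?N)"
    using schlaefli_E[of u0] schlaefli_E[of y] schlaefli_V schlaefli_u0 y by auto
  then have "card {w \<in> fst schlaefli. snd schlaefli u0 w \<and> snd schlaefli y w} = length (filter (\<lambda>v. dot y v = 8) ?N)"
    using distinct_card[of "filter (\<lambda>v. dot y v = 8) ?N"] schlaefli_list_distinct distinct_filter by metis
  also have "\<dots> = (if y = u0 then 16 else if y \<in> set ?N then 10 else 8)"
    using schlaefli_list_srg y by (simp add: Let_def list_all_iff)
  also have "y \<in> set ?N \<longleftrightarrow> snd schlaefli u0 y"
    using schlaefli_nbr[OF schlaefli_u0] by auto
  finally show ?thesis .
qed

lemma gosset_simple: "simple_graph (fst gosset) (snd gosset)"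
  using gosset_rgraph by (simp add: rgraph_def cgraph_def)

text \<open>Every vertex other than \<open>u0\<close> has at least 8 common neighbours with
  \<open>u0\<close>, so the local graph is connected and \<open>local_rgraph\<close>
  applies.\<close>

lemma schlaefli_rgraph: "rgraph (fst schlaefli) (snd schlaefli)"
proof -
  interpret G: rgraph "fst gosset" "snd gosset" by (rule gosset_rgraph)
  have sim: "simple_graph (fst schlaefli) (snd schlaefli)"
    using gosset_simple by (auto simp: schlaefli_def simple_graph_def E_on_def)
  have u0: "u0 \<in> fst schlaefli" using schlaefli_u0 schlaefli_V by simp
  have "\<exists>n. walk (fst schlaefli) (snd schlaefli) n u0 y" if y: "y \<in> fst schlaefli" for y
  proof (cases "y = u0")
    case True
    then have "walk (fst schlaefli) (snd schlaefli) 0 u0 y" using y by simp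
    then show ?thesis by blast
  next
    case False
    have "card {w \<in> fst schlaefli. snd schlaefli u0 w \<and> snd schlaefli y w} \<noteq> 0"
      unfolding schlaefli_common[OF y] using False by simp
    then obtain w where "w \<in> fst schlaefli" "snd schlaefli u0 w" "snd schlaefli w y"
      using sim by (metis (no_types, lifting) card.empty empty_Collect_eq simple_graph_def)
    then have "walk (fst schlaefli) (snd schlaefli) (Suc (Suc 0)) u0 y" using u0 y by auto
    then show ?thesis by blast
  qed
  note wk = this
  have "\<exists>n. walk (fst schlaefli) (snd schlaefli) n y z" if yz: "y \<in> fst schlaefli" "z \<in> fst schlaefli" for y z
  proof -
    obtain m n where "walk (fst schlaefli) (snd schlaefli) m u0 y" "walk (fst schlaefli) (snd schlaefli) n u0 z"
      using wk yz by metis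
    then show ?thesis using walk_append walk_rev[OF sim] by metis
  qed
  then have "connected_graph (fst schlaefli) (snd schlaefli)"
    unfolding connected_graph_def using u0 by blast
  then show ?thesis using G.local_rgraph[of v0] by (simp add: schlaefli_def)
qed

lemma (in rgraph) card_common_r:
  assumes e: "E a b" and uv: "u \<in> V" "v \<in> V"
  shows "card {w \<in> V. E (r a b u) w \<and> E (r a b v) w} = card {w \<in> V. E u w \<and> E v w}"
proof (rule bij_betw_same_card[symmetric])
  show "bij_betw (r a b) {w \<in> V. E u w \<and> E v w} {w \<in> V. E (r a b u) w \<and> E (r a b v) w}"
  proof (rule bij_betw_byWitness[where f' = "r a b"])
    show "r a b ` {w \<in> V. E (r a b u) w \<and> E (r a b v) w} \<subseteq> {w \<in> V. E u w \<and> E v w}"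
      using r_E[OF e r_V[OF e uv(1)]] r_E[OF e r_V[OF e uv(2)]] e uv by auto
  qed (use r_E[OF e] e uv in auto)
qed

text \<open>Reflections act transitively on the vertices, so it suffices to count common neighbours with u0.\<close>
lemma schlaefli_srg: "is_schlaefli schlaefli"
proof -
  let ?V = "fst schlaefli" and ?E = "snd schlaefli"
  interpret rgraph ?V ?E by (rule schlaefli_rgraph)
  let ?Q = "\<lambda>u. \<forall>y\<in>?V. card {w \<in> ?V. ?E u w \<and> ?E y w} = (if y = u then 16 else if ?E u y then 10 else 8)"
  have u0: "u0 \<in> ?V" using schlaefli_u0 schlaefli_V by simp
  have Q: "?Q u" if "u \<in> ?V" for u
    using u0 that
  proof (induction rule: connected_induct)
    case base then show ?case using schlaefli_common by blast
  next
    case (step u w)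
    have uw: "u \<in> ?V" "w \<in> ?V" using E_V step(1) by auto
    show ?case
    proof
      fix y assume y: "y \<in> ?V"
      have "card {v \<in> ?V. ?E (r u w u) v \<and> ?E (r u w (r u w y)) v} = card {v \<in> ?V. ?E u v \<and> ?E (r u w y) v}"
        using card_common_r[OF step(1) uw(1) r_V[OF step(1) y]] .
      then have c: "card {v \<in> ?V. ?E w v \<and> ?E y v} = card {v \<in> ?V. ?E u v \<and> ?E (r u w y) v}"
        using step(1) y by simp
      have e: "?E u (r u w y) \<longleftrightarrow> ?E w y" using r_E[OF step(1) uw(2) y] step(1) by simp
      have "r u w y = u \<longleftrightarrow> y = w" using step(1) y by (metis r_r r_x r_y)
      then show "card {v \<in> ?V. ?E w v \<and> ?E y v} = (if y = w then 16 else if ?E w y then 10 else 8)"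
        unfolding c using step(2) r_V[OF step(1) y] e by simp
    qed
  qed
  have "card ?V = 27" using schlaefli_list_srg schlaefli_list_distinct by (simp add: schlaefli_V distinct_card)
  moreover have "finite ?V" by (simp add: schlaefli_V)
  moreover have "card {w \<in> ?V. ?E u w} = 16" if "u \<in> ?V" for u
    using Q[OF that] that by fastforce
  moreover have "card {w \<in> ?V. ?E u w \<and> ?E y w} = (if ?E u y then 10 else 8)"
    if "u \<in> ?V" "y \<in> ?V" "u \<noteq> y" for u y
    using Q[OF that(1)] that by simp
  ultimately show ?thesis
    unfolding is_schlaefli_def srg_def using simple E_neq by auto
qed

lemma halved5_set: "halved_cube_V 5 = set halved5_list"
proof -
  have "halved_cube_V 5 = {v \<in> bits 5. even (sum_list v)}"
    unfolding halved_cube_V_bits by (auto simp: sum_list_sum_nth atLeast0LessThan bits_len)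
  also have "bits 5 = set (List.n_lists 5 [0, 1])"
    by (simp add: bits_def set_n_lists_nth)
  finally show ?thesis unfolding halved5_list_def by auto
qed

text \<open>With \<open>t\<close> the difference of the entry sums, the terms in \<open>t\<close>
  add up to \<open>3t^2 + 5t^2 - 8t^2 = 0\<close>, leaving the factor \<open>16 = 4^2\<close>. This
  sends Hamming distance 2 to the Gosset edge length 32 and also gives injectivity.\<close>

lemma halved5_map_qd:
  assumes "u \<in> bits 5" "v \<in> bits 5"
  shows "qd 8 (halved5_map u) (halved5_map v) = 16 * qd 5 u v"
proof -
  obtain a0 a1 a2 a3 a4 where u: "u = [a0, a1, a2, a3, a4]"
    using bits_len[OF assms(1)] by (auto simp: eval_nat_numeral length_Suc_conv)
  obtain b0 b1 b2 b3 b4 where v: "v = [b0, b1, b2, b3, b4]"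
    using bits_len[OF assms(2)] by (auto simp: eval_nat_numeral length_Suc_conv)
  show ?thesis
    unfolding u v qd_def halved5_map_def Let_def
    by (simp add: eval_nat_numeral lessThan_Suc power2_eq_square algebra_simps)
qed

lemma schlaefli_local:
  "bij_betw halved5_map (fst (halved_cube 5)) {v. snd schlaefli u0 v}"
  "u \<in> fst (halved_cube 5) \<Longrightarrow> v \<in> fst (halved_cube 5) \<Longrightarrow>
    snd (halved_cube 5) u v \<longleftrightarrow> snd schlaefli (halved5_map u) (halved5_map v)"
proof -
  have b: "u \<in> bits 5" if "u \<in> halved_cube_V 5" for u using that by (simp add: halved_cube_V_bits)
  have im: "halved5_map ` halved_cube_V 5 = {v. snd schlaefli u0 v}"
    using schlaefli_list_srg schlaefli_nbr[OF schlaefli_u0] halved5_set by (simp add: Let_def)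
  have "inj_on halved5_map (halved_cube_V 5)"
  proof (rule inj_onI)
    fix u v assume uv: "u \<in> halved_cube_V 5" "v \<in> halved_cube_V 5" "halved5_map u = halved5_map v"
    have "qd 5 u v = 0" using halved5_map_qd[OF b b, OF uv(1,2)] uv(3) by (simp add: qd_def)
    then show "u = v" using qd_0 b bits_len uv by blast
  qed
  then show "bij_betw halved5_map (fst (halved_cube 5)) {v. snd schlaefli u0 v}"
    using im by (simp add: bij_betw_def halved_cube_def)
  assume "u \<in> fst (halved_cube 5)" "v \<in> fst (halved_cube 5)"
  then have uv: "u \<in> halved_cube_V 5" "v \<in> halved_cube_V 5" by (simp_all add: halved_cube_def)
  let ?u = "halved5_map u" and ?v = "halved5_map v"
  have S: "?u \<in> fst schlaefli" "?v \<in> fst schlaefli"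
    using uv im by (auto simp: schlaefli_def E_on_def)
  then have G: "?u \<in> gosset_V" "?v \<in> gosset_V" by (auto simp: schlaefli_def gosset_def)
  have "snd schlaefli ?u ?v \<longleftrightarrow> qd 8 ?u ?v = 32"
    using schlaefli_E[OF S] dot_ip8[of ?u ?v] gosset_V_len G gosset_qd[OF G] by auto
  also have "\<dots> \<longleftrightarrow> hdist u v = 2"
    using halved5_map_qd[OF b b, OF uv] bits_qd[OF b b, OF uv] by auto
  finally show "snd (halved_cube 5) u v \<longleftrightarrow> snd schlaefli ?u ?v"
    using uv by (simp add: halved_cube_def)
qed

section \<open>Isomorphisms and products\<close>

lemma graph_isoI:
  assumes "bij_betw f V W" "\<And>x y. x \<in> V \<Longrightarrow> y \<in> V \<Longrightarrow> E x y \<longleftrightarrow> F (f x) (f y)"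
  shows "graph_iso V E W F"
  using assms unfolding graph_iso_def by blast

lemma graph_isoE:
  assumes "graph_iso V E W F"
  obtains f where "bij_betw f V W" "\<forall>x\<in>V. f x \<in> W" "\<forall>x\<in>V. \<forall>y\<in>V. E x y \<longleftrightarrow> F (f x) (f y)"
proof -
  obtain f where f: "bij_betw f V W" "\<forall>x\<in>V. \<forall>y\<in>V. E x y \<longleftrightarrow> F (f x) (f y)"
    using assms unfolding graph_iso_def by blast
  then have "\<forall>x\<in>V. f x \<in> W" by (auto simp: bij_betw_def)
  then show thesis using that f by blast
qed

lemma graph_iso_trans:
  assumes "graph_iso V E W F" "graph_iso W F U D"
  shows "graph_iso V E U D"
proof -
  obtain f where f: "bij_betw f V W" "\<forall>x\<in>V. f x \<in> W" "\<forall>x\<in>V. \<forall>y\<in>V. E x y \<longleftrightarrow> F (f x) (f y)"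
    using assms(1) by (rule graph_isoE)
  obtain g where g: "bij_betw g W U" "\<forall>x\<in>W. g x \<in> U" "\<forall>x\<in>W. \<forall>y\<in>W. F x y \<longleftrightarrow> D (g x) (g y)"
    using assms(2) by (rule graph_isoE)
  show ?thesis
    by (rule graph_isoI[OF bij_betw_trans[OF f(1) g(1)]]) (simp add: f(2,3) g(3))
qed

lemma graph_iso_sym:
  assumes "graph_iso V E W F"
  shows "graph_iso W F V E"
proof -
  obtain f where f: "bij_betw f V W" "\<forall>x\<in>V. f x \<in> W" "\<forall>x\<in>V. \<forall>y\<in>V. E x y \<longleftrightarrow> F (f x) (f y)"
    using assms by (rule graph_isoE)
  have i: "bij_betw (inv_into V f) W V" using bij_betw_inv_into[OF f(1)] .
  have m: "inv_into V f y \<in> V" if "y \<in> W" for y using i that by (auto simp: bij_betw_def)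
  show ?thesis
    by (rule graph_isoI[OF i]) (simp add: f(3) m bij_betw_inv_into_right[OF f(1)])
qed

lemma prod_append:
  "prod_V (fs @ gs) = (\<lambda>(xs, ys). xs @ ys) ` (prod_V fs \<times> prod_V gs)"
  "xs \<in> prod_V fs \<Longrightarrow> xs' \<in> prod_V fs \<Longrightarrow> ys \<in> prod_V gs \<Longrightarrow> ys' \<in> prod_V gs \<Longrightarrow>
    prod_E (fs @ gs) (xs @ ys) (xs' @ ys') \<longleftrightarrow> prod_E fs xs xs' \<and> ys = ys' \<or> xs = xs' \<and> prod_E gs ys ys'"
proof -
  let ?m = "length fs" and ?n = "length gs"
  have all: "(\<forall>i<?m + ?n. Q i) \<longleftrightarrow> (\<forall>i<?m. Q i) \<and> (\<forall>i<?n. Q (?m + i))" for Q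
  proof (intro iffI conjI allI impI)
    fix i assume q: "(\<forall>i<?m. Q i) \<and> (\<forall>i<?n. Q (?m + i))" "i < ?m + ?n"
    show "Q i"
    proof (cases "i < ?m")
      case False
      then have "?m + (i - ?m) = i" "i - ?m < ?n" using q(2) by linarith+
      then show ?thesis using q(1) by metis
    qed (use q in simp)
  qed auto
  have ex: "(\<exists>i<?m + ?n. Q i) \<longleftrightarrow> (\<exists>i<?m. Q i) \<or> (\<exists>i<?n. Q (?m + i))" for Q
    using all[of "\<lambda>i. \<not> Q i"] by blast
  show "prod_V (fs @ gs) = (\<lambda>(xs, ys). xs @ ys) ` (prod_V fs \<times> prod_V gs)"
  proof (intro equalityI subsetI)
    fix zs assume zs: "zs \<in> prod_V (fs @ gs)"
    then have "take ?m zs \<in> prod_V fs" "drop ?m zs \<in> prod_V gs"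
      by (auto simp: prod_V_def all nth_append)
    then have "(take ?m zs, drop ?m zs) \<in> prod_V fs \<times> prod_V gs" by simp
    then show "zs \<in> (\<lambda>(xs, ys). xs @ ys) ` (prod_V fs \<times> prod_V gs)"
      by (rule rev_image_eqI) simp
  next
    fix zs assume "zs \<in> (\<lambda>(xs, ys). xs @ ys) ` (prod_V fs \<times> prod_V gs)"
    then show "zs \<in> prod_V (fs @ gs)" by (auto simp: prod_V_def all nth_append)
  qed
  assume "xs \<in> prod_V fs" "xs' \<in> prod_V fs" "ys \<in> prod_V gs" "ys' \<in> prod_V gs"
  then have l: "length xs = ?m" "length xs' = ?m" "length ys = ?n" "length ys' = ?n"
    by (auto simp: prod_V_def)
  have eq: "xs = xs' \<longleftrightarrow> (\<forall>i<?m. xs ! i = xs' ! i)" "ys = ys' \<longleftrightarrow> (\<forall>i<?n. ys ! i = ys' ! i)"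
    using l by (auto simp: list_eq_iff_nth_eq)
  show "prod_E (fs @ gs) (xs @ ys) (xs' @ ys') \<longleftrightarrow> prod_E fs xs xs' \<and> ys = ys' \<or> xs = xs' \<and> prod_E gs ys ys'"
    unfolding prod_E_def eq length_append ex all using l by (auto simp: nth_append)
qed

text \<open>Concatenating factor lists keeps products flat, so a binary splitting whose parts are
  already decomposed needs no nested products.\<close>

lemma graph_iso_append:
  assumes h: "bij_betw h V (S \<times> T)"
    and e: "\<And>u v. u \<in> V \<Longrightarrow> v \<in> V \<Longrightarrow> E u v \<longleftrightarrow>
      E1 (fst (h u)) (fst (h v)) \<and> snd (h u) = snd (h v) \<or> fst (h u) = fst (h v) \<and> E2 (snd (h u)) (snd (h v))"
    and f: "graph_iso S E1 (prod_V fs) (prod_E fs)" and g: "graph_iso T E2 (prod_V gs) (prod_E gs)"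
  shows "graph_iso V E (prod_V (fs @ gs)) (prod_E (fs @ gs))"
proof -
  obtain f where f: "bij_betw f S (prod_V fs)" "\<forall>x\<in>S. f x \<in> prod_V fs"
    "\<forall>x\<in>S. \<forall>y\<in>S. E1 x y \<longleftrightarrow> prod_E fs (f x) (f y)"
    using f by (rule graph_isoE)
  obtain g where g: "bij_betw g T (prod_V gs)" "\<forall>x\<in>T. g x \<in> prod_V gs"
    "\<forall>x\<in>T. \<forall>y\<in>T. E2 x y \<longleftrightarrow> prod_E gs (g x) (g y)"
    using g by (rule graph_isoE)
  have "inj_on (\<lambda>(xs, ys). xs @ ys) (prod_V fs \<times> prod_V gs)"
    by (auto simp: inj_on_def prod_V_def)
  then have app: "bij_betw (\<lambda>(xs, ys). xs @ ys) (prod_V fs \<times> prod_V gs) (prod_V (fs @ gs))"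
    unfolding prod_append by (rule inj_on_imp_bij_betw)
  note bij = bij_betw_trans[OF bij_betw_trans[OF h bij_betw_map_prod[OF f(1) g(1)]] app]
  have inS: "fst (h u) \<in> S" "snd (h u) \<in> T" if "u \<in> V" for u
    using bij_betw_apply[OF h that] by (simp_all add: mem_Times_iff)
  have fi: "f x = f y \<longleftrightarrow> x = y" if "x \<in> S" "y \<in> S" for x y
    using f(1) that by (auto simp: bij_betw_def inj_on_def)
  have gi: "g x = g y \<longleftrightarrow> x = y" if "x \<in> T" "y \<in> T" for x y
    using g(1) that by (auto simp: bij_betw_def inj_on_def)
  show ?thesis
  proof (rule graph_isoI[OF bij])
    fix u v assume uv: "u \<in> V" "v \<in> V"
    have k: "((\<lambda>(xs, ys). xs @ ys) \<circ> (map_prod f g \<circ> h)) w = f (fst (h w)) @ g (snd (h w))" for w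
      by (simp add: case_prod_beta)
    show "E u v \<longleftrightarrow> prod_E (fs @ gs) (((\<lambda>(xs, ys). xs @ ys) \<circ> (map_prod f g \<circ> h)) u) (((\<lambda>(xs, ys). xs @ ys) \<circ> (map_prod f g \<circ> h)) v)"
      unfolding k e[OF uv] using prod_append(2)[of "f (fst (h u))" fs "f (fst (h v))" "g (snd (h u))" gs "g (snd (h v))"]
        f(2,3) g(2,3) inS uv fi gi by auto
  qed
qed

lemma prod_single: "graph_iso (fst G) (snd G) (prod_V [G]) (prod_E [G])"
proof (rule graph_isoI)
  show "bij_betw (\<lambda>x. [x]) (fst G) (prod_V [G])"
    by (rule bij_betwI') (auto simp: prod_V_def length_Suc_conv)
qed (auto simp: prod_E_def)

lemma prod_two:
  "prod_V [G, H] = {[u, c] | u c. u \<in> fst G \<and> c \<in> fst H}"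
  "prod_E [G, H] [u, c] [v, e] \<longleftrightarrow> snd G u v \<and> c = e \<or> u = v \<and> snd H c e"
  by (auto simp: prod_V_def prod_E_def length_Suc_conv less_Suc_eq all_conj_distrib ex_disj_distrib conj_disj_distribR
      eval_nat_numeral)

text \<open>The product of complete graphs on \<open>a\<close> and \<open>b\<close> vertices, where
  exactly one coordinate changes along an edge. With \<open>b = 1\<close> it covers complete graphs,
  and with \<open>a = b = 1\<close> the single vertex.\<close>

definition grid :: "'a set \<Rightarrow> ('a \<Rightarrow> 'a \<Rightarrow> bool) \<Rightarrow> bool" where
  "grid W F \<longleftrightarrow> (\<exists>(a::nat) (b::nat) f. 1 \<le> a \<and> 1 \<le> b \<and> bij_betw f W ({..<a} \<times> {..<b}) \<and>
    (\<forall>u\<in>W. \<forall>v\<in>W. F u v \<longleftrightarrow> (fst (f u) = fst (f v)) \<noteq> (snd (f u) = snd (f v))))"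

text \<open>Cocktail party graphs without a numbering of the pairs, a form that passes through
  isomorphisms and from local graphs to the whole graph.\<close>

definition cocktail :: "'a set \<Rightarrow> ('a \<Rightarrow> 'a \<Rightarrow> bool) \<Rightarrow> bool" where
  "cocktail W F \<longleftrightarrow> (\<forall>u\<in>W. \<exists>!v. v \<in> W \<and> v \<noteq> u \<and> \<not> F u v)"

definition diam2 :: "'a set \<Rightarrow> ('a \<Rightarrow> 'a \<Rightarrow> bool) \<Rightarrow> bool" where
  "diam2 W F \<longleftrightarrow> (\<forall>u\<in>W. \<forall>v\<in>W. u = v \<or> F u v \<or> (\<exists>w\<in>W. F u w \<and> F w v))"

lemma grid_iso:
  assumes "graph_iso V E W F" "grid W F"
  shows "grid V E"
proof -
  obtain f where f: "bij_betw f V W" "\<forall>x\<in>V. f x \<in> W" "\<forall>x\<in>V. \<forall>y\<in>V. E x y \<longleftrightarrow> F (f x) (f y)"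
    using assms(1) by (rule graph_isoE)
  obtain g a b where g: "1 \<le> a" "1 \<le> b" "bij_betw g W ({..<a::nat} \<times> {..<b::nat})"
      "\<forall>u\<in>W. \<forall>v\<in>W. F u v \<longleftrightarrow> (fst (g u) = fst (g v)) \<noteq> (snd (g u) = snd (g v))"
    using assms(2) unfolding grid_def by blast
  show ?thesis
    unfolding grid_def using g(1,2) bij_betw_trans[OF f(1) g(3)]
    by (intro exI[of _ a] exI[of _ b] exI[of _ "g \<circ> f"]) (simp add: f(2,3) g(4))
qed

lemma diam2_iso:
  assumes "graph_iso V E W F" and d: "diam2 V E"
  shows "diam2 W F"
proof -
  obtain f where f: "bij_betw f V W" "\<forall>x\<in>V. f x \<in> W" "\<forall>x\<in>V. \<forall>y\<in>V. E x y \<longleftrightarrow> F (f x) (f y)"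
    using assms(1) by (rule graph_isoE)
  have W: "W = f ` V" using f(1) by (simp add: bij_betw_def)
  have "f u = f v \<or> F (f u) (f v) \<or> (\<exists>w\<in>W. F (f u) w \<and> F w (f v))" if "u \<in> V" "v \<in> V" for u v
  proof -
    consider "u = v" | "E u v" | w where "w \<in> V" "E u w" "E w v" using d \<open>u \<in> V\<close> \<open>v \<in> V\<close> unfolding diam2_def by blast
    then show ?thesis
    proof cases
      case 3
      then have "f w \<in> W" "F (f u) (f w)" "F (f w) (f v)" using f(2,3) that by blast+
      then show ?thesis by blast
    qed (use f that in auto)
  qed
  then show ?thesis unfolding diam2_def W by simp
qed

lemma cocktail_iso:
  assumes "graph_iso V E W F" and c: "cocktail W F"
  shows "cocktail V E"
proof -
  obtain f where f: "bij_betw f V W" "\<forall>x\<in>V. f x \<in> W" "\<forall>x\<in>V. \<forall>y\<in>V. E x y \<longleftrightarrow> F (f x) (f y)"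
    using assms(1) by (rule graph_isoE)
  have W: "W = f ` V" and inj: "\<And>u v. u \<in> V \<Longrightarrow> v \<in> V \<Longrightarrow> f u = f v \<longleftrightarrow> u = v"
    using f(1) by (auto simp: bij_betw_def inj_on_def)
  show ?thesis
    unfolding cocktail_def
  proof
    fix u assume u: "u \<in> V"
    then obtain v where v: "v \<in> V" "f v \<noteq> f u" "\<not> F (f u) (f v)"
      and un: "\<And>y. y \<in> W \<and> y \<noteq> f u \<and> \<not> F (f u) y \<Longrightarrow> y = f v"
      using c W unfolding cocktail_def by (metis (no_types, lifting) imageE imageI)
    show "\<exists>!v. v \<in> V \<and> v \<noteq> u \<and> \<not> E u v"
    proof (rule ex1I[of _ v])
      show "v \<in> V \<and> v \<noteq> u \<and> \<not> E u v" using v f(3) u by auto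
      fix y assume y: "y \<in> V \<and> y \<noteq> u \<and> \<not> E u y"
      then have "f y = f v" using un[of "f y"] u f(3) inj W by auto
      then show "y = v" using inj y v by blast
    qed
  qed
qed

lemma complete_grid:
  assumes "finite W" "W \<noteq> {}" "\<And>u v. u \<in> W \<Longrightarrow> v \<in> W \<Longrightarrow> F u v \<longleftrightarrow> u \<noteq> v"
  shows "grid W F"
proof -
  obtain f where f: "bij_betw f W {0..<card W}" using ex_bij_betw_finite_nat[OF assms(1)] by blast
  have c: "1 \<le> card W" using assms(1,2) by (simp add: Suc_le_eq card_gt_0_iff)
  have b: "bij_betw (\<lambda>u. (f u, 0::nat)) W ({..<card W} \<times> {..<1})"
    using f by (auto simp: bij_betw_def inj_on_def image_iff)
  have inj: "f u = f v \<longleftrightarrow> u = v" if "u \<in> W" "v \<in> W" for u v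
    using f that by (auto simp: bij_betw_def inj_on_def)
  show ?thesis
    unfolding grid_def using c b assms(3) inj
    by (intro exI[of _ "card W"] exI[of _ 1] exI[of _ "\<lambda>u. (f u, 0)"]) auto
qed

lemma prod_complete_grid:
  assumes "finite (fst G)" "finite (fst H)" "fst G \<noteq> {}" "fst H \<noteq> {}"
    and G: "\<And>u v. u \<in> fst G \<Longrightarrow> v \<in> fst G \<Longrightarrow> snd G u v \<longleftrightarrow> u \<noteq> v"
    and H: "\<And>u v. u \<in> fst H \<Longrightarrow> v \<in> fst H \<Longrightarrow> snd H u v \<longleftrightarrow> u \<noteq> v"
  shows "grid (prod_V [G, H]) (prod_E [G, H])"
proof -
  let ?a = "card (fst G)" and ?b = "card (fst H)"
  obtain f where f: "bij_betw f (fst G) {0..<?a}" using ex_bij_betw_finite_nat[OF assms(1)] by blast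
  obtain g where g: "bij_betw g (fst H) {0..<?b}" using ex_bij_betw_finite_nat[OF assms(2)] by blast
  have c: "1 \<le> ?a" "1 \<le> ?b" using assms(1-4) by (simp_all add: Suc_le_eq card_gt_0_iff)
  have fi: "f x = f y \<longleftrightarrow> x = y" if "x \<in> fst G" "y \<in> fst G" for x y
    using f that by (auto simp: bij_betw_def inj_on_def)
  have gi: "g x = g y \<longleftrightarrow> x = y" if "x \<in> fst H" "y \<in> fst H" for x y
    using g that by (auto simp: bij_betw_def inj_on_def)
  let ?h = "\<lambda>xs. (f (xs ! 0), g (xs ! 1))"
  have "bij_betw ?h (prod_V [G, H]) ({..<?a} \<times> {..<?b})"
  proof (rule bij_betw_imageI)
    show "inj_on ?h (prod_V [G, H])" unfolding prod_two inj_on_def using fi gi by auto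
    have "f ` fst G = {0..<?a}" "g ` fst H = {0..<?b}" using f g by (auto simp: bij_betw_def)
    then have "{..<?a} \<times> {..<?b} = f ` fst G \<times> g ` fst H" by auto
    also have "\<dots> = ?h ` prod_V [G, H]"
    proof (intro equalityI subsetI)
      fix p assume "p \<in> f ` fst G \<times> g ` fst H"
      then obtain u c where uc: "u \<in> fst G" "c \<in> fst H" "p = (f u, g c)" by blast
      then have "[u, c] \<in> prod_V [G, H]" "p = ?h [u, c]" unfolding prod_two by auto
      then show "p \<in> ?h ` prod_V [G, H]" by blast
    qed (auto simp: prod_two)
    finally show "?h ` prod_V [G, H] = {..<?a} \<times> {..<?b}" by simp
  qed
  moreover have "prod_E [G, H] xs ys \<longleftrightarrow> (fst (?h xs) = fst (?h ys)) \<noteq> (snd (?h xs) = snd (?h ys))"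
    if xy: "xs \<in> prod_V [G, H]" "ys \<in> prod_V [G, H]" for xs ys
  proof -
    obtain u c v e where "xs = [u, c]" "ys = [v, e]" "u \<in> fst G" "v \<in> fst G" "c \<in> fst H" "e \<in> fst H"
      using xy unfolding prod_two by auto
    then show ?thesis using prod_two(2)[of G H u c v e] G H fi gi by auto
  qed
  ultimately show ?thesis
    unfolding grid_def using c by (intro exI[of _ ?a] exI[of _ ?b] exI[of _ ?h]) simp
qed

text \<open>Remove a vertex and its only non-neighbour, number the rest by induction, and give the
  removed pair the next numbers \<open>2 * k\<close> and \<open>2 * k + 1\<close>.\<close>

lemma cocktail_pairing:
  assumes "finite W" "cocktail W F" "\<And>u v. u \<in> W \<Longrightarrow> v \<in> W \<Longrightarrow> F u v \<Longrightarrow> F v u \<and> u \<noteq> v"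
  shows "\<exists>k f. bij_betw f W {..<2 * k} \<and> (\<forall>u\<in>W. \<forall>v\<in>W. F u v \<longleftrightarrow> f u div 2 \<noteq> f v div (2::nat))"
  using assms
proof (induction "card W" arbitrary: W rule: less_induct)
  case less
  show ?case
  proof (cases "W = {}")
    case True
    then show ?thesis by (intro exI[of _ 0] exI[of _ "\<lambda>_. 0"]) (simp add: bij_betw_def)
  next
    case False
    then obtain u where u: "u \<in> W" by blast
    then obtain v where v: "v \<in> W" "v \<noteq> u" "\<not> F u v" "\<And>y. y \<in> W \<Longrightarrow> y \<noteq> u \<Longrightarrow> \<not> F u y \<Longrightarrow> y = v"
      using less.prems(2) unfolding cocktail_def by metis
    have v': "y = u" if "y \<in> W" "y \<noteq> v" "\<not> F v y" for y
      using less.prems(2,3) that u v unfolding cocktail_def by metis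
    let ?W = "W - {u, v}"
    have "?W \<subset> W" using u by blast
    then have "card ?W < card W" using less.prems(1) by (simp add: psubset_card_mono)
    moreover have "cocktail ?W F"
      unfolding cocktail_def
    proof
      fix a assume a: "a \<in> ?W"
      then obtain b where b: "b \<in> W" "b \<noteq> a" "\<not> F a b" "\<And>y. y \<in> W \<Longrightarrow> y \<noteq> a \<Longrightarrow> \<not> F a y \<Longrightarrow> y = b"
        using less.prems(2) unfolding cocktail_def by (metis DiffD1)
      have sym: "\<not> F b a" using less.prems(3)[of b a] a b by blast
      have "b \<noteq> u" using v(4)[of a] a sym by auto
      moreover have "b \<noteq> v" using v'[of a] a sym by auto
      ultimately have "b \<in> ?W" using b(1) by blast
      then show "\<exists>!b. b \<in> ?W \<and> b \<noteq> a \<and> \<not> F a b" using b(2-4) by (intro ex1I[of _ b]) blast+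
    qed
    ultimately obtain k f where f: "bij_betw f ?W {..<2 * k}"
      "\<forall>a\<in>?W. \<forall>b\<in>?W. F a b \<longleftrightarrow> f a div 2 \<noteq> f b div (2::nat)"
      using less.hyps[of ?W] less.prems by (metis DiffD1 finite_Diff)
    have fk: "f a < 2 * k" if "a \<in> ?W" for a using f(1) that by (auto simp: bij_betw_def)
    define g where "g = f(u := 2 * k, v := 2 * k + 1)"
    have gW: "g a = f a" if "a \<in> ?W" for a using that by (auto simp: g_def)
    have guv: "g u = 2 * k" "g v = 2 * k + 1" using v(2) by (simp_all add: g_def)
    have "bij_betw g ?W {..<2 * k}" using f(1) bij_betw_cong[of ?W g f] gW by blast
    moreover have "bij_betw g {u, v} {2 * k, 2 * k + 1}" using guv by (auto simp: bij_betw_def inj_on_def)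
    ultimately have "bij_betw g (?W \<union> {u, v}) ({..<2 * k} \<union> {2 * k, 2 * k + 1})"
      by (rule bij_betw_combine) auto
    moreover have "?W \<union> {u, v} = W" using u v(1) by blast
    moreover have "{..<2 * k} \<union> {2 * k, 2 * k + 1} = {..<2 * Suc k}" by auto
    ultimately have bij: "bij_betw g W {..<2 * Suc k}" by simp
    have d: "g a div 2 < k" if "a \<in> ?W" for a using fk[OF that] gW[OF that] by simp
    have uF: "F u a" "F a u" "F v a" "F a v" if "a \<in> ?W" for a
    proof -
      have a: "a \<in> W" "a \<noteq> u" "a \<noteq> v" using that by auto
      show "F u a" using v(4)[OF a(1,2)] a(3) by blast
      show "F v a" using v'[OF a(1,3)] a(2) by blast
      show "F a u" using \<open>F u a\<close> less.prems(3) u a(1) by blast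
      show "F a v" using \<open>F v a\<close> less.prems(3) v(1) a(1) by blast
    qed
    have "F a b \<longleftrightarrow> g a div 2 \<noteq> g b div 2" if ab: "a \<in> W" "b \<in> W" for a b
    proof -
      consider "a \<in> ?W" "b \<in> ?W" | "a \<in> ?W" "b \<in> {u, v}" | "a \<in> {u, v}" "b \<in> ?W" | "a \<in> {u, v}" "b \<in> {u, v}"
        using ab by blast
      then show ?thesis
      proof cases
        case 1 then show ?thesis using f(2) gW by simp
      next
        case 2 then show ?thesis using d[OF 2(1)] uF[OF 2(1)] guv by auto
      next
        case 3 then show ?thesis using d[OF 3(2)] uF[OF 3(2)] guv by auto
      next
        case 4
        have "\<not> F u u" "\<not> F v v" "\<not> F v u"
          using less.prems(3)[OF u u] less.prems(3)[OF v(1) v(1)] less.prems(3)[OF v(1) u] v(3) by blast+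
        then show ?thesis using 4 guv v(3) by auto
      qed
    qed
    then show ?thesis using bij by blast
  qed
qed

lemma cocktail_party_iso:
  assumes "finite W" "cocktail W F" "\<And>u v. u \<in> W \<Longrightarrow> v \<in> W \<Longrightarrow> F u v \<Longrightarrow> F v u \<and> u \<noteq> v" "W \<noteq> {}"
  shows "\<exists>k\<ge>1. graph_iso W F (fst (cocktail_party k)) (snd (cocktail_party k))"
proof -
  obtain k f where f: "bij_betw f W {..<2 * k}" "\<forall>u\<in>W. \<forall>v\<in>W. F u v \<longleftrightarrow> f u div 2 \<noteq> f v div (2::nat)"
    using cocktail_pairing[OF assms(1-3)] by blast
  have "k \<noteq> 0" using f(1) assms(4) by (auto simp: bij_betw_def)
  have fk: "f a < 2 * k" if "a \<in> W" for a using f(1) that by (auto simp: bij_betw_def)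
  have "bij_betw (\<lambda>i. [int i]) {..<2 * k} {[int i] | i. i < 2 * k}"
    by (auto simp: bij_betw_def inj_on_def)
  note b = bij_betw_trans[OF f(1) this]
  have "graph_iso W F (fst (cocktail_party k)) (snd (cocktail_party k))"
  proof (rule graph_isoI)
    show "bij_betw ((\<lambda>i. [int i]) \<circ> f) W (fst (cocktail_party k))"
      using b by (simp add: cocktail_party_def)
    fix u v assume uv: "u \<in> W" "v \<in> W"
    have "int (f u) div 2 = int (f v) div 2 \<longleftrightarrow> f u div 2 = f v div 2"
      by (metis nat_int of_nat_numeral zdiv_int)
    then show "F u v \<longleftrightarrow> snd (cocktail_party k) (((\<lambda>i. [int i]) \<circ> f) u) (((\<lambda>i. [int i]) \<circ> f) v)"
      using f(2) uv fk by (auto simp: cocktail_party_def)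
  qed
  then show ?thesis using \<open>k \<noteq> 0\<close> by (intro exI[of _ k]) auto
qed

lemma cocktail_party_cocktail: "cocktail (fst (cocktail_party k)) (snd (cocktail_party k))"
proof -
  have "\<exists>!v. v \<in> {[int i] | i. i < 2 * k} \<and> v \<noteq> u \<and> \<not> snd (cocktail_party k) u v"
    if u: "u \<in> {[int i] | i. i < 2 * k}" for u
  proof -
    obtain i where i: "u = [int i]" "i < 2 * k" using u by blast
    \<comment> \<open>The other member of the pair \<open>i div 2\<close>.\<close>
    define j where "j = (if even i then i + 1 else i - 1)"
    have j: "j < 2 * k" "j \<noteq> i" "j div 2 = i div 2"
      using i(2) by (auto simp: j_def elim!: evenE oddE)
    have un: "l = j" if "l div 2 = i div 2" "l \<noteq> i" for l
      using that unfolding j_def by (cases "even i"; cases "even l") (auto elim!: evenE oddE)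
    have dv: "int a div 2 = int b div 2 \<longleftrightarrow> a div 2 = b div 2" for a b :: nat
      by (metis nat_int of_nat_numeral zdiv_int)
    have E: "snd (cocktail_party k) u [int l] \<longleftrightarrow> l \<noteq> i \<and> l div 2 \<noteq> i div 2" if "l < 2 * k" for l
      using i that dv[of i l] unfolding cocktail_party_def by auto
    show ?thesis
    proof (rule ex1I[of _ "[int j]"])
      show "[int j] \<in> {[int i] | i. i < 2 * k} \<and> [int j] \<noteq> u \<and> \<not> snd (cocktail_party k) u [int j]"
        using j(1,2) i(1) E[OF j(1)] j(3) by simp
      fix v assume v: "v \<in> {[int i] | i. i < 2 * k} \<and> v \<noteq> u \<and> \<not> snd (cocktail_party k) u v"
      then obtain l where l: "v = [int l]" "l < 2 * k" by blast
      then have "l \<noteq> i" "l div 2 = i div 2" using v i(1) E[OF l(2)] by auto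
      then show "v = [int j]" using un l(1) by blast
    qed
  qed
  then show ?thesis by (simp add: cocktail_def cocktail_party_def)
qed

section \<open>Local graphs of the models\<close>

definition ind :: "nat \<Rightarrow> nat set \<Rightarrow> int list" where
  "ind n A = map (\<lambda>i. if i \<in> A then 1 else 0) [0..<n]"

lemma ind_nth [simp]: "i < n \<Longrightarrow> ind n A ! i = (if i \<in> A then 1 else 0)"
  and ind_len [simp]: "length (ind n A) = n"
  by (simp_all add: ind_def)

lemma ind_ones: "A \<subseteq> {..<n} \<Longrightarrow> {i. i < n \<and> ind n A ! i = 1} = A"
  by (auto split: if_splits)

lemma ind_johnson: "A \<subseteq> {..<n} \<Longrightarrow> ind n A \<in> johnson_V n (card A)"
  using ind_ones by (simp add: johnson_V_def)

lemma ind_hdist: "A \<subseteq> {..<n} \<Longrightarrow> B \<subseteq> {..<n} \<Longrightarrow> hdist (ind n A) (ind n B) = card ((A - B) \<union> (B - A))"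
  unfolding hdist_def by (intro arg_cong[where f = card]) (auto split: if_splits)

lemma bits_ind: "u \<in> bits n \<Longrightarrow> u = ind n {i. i < n \<and> u ! i = 1}"
  by (rule nth_equalityI) (use bits_len bits_nth in force)+

lemma johnson_indE:
  assumes "u \<in> johnson_V n k"
  obtains A where "A \<subseteq> {..<n}" "card A = k" "u = ind n A"
proof (rule that[of "{i. i < n \<and> u ! i = 1}"])
  show "u = ind n {i. i < n \<and> u ! i = 1}" using assms bits_ind by (auto simp: johnson_V_bits)
qed (use assms in \<open>auto simp: johnson_V_def\<close>)

lemma ind_inj: "A \<subseteq> {..<n} \<Longrightarrow> B \<subseteq> {..<n} \<Longrightarrow> ind n A = ind n B \<longleftrightarrow> A = B"
  using ind_ones by metis

lemma hdist_tri:
  assumes "length u = n" "length v = n" "length w = n"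
  shows "hdist u v \<le> hdist u w + hdist w v"
proof -
  have "{i. i < n \<and> u ! i \<noteq> v ! i} \<subseteq> {i. i < n \<and> u ! i \<noteq> w ! i} \<union> {i. i < n \<and> w ! i \<noteq> v ! i}" by auto
  then have "card {i. i < n \<and> u ! i \<noteq> v ! i} \<le> card ({i. i < n \<and> u ! i \<noteq> w ! i} \<union> {i. i < n \<and> w ! i \<noteq> v ! i})"
    by (intro card_mono) auto
  also have "\<dots> \<le> card {i. i < n \<and> u ! i \<noteq> w ! i} + card {i. i < n \<and> w ! i \<noteq> v ! i}" by (rule card_Un_le)
  finally show ?thesis using assms by (simp add: hdist_def)
qed

text \<open>Each edge changes two positions, so two edges change at most four.\<close>

lemma hdist_not_diam2:
  assumes "W \<subseteq> bits n" "u \<in> W" "v \<in> W" "hdist u v > 4"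
  shows "\<not> diam2 W (\<lambda>u v. u \<in> W \<and> v \<in> W \<and> hdist u v = 2)"
proof
  assume "diam2 W (\<lambda>u v. u \<in> W \<and> v \<in> W \<and> hdist u v = 2)"
  then consider "u = v" | "hdist u v = 2" | w where "w \<in> W" "hdist u w = 2" "hdist w v = 2"
    using assms(2,3) unfolding diam2_def by blast
  then show False
  proof cases
    case 1 then show ?thesis using assms(4) by (simp add: hdist_def)
  next
    case 2 then show ?thesis using assms(4) by simp
  next
    case 3
    have "hdist u v \<le> hdist u w + hdist w v"
      by (rule hdist_tri[of _ n]) (use assms 3 bits_len in blast)+
    then show ?thesis using 3 assms(4) by simp
  qed
qed

text \<open>Two disjoint \<open>k\<close>-sets have characteristic vectors differing in
  \<open>2 * k\<close>, hence at least 6, positions.\<close>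

lemma johnson_not_diam2:
  assumes "3 \<le> k" "2 * k \<le> n"
  shows "\<not> diam2 (fst (johnson n k)) (snd (johnson n k))"
proof -
  have s: "{..<k} \<subseteq> {..<n}" "{k..<2 * k} \<subseteq> {..<n}" using assms by auto
  have "hdist (ind n {..<k}) (ind n {k..<2 * k}) = card ({..<k} - {k..<2 * k} \<union> ({k..<2 * k} - {..<k}))"
    by (rule ind_hdist[OF s])
  also have "{..<k} - {k..<2 * k} \<union> ({k..<2 * k} - {..<k}) = {..<2 * k}" by auto
  finally have "hdist (ind n {..<k}) (ind n {k..<2 * k}) > 4" using assms by simp
  then show ?thesis
    unfolding johnson_def fst_conv snd_conv
    using hdist_not_diam2[of "johnson_V n k" n "ind n {..<k}" "ind n {k..<2 * k}"]
      ind_johnson[OF s(1)] ind_johnson[OF s(2)] by (auto simp: johnson_V_bits)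
qed

text \<open>The empty set and a set of 6 elements are at distance 3. The bound 6 is sharp, which
  leaves the halved 5-cube as a possible local graph.\<close>

lemma halved_not_diam2:
  assumes "6 \<le> n"
  shows "\<not> diam2 (fst (halved_cube n)) (snd (halved_cube n))"
proof -
  have s: "{} \<subseteq> {..<n}" "{..<6} \<subseteq> {..<n}" using assms by auto
  have "hdist (ind n {}) (ind n {..<6}) = card ({} - {..<6} \<union> ({..<6::nat} - {}))"
    by (rule ind_hdist[OF s])
  then have h: "hdist (ind n {}) (ind n {..<6}) > 4" by simp
  have "ind n {} \<in> halved_cube_V n" "ind n {..<6} \<in> halved_cube_V n"
    using ind_johnson[OF s(1)] ind_johnson[OF s(2)] by (auto simp: halved_cube_V_bits johnson_V_bits)
  then show ?thesis
    unfolding halved_cube_def fst_conv snd_conv using h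
    by (intro hdist_not_diam2[where n = n]) (auto simp: halved_cube_V_bits)
qed

lemma v0_gosset: "v0 \<in> gosset_V"
  using gosset_simple schlaefli_u0 unfolding schlaefli_list_set simple_graph_def by (auto simp: gosset_def)

text \<open>The antipodes \<open>v0\<close> and \<open>- v0\<close> have no common neighbour: inner
  product 8 with one means -8 with the other.\<close>

lemma gosset_not_diam2: "\<not> diam2 (fst gosset) (snd gosset)"
proof
  assume d: "diam2 (fst gosset) (snd gosset)"
  let ?m = "map uminus v0"
  have m: "?m \<in> gosset_V" by (simp add: gosset_V_norm v0_def eval_nat_numeral less_Suc_eq all_conj_distrib)
  have ip: "(\<Sum>i<8. w ! i * ?m ! i) = - (\<Sum>i<8. v0 ! i * w ! i)" for w
    unfolding sum_negf[symmetric] by (intro sum.cong refl) (use gosset_V_len[OF v0_gosset] in simp)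
  have "v0 \<noteq> ?m" by (simp add: v0_def)
  moreover have "\<not> snd gosset v0 ?m"
    using ip[of v0] by (simp add: gosset_def v0_def eval_nat_numeral lessThan_Suc)
  moreover have "\<not> (snd gosset v0 w \<and> snd gosset w ?m)" for w
    using ip[of w] by (simp add: gosset_def)
  moreover have "v0 \<in> fst gosset" "?m \<in> fst gosset" using v0_gosset m by (simp_all add: gosset_def)
  ultimately show False using d unfolding diam2_def by blast
qed

lemma johnson_1: "u \<in> johnson_V n 1 \<Longrightarrow> v \<in> johnson_V n 1 \<Longrightarrow> snd (johnson n 1) u v \<longleftrightarrow> u \<noteq> v"
proof -
  assume u: "u \<in> johnson_V n 1" and v: "v \<in> johnson_V n 1"
  obtain A where A: "A \<subseteq> {..<n}" "card A = 1" "u = ind n A" using u by (rule johnson_indE)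
  obtain B where B: "B \<subseteq> {..<n}" "card B = 1" "v = ind n B" using v by (rule johnson_indE)
  obtain p q where pq: "A = {p}" "B = {q}" using A B by (metis card_1_singletonE)
  have "hdist u v = card ((A - B) \<union> (B - A))" using ind_hdist A B by simp
  also have "\<dots> = (if p = q then 0 else 2)" unfolding pq by (simp add: card_insert_if)
  finally show ?thesis using u v ind_inj[OF A(1) B(1)] A(3) B(3) pq by (simp add: johnson_def)
qed

text \<open>J(4,2) is the octahedron: the only non-neighbour of a pair is its complement. The six
  vertices are checked by evaluation.\<close>

lemma johnson_42_cocktail: "cocktail (fst (johnson 4 2)) (snd (johnson 4 2))"
proof -
  let ?L = "filter (\<lambda>v. sum_list v = 2) (List.n_lists 4 [0, 1 :: int])"
  let ?h = "\<lambda>u v. length (filter (\<lambda>(a, b). a \<noteq> b) (zip u v))"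
  have c: "list_all (\<lambda>u. filter (\<lambda>v. v \<noteq> u \<and> ?h u v \<noteq> 2) ?L = [map (\<lambda>t. 1 - t) u]) ?L" by code_simp
  have b: "bits 4 = set (List.n_lists 4 [0, 1])" by (simp add: bits_def set_n_lists_nth)
  have J: "johnson_V 4 2 = set ?L"
    unfolding johnson_V_bits set_filter b[symmetric] by (auto simp: sum_list_sum_nth atLeast0LessThan bits_len)
  have h: "hdist u v = ?h u v" if "u \<in> johnson_V 4 2" "v \<in> johnson_V 4 2" for u v
    using that bits_len unfolding hdist_def length_filter_conv_card johnson_V_bits
    by (intro arg_cong[where f = card]) auto
  have "\<exists>!v. v \<in> johnson_V 4 2 \<and> v \<noteq> u \<and> \<not> (u \<in> johnson_V 4 2 \<and> v \<in> johnson_V 4 2 \<and> hdist u v = 2)"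
    if u: "u \<in> johnson_V 4 2" for u
  proof -
    have "filter (\<lambda>v. v \<noteq> u \<and> ?h u v \<noteq> 2) ?L = [map (\<lambda>t. 1 - t) u]"
      using c u unfolding J list_all_iff by blast
    then have "set (filter (\<lambda>v. v \<noteq> u \<and> ?h u v \<noteq> 2) ?L) = {map (\<lambda>t. 1 - t) u}" by simp
    moreover have "{v \<in> johnson_V 4 2. v \<noteq> u \<and> hdist u v \<noteq> 2} = {v \<in> johnson_V 4 2. v \<noteq> u \<and> ?h u v \<noteq> 2}"
      using h[OF u] by auto
    moreover have "\<dots> = set (filter (\<lambda>v. v \<noteq> u \<and> ?h u v \<noteq> 2) ?L)"
      unfolding J by auto
    ultimately have "{v \<in> johnson_V 4 2. v \<noteq> u \<and> hdist u v \<noteq> 2} = {map (\<lambda>t. 1 - t) u}" by argo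
    then show ?thesis using u by (intro ex1I[of _ "map (\<lambda>t. 1 - t) u"]) blast+
  qed
  then show ?thesis by (simp add: cocktail_def johnson_def)
qed

lemma johnson_compl:
  assumes "k \<le> n"
  shows "graph_iso (fst (johnson n k)) (snd (johnson n k)) (fst (johnson n (n - k))) (snd (johnson n (n - k)))"
proof (rule graph_isoI)
  let ?f = "map (\<lambda>t. 1 - t :: int)"
  have m: "?f u \<in> johnson_V n (n - k')" if "u \<in> johnson_V n k'" "k' \<le> n" for u k'
  proof -
    have u: "u \<in> bits n" "(\<Sum>i<n. u ! i) = int k'" using that by (auto simp: johnson_V_bits)
    have "(\<Sum>i<n. ?f u ! i) = (\<Sum>i<n. 1 - u ! i)" by (intro sum.cong refl) (use bits_len[OF u(1)] in simp)
    also have "\<dots> = int (n - k')" using u that(2) by (simp add: sum_subtractf)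
    finally show ?thesis using u(1) by (auto simp: johnson_V_bits bits_def)
  qed
  have ff: "?f (?f u) = u" for u by (simp add: o_def)
  show "bij_betw ?f (fst (johnson n k)) (fst (johnson n (n - k)))"
    unfolding johnson_def fst_conv
    by (rule bij_betw_byWitness[where f' = ?f]) (use m[of _ k] m[of _ "n - k"] assms ff in auto)
  fix u v assume "u \<in> fst (johnson n k)" "v \<in> fst (johnson n k)"
  then have uv: "u \<in> johnson_V n k" "v \<in> johnson_V n k" by (simp_all add: johnson_def)
  then have "length u = n" "length v = n" by (simp_all add: johnson_V_def)
  then have "hdist (?f u) (?f v) = hdist u v"
    unfolding hdist_def by (intro arg_cong[where f = card]) auto
  then show "snd (johnson n k) u v \<longleftrightarrow> snd (johnson n (n - k)) (?f u) (?f v)"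
    using uv m assms by (simp add: johnson_def)
qed

text \<open>At the zero vector the neighbours are the vectors of weight 2.\<close>

lemma halved_local:
  "{y. snd (halved_cube n) (ind n {}) y} = johnson_V n 2"
  "E_on (snd (halved_cube n)) (johnson_V n 2) = snd (johnson n 2)"
proof -
  have z: "ind n {} \<in> halved_cube_V n"
    using ind_johnson[of "{}" n] by (simp add: halved_cube_V_bits johnson_V_bits)
  have e: "hdist (ind n {}) y = 2 \<longleftrightarrow> y \<in> johnson_V n 2" if "y \<in> bits n" for y
  proof -
    have "hdist (ind n {}) y = card {i. i < n \<and> y ! i = 1}"
      unfolding hdist_def by (intro arg_cong[where f = card]) (use bits_nth[OF that] in force)
    then show ?thesis using that by (simp add: johnson_V_def bits_def)
  qed
  have sub: "johnson_V n 2 \<subseteq> halved_cube_V n" by (auto simp: halved_cube_V_bits johnson_V_bits)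
  show "{y. snd (halved_cube n) (ind n {}) y} = johnson_V n 2"
    using z e sub by (auto simp: halved_cube_def halved_cube_V_bits)
  show "E_on (snd (halved_cube n)) (johnson_V n 2) = snd (johnson n 2)"
    using sub by (auto simp: fun_eq_iff E_on_def halved_cube_def johnson_def)
qed

text \<open>A neighbour of the \<open>a\<close>-set \<open>{..<a}\<close> exchanges an element
  \<open>i\<close> of it for an element \<open>a + j\<close> outside. Two such exchanges are
  adjacent iff they share exactly one of the two choices, so the local graph is an \<open>a\<close>
  by \<open>b\<close> grid.\<close>

lemma johnson_local:
  assumes "1 \<le> a" "1 \<le> b"
  defines "h0 \<equiv> ind (a + b) {..<a}"
  defines "\<sigma> \<equiv> \<lambda>(i, j). ind (a + b) (insert (a + j) ({..<a} - {i}))"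
  shows "h0 \<in> fst (johnson (a + b) a)"
    and "bij_betw \<sigma> ({..<a} \<times> {..<b}) {y. snd (johnson (a + b) a) h0 y}"
    and "p \<in> {..<a} \<times> {..<b} \<Longrightarrow> q \<in> {..<a} \<times> {..<b} \<Longrightarrow>
      snd (johnson (a + b) a) (\<sigma> p) (\<sigma> q) \<longleftrightarrow> (fst p = fst q) \<noteq> (snd p = snd q)"
proof -
  let ?n = "a + b"
  let ?A = "\<lambda>i j. insert (a + j) ({..<a} - {i})"
  have sub: "{..<a} \<subseteq> {..<?n}" by auto
  have As: "?A i j \<subseteq> {..<?n}" "card (?A i j) = a" if "i < a" "j < b" for i j
    using that by (auto simp: card_insert_if)
  have h0: "h0 \<in> johnson_V ?n a" using ind_johnson[OF sub] by (simp add: h0_def)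
  then show "h0 \<in> fst (johnson ?n a)" by (simp add: johnson_def)
  have s: "\<sigma> (i, j) \<in> johnson_V ?n a" if "i < a" "j < b" for i j
    using ind_johnson[OF As(1)[OF that]] As(2)[OF that] by (simp add: \<sigma>_def)
  have hd: "hdist (\<sigma> (i, j)) (\<sigma> (i', j')) = (if i = i' then 0 else 2) + (if j = j' then 0 else 2)"
    if "i < a" "j < b" "i' < a" "j' < b" for i j i' j'
  proof -
    have "hdist (\<sigma> (i, j)) (\<sigma> (i', j')) = card (?A i j - ?A i' j' \<union> (?A i' j' - ?A i j))"
      unfolding \<sigma>_def prod.case by (rule ind_hdist) (use As that in auto)
    also have "?A i j - ?A i' j' \<union> (?A i' j' - ?A i j) = (if i = i' then {} else {i, i'}) \<union> (if j = j' then {} else {a + j, a + j'})"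
      using that by auto
    also have "card \<dots> = (if i = i' then 0 else 2) + (if j = j' then 0 else 2)"
      using that by (auto simp: card_insert_if)
    finally show ?thesis .
  qed
  show "snd (johnson ?n a) (\<sigma> p) (\<sigma> q) \<longleftrightarrow> (fst p = fst q) \<noteq> (snd p = snd q)"
    if pq: "p \<in> {..<a} \<times> {..<b}" "q \<in> {..<a} \<times> {..<b}" for p q
  proof -
    obtain i j i' j' where "p = (i, j)" "q = (i', j')" "i < a" "j < b" "i' < a" "j' < b" using pq by auto
    then show ?thesis using hd s by (simp add: johnson_def)
  qed
  show "bij_betw \<sigma> ({..<a} \<times> {..<b}) {y. snd (johnson ?n a) h0 y}"
  proof (rule bij_betw_imageI)
    show "inj_on \<sigma> ({..<a} \<times> {..<b})"
    proof (rule inj_onI, clarsimp)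
      fix i j i' j' assume a: "\<sigma> (i, j) = \<sigma> (i', j')" "i < a" "j < b" "i' < a" "j' < b"
      then have "hdist (\<sigma> (i, j)) (\<sigma> (i', j')) = 0" by (simp add: hdist_def)
      then show "i = i' \<and> j = j'" using hd[OF a(2-5)] by (auto split: if_splits)
    qed
    have h0d: "hdist h0 (ind ?n B) = card ({..<a} - B) + card (B - {..<a})" if "B \<subseteq> {..<?n}" for B
    proof -
      have "finite B" using that finite_subset by blast
      then show ?thesis
        unfolding h0_def ind_hdist[OF sub that] by (intro card_Un_disjoint) auto
    qed
    show "\<sigma> ` ({..<a} \<times> {..<b}) = {y. snd (johnson ?n a) h0 y}"
    proof (intro equalityI subsetI)
      fix y assume "y \<in> \<sigma> ` ({..<a} \<times> {..<b})"
      then obtain i j where ij: "i < a" "j < b" "y = \<sigma> (i, j)" by auto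
      have "{..<a} - ?A i j = {i}" "?A i j - {..<a} = {a + j}" using ij by auto
      then have "hdist h0 y = 2" using h0d[OF As(1)[OF ij(1,2)]] ij by (simp add: \<sigma>_def)
      then show "y \<in> {y. snd (johnson ?n a) h0 y}" using s ij h0 by (simp add: johnson_def)
    next
      fix y assume "y \<in> {y. snd (johnson ?n a) h0 y}"
      then have y: "y \<in> johnson_V ?n a" "hdist h0 y = 2" by (auto simp: johnson_def)
      obtain B where B: "B \<subseteq> {..<?n}" "card B = a" "y = ind ?n B" using y(1) by (rule johnson_indE)
      have f: "finite B" using B(1) finite_subset by blast
      have "card ({..<a} - B) + card (B - {..<a}) = 2" using h0d[OF B(1)] y(2) B(3) by simp
      moreover have "card ({..<a} - B) = card (B - {..<a})"
        using card_Diff_subset_Int[of "{..<a}" B] card_Diff_subset_Int[of B "{..<a}"] f B(2) by (simp add: Int_commute)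
      ultimately have "card ({..<a} - B) = 1" "card (B - {..<a}) = 1" by simp_all
      then obtain i q where iq: "{..<a} - B = {i}" "B - {..<a} = {q}" by (metis card_1_singletonE)
      have i: "i < a" using iq by auto
      have q: "a \<le> q" "q < ?n" using iq B(1) by auto
      have "B = ?A i (q - a)" using iq q by auto
      then have "y = \<sigma> (i, q - a)" using B(3) by (simp add: \<sigma>_def)
      then show "y \<in> \<sigma> ` ({..<a} \<times> {..<b})" using i q by (intro image_eqI[of _ _ "(i, q - a)"]) auto
    qed
  qed
qed

text \<open>An \<open>a\<close> by \<open>b\<close> grid gives J(a+b,a); for \<open>b = 1\<close>
  this is the complete graph on \<open>a + 1\<close> vertices.\<close>

lemma grid_johnson:
  assumes "rgraph V E" "x \<in> V" and g: "grid {y. E x y} (E_on E {y. E x y})"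
  shows "\<exists>n k. 1 \<le> k \<and> k < n \<and> graph_iso V E (fst (johnson n k)) (snd (johnson n k))"
proof -
  obtain a b f where ab: "1 \<le> a" "1 \<le> b" and f: "bij_betw f {y. E x y} ({..<a::nat} \<times> {..<b::nat})"
    and e: "\<forall>u\<in>{y. E x y}. \<forall>v\<in>{y. E x y}. E_on E {y. E x y} u v \<longleftrightarrow> (fst (f u) = fst (f v)) \<noteq> (snd (f u) = snd (f v))"
    using g unfolding grid_def by blast
  note j = johnson_local[OF ab]
  have "graph_iso V E (fst (johnson (a + b) a)) (snd (johnson (a + b) a))"
  proof (rule local_iso_extends[OF assms(1) johnson_rgraph assms(2) j(1) bij_betw_trans[OF f j(2)]])
    fix y z assume yz: "E x y" "E x z"
    have "f y \<in> {..<a} \<times> {..<b}" "f z \<in> {..<a} \<times> {..<b}" using bij_betw_apply[OF f] yz by auto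
    note jj = j(3)[OF this]
    show "E y z \<longleftrightarrow> snd (johnson (a + b) a) (((\<lambda>(i, j). ind (a + b) (insert (a + j) ({..<a} - {i}))) \<circ> f) y)
      (((\<lambda>(i, j). ind (a + b) (insert (a + j) ({..<a} - {i}))) \<circ> f) z)"
      unfolding o_apply jj using e yz by (simp add: E_on_def)
  qed simp
  then show ?thesis using ab by (intro exI[of _ "a + b"] exI[of _ a]) simp
qed

section \<open>Classification\<close>

context rgraph
begin

lemma local_diam2:
  assumes "connected_graph {y. E x y} (E_on E {y. E x y})"
  shows "diam2 {y. E x y} (E_on E {y. E x y})"
  unfolding diam2_def
proof (intro ballI)
  fix u v assume uv: "u \<in> {y. E x y}" "v \<in> {y. E x y}"
  show "u = v \<or> E_on E {y. E x y} u v \<or> (\<exists>w\<in>{y. E x y}. E_on E {y. E x y} u w \<and> E_on E {y. E x y} w v)"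
    using local_diameter[OF assms, of u v] uv by (auto simp: E_on_def)
qed

text \<open>The local structure at \<open>x\<close> is carried to every vertex by reflections. Then
  two non-adjacent vertices with a common neighbour turn out to have the same neighbours, and
  connectivity leaves no further vertices. The edge from \<open>a\<close> to \<open>b\<close> rules
  out the local graph CP(1), two isolated vertices.\<close>

lemma cocktail_local:
  assumes x: "x \<in> V" and c: "cocktail {y. E x y} (E_on E {y. E x y})"
    and ed: "E x a" "E x b" "E a b"
  shows "cocktail V E"
proof -
  \<comment> \<open>\<open>Q w\<close>: the local graph at \<open>w\<close> is a nonempty cocktail
    party graph without isolated vertices. At \<open>x\<close> the edge from \<open>a\<close> to
    \<open>b\<close> ensures the last point, since only one of its ends can be the non-neighbour of
    \<open>y\<close>.\<close>
  define Q where "Q w \<longleftrightarrow> (\<exists>y. E w y) \<and> (\<forall>y. E w y \<longrightarrow> (\<exists>!z. E w z \<and> z \<noteq> y \<and> \<not> E y z) \<and> (\<exists>s. E w s \<and> E y s))" for w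
  have Qx: "Q x"
    unfolding Q_def
  proof (intro conjI allI impI)
    show "\<exists>y. E x y" using ed by blast
    fix y assume y: "E x y"
    show un: "\<exists>!z. E x z \<and> z \<noteq> y \<and> \<not> E y z"
      using c y unfolding cocktail_def E_on_def by (simp cong: conj_cong)
    show "\<exists>s. E x s \<and> E y s"
    proof (cases "y = a \<or> y = b \<or> E y a \<or> E y b")
      case True then show ?thesis using ed E_sym[OF ed(3)] by blast
    next
      case False
      then have "a = b" using un ed by blast
      then show ?thesis using E_neq[OF ed(3)] by blast
    qed
  qed
  have Q: "Q w" if "w \<in> V" for w
    using x that
  proof (induction rule: connected_induct)
    case base show ?case by (rule Qx)
  next
    case (step u w)
    let ?r = "r u w"
    have V: "u \<in> V" "w \<in> V" using E_V step(1) by auto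
    have tr: "E w t \<longleftrightarrow> E u (?r t)" if "t \<in> V" for t
      using r_E[OF step(1) V(2) that] step(1) by simp
    have tr2: "E s t \<longleftrightarrow> E (?r s) (?r t)" if "s \<in> V" "t \<in> V" for s t
      using r_E[OF step(1) that] by simp
    have rr: "?r (?r t) = t" "?r t \<in> V" if "t \<in> V" for t using step(1) that by auto
    show ?case
      unfolding Q_def
    proof (intro conjI allI impI)
      show "\<exists>y. E w y" using E_sym[OF step(1)] by blast
      fix y assume y: "E w y"
      have yV: "y \<in> V" using E_V y by blast
      have uy: "E u (?r y)" using tr[OF yV] y by blast
      then obtain z where z: "E u z" "z \<noteq> ?r y" "\<not> E (?r y) z" and
        un: "\<And>t. E u t \<Longrightarrow> t \<noteq> ?r y \<Longrightarrow> \<not> E (?r y) t \<Longrightarrow> t = z"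
        using step(2) unfolding Q_def by metis
      have zV: "z \<in> V" using E_V z by blast
      show "\<exists>!z. E w z \<and> z \<noteq> y \<and> \<not> E y z"
      proof (rule ex1I[of _ "?r z"])
        show "E w (?r z) \<and> ?r z \<noteq> y \<and> \<not> E y (?r z)"
          using z tr[OF rr(2)[OF zV]] tr2[OF yV rr(2)[OF zV]] rr(1)[OF zV] by auto
        fix t assume t: "E w t \<and> t \<noteq> y \<and> \<not> E y t"
        have tV: "t \<in> V" using t E_V by blast
        have "?r t \<noteq> ?r y" using t rr(1)[OF tV] rr(1)[OF yV] by metis
        then have "?r t = z" using un t tr[OF tV] tr2[OF yV tV] by blast
        then show "t = ?r z" using rr(1)[OF tV] by simp
      qed
      obtain s where s: "E u s" "E (?r y) s" using step(2) uy unfolding Q_def by blast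
      have sV: "s \<in> V" using E_V s by blast
      then have "E w (?r s)" "E y (?r s)"
        using s tr[OF rr(2)[OF sV]] tr2[OF yV rr(2)[OF sV]] rr(1)[OF sV] by auto
      then show "\<exists>s. E w s \<and> E y s" by blast
    qed
  qed
  have anti: "t = s" if "E w y" "E w t" "E w s" "t \<noteq> y" "s \<noteq> y" "\<not> E y t" "\<not> E y s" for w y s t
    using Q[of w] E_V(1)[OF that(1)] that unfolding Q_def by blast
  have sub: "E v t" if uv: "E w u" "E w v" "u \<noteq> v" "\<not> E u v" and t: "E u t" for u v w t
  proof -
    have nvu: "\<not> E v u" using uv E_sym by blast
    \<comment> \<open>In the local graph at \<open>m\<close> the only non-neighbour of
      \<open>v\<close> is \<open>u\<close>, and \<open>t\<close> differs from
      \<open>u\<close>.\<close>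
    have clo: "E v t" if m: "E u m" "E v m" and t: "E u t" "E m t" for m t
    proof (rule ccontr)
      assume "\<not> E v t"
      moreover have "t \<noteq> v" using t uv by blast
      moreover have "t \<noteq> u" using E_neq[OF t(1)] by blast
      moreover have "E m u" "E m v" using m E_sym by blast+
      ultimately have "t = u" using anti[of m v t u] t uv nvu by blast
      then show False using \<open>t \<noteq> u\<close> by blast
    qed
    have uw: "E u w" "E v w" using uv E_sym by blast+
    show ?thesis
    proof (cases "t = w \<or> E w t")
      case True then show ?thesis using uw clo t by blast
    next
      case False
      \<comment> \<open>In the local graph at \<open>u\<close>, \<open>w\<close> is the only
        non-neighbour of \<open>t\<close>; so a common neighbour \<open>s\<close> of
        \<open>u\<close> and \<open>w\<close> is adjacent to \<open>t\<close>, and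
        \<open>clo\<close> applies with \<open>s\<close> in the role of \<open>m\<close>.\<close>
      obtain s where s: "E u s" "E w s" using Q[of u] E_V(1)[OF t] uw(1) unfolding Q_def by blast
      have "E v s" using clo[OF uw s] .
      have "s \<noteq> w" "s \<noteq> t" using E_neq[OF s(2)] s(2) False by blast+
      have "E s t"
      proof (rule ccontr)
        assume "\<not> E s t"
        then have nts: "\<not> E t s" using E_sym by blast
        have "\<not> E t w" using False E_sym by blast
        then have "s = w" using anti[of u t s w] t s uw nts \<open>s \<noteq> t\<close> False by blast
        then show False using \<open>s \<noteq> w\<close> by blast
      qed
      then show ?thesis using clo[OF s(1) \<open>E v s\<close> t] by blast
    qed
  qed
  have "\<exists>!v. v \<in> V \<and> v \<noteq> u \<and> \<not> E u v" if u: "u \<in> V" for u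
  proof -
    obtain w where w: "E u w" using Q[OF u] unfolding Q_def by blast
    then obtain v where v: "E w v" "v \<noteq> u" "\<not> E u v"
      using Q[of w] E_V(2)[OF w] E_sym[OF w] unfolding Q_def by blast
    have uvt: "E v t" if "E u t" for t using sub[OF E_sym[OF w] v(1)] v that by blast
    have vut: "E u t" if "E v t" for t using sub[OF v(1) E_sym[OF w] v(2) _ that] v E_sym by blast
    \<comment> \<open>A walk cannot leave this set: in the local graph at a common neighbour
      \<open>t\<close> of \<open>u\<close> and \<open>v\<close>, the only non-neighbour of
      \<open>u\<close> is \<open>v\<close>.\<close>
    have all: "s = u \<or> s = v \<or> E u s" if "s \<in> V" for s
      using u that
    proof (induction rule: connected_induct)
      case (step t s)
      then consider "t = u \<or> t = v" | "E u t" by blast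
      then show ?case
      proof cases
        case 1 then show ?thesis using step(1) vut by blast
      next
        case 2
        have tu: "E t u" "E t v" using 2 uvt E_sym by blast+
        show ?thesis
        proof (rule ccontr)
          assume n: "\<not> (s = u \<or> s = v \<or> E u s)"
          then have "s = v" using anti[of t u s v] tu step(1) v by blast
          then show False using n by blast
        qed
      qed
    qed simp
    show ?thesis
      by (rule ex1I[of _ v]) (use v E_V all in blast)+
  qed
  then show ?thesis unfolding cocktail_def by blast
qed

end

text \<open>The irredundant part of the list that the induction produces. Complete graphs are
  Johnson graphs, the halved 4-cube is CP(4), smaller halved cubes are complete, and Hamming graphs
  are products.\<close>

definition model :: "int list graph \<Rightarrow> bool" where
  "model G \<longleftrightarrow> (\<exists>n k. 1 \<le> k \<and> k < n \<and> G = johnson n k) \<or> (\<exists>k\<ge>1. G = cocktail_party k) \<or>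
    (\<exists>n\<ge>5. G = halved_cube n) \<or> G = schlaefli \<or> G = gosset"

text \<open>An edge in every factor gives it diameter at least 1, so that the diameter of a product
  bounds the number of its factors.\<close>

definition factor :: "int list graph \<Rightarrow> bool" where
  "factor G \<longleftrightarrow> model G \<and> finite (fst G) \<and> (\<forall>u\<in>fst G. \<not> snd G u u) \<and> (\<exists>u\<in>fst G. \<exists>v\<in>fst G. snd G u v)"

text \<open>Choose an edge in every factor: its two ends give two vertices of the product differing
  in all coordinates, while two edges of the product change at most two coordinates.\<close>

lemma prod_diam2_short:
  assumes d: "diam2 (prod_V fs) (prod_E fs)" and f: "\<forall>G\<in>set fs. factor G"
  shows "length fs \<le> 2"
proof (rule ccontr)
  assume "\<not> ?thesis"
  then have l: "3 \<le> length fs" by simp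
  define a where "a G = (SOME u. u \<in> fst G \<and> (\<exists>v\<in>fst G. snd G u v))" for G :: "int list graph"
  define b where "b G = (SOME v. v \<in> fst G \<and> snd G (a G) v)" for G :: "int list graph"
  have a: "a (fs ! i) \<in> fst (fs ! i) \<and> (\<exists>v\<in>fst (fs ! i). snd (fs ! i) (a (fs ! i)) v)" if "i < length fs" for i
    unfolding a_def by (rule someI_ex) (use f that in \<open>force simp: factor_def\<close>)
  have b: "b (fs ! i) \<in> fst (fs ! i) \<and> snd (fs ! i) (a (fs ! i)) (b (fs ! i))" if "i < length fs" for i
    unfolding b_def by (rule someI_ex) (use a[OF that] in blast)
  have ab: "a (fs ! i) \<noteq> b (fs ! i)" if "i < length fs" for i
    using f a[OF that] b[OF that] that unfolding factor_def by (metis nth_mem)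
  let ?x = "map a fs" and ?y = "map b fs"
  have V: "?x \<in> prod_V fs" "?y \<in> prod_V fs" using a b by (auto simp: prod_V_def)
  have eqF: False if "k < 3" "?x ! k = ?y ! k" for k using ab[of k] l that by simp
  from d V consider "?x = ?y" | "prod_E fs ?x ?y" | z where "prod_E fs ?x z" "prod_E fs z ?y"
    unfolding diam2_def by blast
  then show False
  proof cases
    case 1
    then have "?x ! 0 = ?y ! 0" by (rule arg_cong)
    then show ?thesis by (rule eqF[rotated]) simp
  next
    case 2
    then obtain i where i: "\<forall>j<length fs. j \<noteq> i \<longrightarrow> ?x ! j = ?y ! j" unfolding prod_E_def by blast
    have "\<exists>k<3. k \<noteq> i" by presburger
    then obtain k where k: "k < 3" "k \<noteq> i" by blast
    then have "?x ! k = ?y ! k" using i l by (meson order_less_le_trans)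
    then show ?thesis using eqF k by blast
  next
    case 3
    then obtain i j where ij: "\<forall>k<length fs. k \<noteq> i \<longrightarrow> ?x ! k = z ! k" "\<forall>k<length fs. k \<noteq> j \<longrightarrow> z ! k = ?y ! k"
      unfolding prod_E_def by blast
    have "\<exists>k<3. k \<noteq> i \<and> k \<noteq> j" by presburger
    then obtain k where k: "k < 3" "k \<noteq> i" "k \<noteq> j" by blast
    then have "k < length fs" using l by linarith
    then have "?x ! k = ?y ! k" using ij k by metis
    then show ?thesis using eqF k by blast
  qed
qed

text \<open>A path of length 2 between vertices differing in both coordinates moves each coordinate
  once, along an edge of its factor. An edge of the other factor supplies the second pair of
  distinct entries.\<close>

lemma prod_diam2_complete:
  assumes d: "diam2 (prod_V [G, H]) (prod_E [G, H])" and f: "factor G" "factor H"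
  shows "u \<in> fst G \<Longrightarrow> v \<in> fst G \<Longrightarrow> snd G u v \<longleftrightarrow> u \<noteq> v"
    and "u \<in> fst H \<Longrightarrow> v \<in> fst H \<Longrightarrow> snd H u v \<longleftrightarrow> u \<noteq> v"
proof -
  have step: "snd G u v \<and> snd H c e"
    if "u \<in> fst G" "v \<in> fst G" "c \<in> fst H" "e \<in> fst H" "u \<noteq> v" "c \<noteq> e" for u v c e
  proof -
    have V: "[u, c] \<in> prod_V [G, H]" "[v, e] \<in> prod_V [G, H]" using that unfolding prod_two by auto
    from d[unfolded diam2_def, rule_format, OF V]
    consider "[u, c] = [v, e]" | "prod_E [G, H] [u, c] [v, e]"
      | z where "z \<in> prod_V [G, H]" "prod_E [G, H] [u, c] z" "prod_E [G, H] z [v, e]"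
      by blast
    then show ?thesis
    proof cases
      case 3
      then obtain p q where z: "z = [p, q]" unfolding prod_two by blast
      show ?thesis using 3(2,3) that(5,6) unfolding z prod_two by blast
    qed (use that(5,6) in \<open>auto simp: prod_two\<close>)
  qed
  obtain u0 v0 where G: "u0 \<in> fst G" "v0 \<in> fst G" "u0 \<noteq> v0" using f(1) unfolding factor_def by metis
  obtain c0 e0 where H: "c0 \<in> fst H" "e0 \<in> fst H" "c0 \<noteq> e0" using f(2) unfolding factor_def by metis
  show "snd G u v \<longleftrightarrow> u \<noteq> v" if "u \<in> fst G" "v \<in> fst G"
    using step[OF that H(1,2) _ H(3)] f(1) that unfolding factor_def by blast
  show "snd H u v \<longleftrightarrow> u \<noteq> v" if "u \<in> fst H" "v \<in> fst H"
    using step[OF G(1,2) that G(3)] f(2) that unfolding factor_def by blast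
qed

lemma extends_model:
  assumes V: "rgraph V E" "x \<in> V" and iso: "graph_iso {y. E x y} (E_on E {y. E x y}) W F"
    and H: "rgraph (fst H) (snd H)" "h \<in> fst H"
    and W: "graph_iso W F {y. snd H h y} (E_on (snd H) {y. snd H h y})"
  shows "graph_iso V E (fst H) (snd H)"
proof -
  obtain f where f: "bij_betw f {y. E x y} {y. snd H h y}" "\<forall>y\<in>{y. E x y}. f y \<in> {y. snd H h y}"
    "\<forall>y\<in>{y. E x y}. \<forall>z\<in>{y. E x y}. E_on E {y. E x y} y z \<longleftrightarrow> E_on (snd H) {y. snd H h y} (f y) (f z)"
    using graph_iso_trans[OF iso W] by (rule graph_isoE)
  show ?thesis
    by (rule local_iso_extends[OF V(1) H(1) V(2) H(2) f(1)]) (use f(2,3) in \<open>auto simp: E_on_def\<close>)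
qed

lemma graph_iso_refl: "graph_iso V E V E"
  by (rule graph_isoI[of id]) auto

lemma model_johnson: "1 \<le> k \<Longrightarrow> k < n \<Longrightarrow> model (johnson n k)"
  and model_cocktail_party: "1 \<le> k \<Longrightarrow> model (cocktail_party k)"
  and model_halved_cube: "5 \<le> n \<Longrightarrow> model (halved_cube n)"
  and model_schlaefli: "model schlaefli"
  and model_gosset: "model gosset"
  unfolding model_def by blast+

lemma johnson_half:
  assumes "1 \<le> k" "k < n"
  obtains m where "1 \<le> m" "2 * m \<le> n" "graph_iso (fst (johnson n k)) (snd (johnson n k)) (fst (johnson n m)) (snd (johnson n m))"
proof (cases "2 * k \<le> n")
  case True
  then show thesis using that[of k] assms graph_iso_refl by blast
next
  case False
  then show thesis using that[of "n - k"] assms johnson_compl[of k n] by auto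
qed

context rgraph
begin

lemma cocktail_classified:
  assumes "finite V" "x \<in> V" "cocktail {y. E x y} (E_on E {y. E x y})" "E x a" "E x b" "E a b"
  shows "\<exists>H. model H \<and> graph_iso V E (fst H) (snd H)"
proof -
  have "\<exists>k\<ge>1. graph_iso V E (fst (cocktail_party k)) (snd (cocktail_party k))"
    by (rule cocktail_party_iso) (use assms(1,2) cocktail_local[OF assms(2-6)] E_sym E_neq in auto)
  then show ?thesis using model_cocktail_party by blast
qed

text \<open>The diameter of the local graph discards most models; each survivor is either a grid, a
  cocktail party graph, or the known local graph of another model, to which
  \<open>local_iso_extends\<close> applies.\<close>

lemma single_factor_classified:
  assumes fin: "finite V" and x: "x \<in> V" and con: "connected_graph {y. E x y} (E_on E {y. E x y})"
    and G: "factor G" and iso: "graph_iso {y. E x y} (E_on E {y. E x y}) (fst G) (snd G)"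
  shows "\<exists>H. model H \<and> graph_iso V E (fst H) (snd H)"
proof -
  have rg: "rgraph V E" by unfold_locales
  obtain f where f: "bij_betw f {y. E x y} (fst G)" "\<forall>y\<in>{y. E x y}. f y \<in> fst G"
    "\<forall>y\<in>{y. E x y}. \<forall>z\<in>{y. E x y}. E_on E {y. E x y} y z \<longleftrightarrow> snd G (f y) (f z)"
    using iso by (rule graph_isoE)
  obtain p q where pq: "p \<in> fst G" "q \<in> fst G" "snd G p q" using G unfolding factor_def by blast
  have "fst G = f ` {y. E x y}" using f(1) by (simp add: bij_betw_def)
  then obtain a b where a: "a \<in> {y. E x y}" "p = f a" and b: "b \<in> {y. E x y}" "q = f b" using pq by blast
  have "E_on E {y. E x y} a b" using f(3) a b pq(3) by simp
  then have ab: "E x a" "E x b" "E a b" by (simp_all add: E_on_def)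
  have d: "diam2 W F" if "graph_iso (fst G) (snd G) W F" for W F
    using diam2_iso[OF graph_iso_trans[OF iso that] local_diam2[OF con]] .
  have ck: ?thesis if "cocktail W F" "graph_iso (fst G) (snd G) W F" for W :: "int list set" and F
    using cocktail_classified[OF fin x cocktail_iso[OF graph_iso_trans[OF iso that(2)] that(1)] ab] .
  consider n k where "1 \<le> k" "k < n" "G = johnson n k" | k where "1 \<le> k" "G = cocktail_party k"
    | n where "5 \<le> n" "G = halved_cube n" | "G = schlaefli" | "G = gosset"
    using G unfolding factor_def model_def by blast
  then show ?thesis
  proof cases
    case 1
    obtain m where m: "1 \<le> m" "2 * m \<le> n" "graph_iso (fst G) (snd G) (fst (johnson n m)) (snd (johnson n m))"
      using johnson_half[OF 1(1,2)] 1(3) by metis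
    note iso' = graph_iso_trans[OF iso m(3)]
    \<comment> \<open>J(4,2) goes with the cocktail party graphs; its extension, the halved 4-cube,
      is CP(4). From \<open>m = 3\<close> on the diameter exceeds 2.\<close>
    consider "m = 1" | "m = 2" "n = 4" | "m = 2" "5 \<le> n" | "3 \<le> m" using m by linarith
    then show ?thesis
    proof cases
      case 1
      have "finite {y. E x y}" by (rule finite_subset[OF _ fin]) (use E_V in blast)
      moreover obtain h where h: "bij_betw h {y. E x y} (fst (johnson n m))"
        using iso' unfolding graph_iso_def by blast
      ultimately have "finite (fst (johnson n m))" "fst (johnson n m) \<noteq> {}"
        using bij_betw_finite[OF h] bij_betw_apply[OF h, of a] ab(1) by auto
      then have "grid (fst (johnson n m)) (snd (johnson n m))"
        by (rule complete_grid) (use johnson_1 1 in \<open>simp add: johnson_def\<close>)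
      then have "grid {y. E x y} (E_on E {y. E x y})" by (rule grid_iso[OF iso'])
      then show ?thesis using grid_johnson[OF rg x] model_johnson by blast
    next
      case 2
      then show ?thesis using ck[OF johnson_42_cocktail] m(3) by simp
    next
      case 3
      have "graph_iso V E (fst (halved_cube n)) (snd (halved_cube n))"
      proof (rule extends_model[OF rg x iso' halved_cube_rgraph])
        show "ind n {} \<in> fst (halved_cube n)"
          using ind_johnson[of "{}" n] by (simp add: halved_cube_def halved_cube_V_bits johnson_V_bits)
        show "graph_iso (fst (johnson n m)) (snd (johnson n m)) {y. snd (halved_cube n) (ind n {}) y}
            (E_on (snd (halved_cube n)) {y. snd (halved_cube n) (ind n {}) y})"
          unfolding halved_local 3(1) using graph_iso_refl by (simp add: johnson_def)
      qed
      then show ?thesis using model_halved_cube 3 by blast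
    next
      case 4
      then show ?thesis using johnson_not_diam2[of m n] m d by blast
    qed
  next
    case 2
    then show ?thesis using ck[OF cocktail_party_cocktail] graph_iso_refl by blast
  next
    case 3
    show ?thesis
    proof (cases "n = 5")
      case True
      have "graph_iso V E (fst schlaefli) (snd schlaefli)"
      proof (rule extends_model[OF rg x iso schlaefli_rgraph])
        show "u0 \<in> fst schlaefli" using schlaefli_u0 schlaefli_V by simp
        show "graph_iso (fst G) (snd G) {y. snd schlaefli u0 y} (E_on (snd schlaefli) {y. snd schlaefli u0 y})"
        proof (rule graph_isoI)
          show b: "bij_betw halved5_map (fst G) {y. snd schlaefli u0 y}"
            using schlaefli_local(1) 3(2) True by simp
          fix y z assume yz: "y \<in> fst G" "z \<in> fst G"
          then have "halved5_map y \<in> {y. snd schlaefli u0 y}" "halved5_map z \<in> {y. snd schlaefli u0 y}"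
            using bij_betw_apply[OF b] by blast+
          then show "snd G y z \<longleftrightarrow> E_on (snd schlaefli) {y. snd schlaefli u0 y} (halved5_map y) (halved5_map z)"
            using schlaefli_local(2) yz 3(2) True by (simp add: E_on_def)
        qed
      qed
      then show ?thesis using model_schlaefli by blast
    next
      case False
      then show ?thesis using halved_not_diam2[of n] d[OF graph_iso_refl] 3 by simp
    qed
  next
    case 4
    have "graph_iso V E (fst gosset) (snd gosset)"
    proof (rule extends_model[OF rg x iso gosset_rgraph])
      show "v0 \<in> fst gosset" using v0_gosset by (simp add: gosset_def)
      show "graph_iso (fst G) (snd G) {y. snd gosset v0 y} (E_on (snd gosset) {y. snd gosset v0 y})"
        unfolding 4 schlaefli_def fst_conv snd_conv by (rule graph_iso_refl)
    qed
    then show ?thesis using model_gosset by blast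
  next
    case 5
    then show ?thesis using gosset_not_diam2 d[OF graph_iso_refl] by simp
  qed
qed

lemma connected_local_classified:
  assumes fin: "finite V" and x: "x \<in> V" and con: "connected_graph {y. E x y} (E_on E {y. E x y})"
    and fs: "\<forall>G\<in>set fs. factor G" and iso: "graph_iso {y. E x y} (E_on E {y. E x y}) (prod_V fs) (prod_E fs)"
  shows "\<exists>H. model H \<and> graph_iso V E (fst H) (snd H)"
proof -
  have rg: "rgraph V E" by unfold_locales
  have d: "diam2 (prod_V fs) (prod_E fs)" using diam2_iso[OF iso local_diam2[OF con]] .
  have gr: ?thesis if "grid (prod_V fs) (prod_E fs)"
    using grid_johnson[OF rg x grid_iso[OF iso that]] model_johnson by blast
  have "length fs \<le> 2" using prod_diam2_short[OF d fs] .
  then consider "fs = []" | G where "fs = [G]" | G H where "fs = [G, H]"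
    by (cases fs; cases "tl fs") (auto simp: le_Suc_eq length_Suc_conv)
  then show ?thesis
  proof cases
    case 1
    \<comment> \<open>The empty product is a single vertex, the 1 by 1 grid; the graph itself is
      then the edge J(2,1).\<close>
    have "grid (prod_V fs) (prod_E fs)"
      by (rule complete_grid) (auto simp: 1 prod_V_def prod_E_def)
    then show ?thesis by (rule gr)
  next
    case 2
    have "graph_iso {y. E x y} (E_on E {y. E x y}) (fst G) (snd G)"
      using graph_iso_trans[OF iso[unfolded 2] graph_iso_sym[OF prod_single]] .
    then show ?thesis using single_factor_classified[OF fin x con] fs 2 by simp
  next
    case 3
    have f: "factor G" "factor H" using fs 3 by auto
    have "grid (prod_V fs) (prod_E fs)"
      unfolding 3
      by (rule prod_complete_grid) (use f prod_diam2_complete[OF d[unfolded 3] f] in \<open>auto simp: factor_def\<close>)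
    then show ?thesis by (rule gr)
  qed
qed

lemma factor_transfer:
  assumes fin: "finite V" and e: "E a b" and H: "model H" "graph_iso V E (fst H) (snd H)"
  shows "factor H"
proof -
  obtain f where f: "bij_betw f V (fst H)" "\<forall>y\<in>V. f y \<in> fst H" "\<forall>y\<in>V. \<forall>z\<in>V. E y z \<longleftrightarrow> snd H (f y) (f z)"
    using H(2) by (rule graph_isoE)
  have im: "fst H = f ` V" using f(1) by (simp add: bij_betw_def)
  have "finite (fst H)" using fin im by simp
  moreover have "\<not> snd H u u" if "u \<in> fst H" for u using that f(3) E_neq unfolding im by blast
  moreover have "\<exists>u\<in>fst H. \<exists>v\<in>fst H. snd H u v" using e E_V f(2,3) by blast
  ultimately show ?thesis using H(1) by (simp add: factor_def)
qed

end

text \<open>The induction stays within one vertex type, so local graphs and factors are subsets of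
  \<open>V\<close>. The local graph omits \<open>x\<close>, and each factor omits the neighbours in
  the other part, so all of them are smaller.\<close>

theorem rgraph_classification:
  fixes V :: "'a set"
  assumes "finite V" "rgraph V E"
  shows "\<exists>fs. (\<forall>G\<in>set fs. factor G) \<and> graph_iso V E (prod_V fs) (prod_E fs)"
  using assms
proof (induction "card V" arbitrary: V E rule: less_induct)
  case less
  interpret rgraph V E by fact
  have IH: "\<exists>fs. (\<forall>G\<in>set fs. factor G) \<and> graph_iso S (E_on E S) (prod_V fs) (prod_E fs)"
    if "S \<subset> V" "rgraph S (E_on E S)" for S
    by (rule less.hyps) (use that less.prems(1) finite_subset in \<open>auto intro: psubset_card_mono\<close>)
  obtain x where x: "x \<in> V" using conn unfolding connected_graph_def by blast
  let ?N = "{y. E x y}"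
  have N: "?N \<subset> V" using E_V E_neq x by blast
  show ?case
  proof (cases "?N = {}")
    case True
    have "v = x" if "v \<in> V" for v
      using x that
    proof (induction rule: connected_induct)
      case (step u w) then show ?case using True by blast
    qed simp
    then have V: "V = {x}" using x by blast
    \<comment> \<open>A single vertex is the product of no factors, as a \<open>factor\<close> must
      contain an edge.\<close>
    have "graph_iso V E (prod_V []) (prod_E [])"
    proof (rule graph_isoI)
      show "bij_betw (\<lambda>_. []) V (prod_V [])" by (auto simp: V bij_betw_def prod_V_def)
      show "E u v \<longleftrightarrow> prod_E [] [] []" if "u \<in> V" "v \<in> V" for u v
        using that V E_neq by (auto simp: prod_E_def)
    qed
    then show ?thesis by (intro exI[of _ "[]"]) simp
  next
    case False
    then obtain y where y: "E x y" by blast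
    show ?thesis
    proof (cases "connected_graph ?N (E_on E ?N)")
      case True
      obtain fs where "\<forall>G\<in>set fs. factor G" "graph_iso ?N (E_on E ?N) (prod_V fs) (prod_E fs)"
        using IH[OF N local_rgraph[OF True]] by blast
      then obtain H where H: "model H" "graph_iso V E (fst H) (snd H)"
        using connected_local_classified[OF less.prems(1) x True] by blast
      have "factor H" using factor_transfer[OF less.prems(1) y H] .
      then show ?thesis using graph_iso_trans[OF H(2) prod_single] by (intro exI[of _ "[H]"]) simp
    next
      case not_conn: False
      then obtain a b where ab: "a \<in> ?N" "b \<in> ?N" "\<nexists>n. walk ?N (E_on E ?N) n a b"
        using False unfolding connected_graph_def by blast
      \<comment> \<open>The component of \<open>a\<close> in the local graph; \<open>b\<close> lies
        in the rest, so both parts are nonempty and both factors are proper.\<close>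
      define C1 where "C1 = {z. \<exists>n. walk ?N (E_on E ?N) n a z}"
      define C2 where "C2 = ?N - C1"
      have C1N: "C1 \<subseteq> ?N" using walk_ends unfolding C1_def by fastforce
      have sep: "z \<in> C1" if z: "y \<in> C1" "E x z" "E y z" for y z
      proof -
        obtain n where n: "walk ?N (E_on E ?N) n a y" using z unfolding C1_def by blast
        have "y \<in> ?N" using walk_ends[OF n] by blast
        then have "walk ?N (E_on E ?N) 1 y z" using z by (simp add: E_on_def)
        then show ?thesis using walk_append[OF n] unfolding C1_def by blast
      qed
      interpret split_rgraph V E x C1 C2
      proof
        show "x \<in> V" by fact
        show "E x y \<longleftrightarrow> y \<in> C1 \<or> y \<in> C2" for y using C1N unfolding C2_def by blast
        show "y \<noteq> z \<and> \<not> E y z" if "y \<in> C1" "z \<in> C2" for y z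
          using sep that unfolding C2_def by blast
      qed
      have "walk ?N (E_on E ?N) 0 a a" using ab by simp
      then have "C1 \<noteq> {}" unfolding C1_def by blast
      moreover have "C2 \<noteq> {}" using ab unfolding C1_def C2_def by blast
      ultimately obtain fs gs where fs: "\<forall>G\<in>set fs. factor G" "graph_iso S1 (E_on E S1) (prod_V fs) (prod_E fs)"
        and gs: "\<forall>G\<in>set gs. factor G" "graph_iso S2 (E_on E S2) (prod_V gs) (prod_E gs)"
        using IH[OF S1_psubset rgraph_S1] IH[OF S2_psubset rgraph_S2] by metis
      have "graph_iso V E (prod_V (fs @ gs)) (prod_E (fs @ gs))"
      proof (rule graph_iso_append[OF factor_bij _ fs(2) gs(2)])
        fix u v assume uv: "u \<in> V" "v \<in> V"
        show "E u v \<longleftrightarrow> E_on E S1 (fst (c u x, c x u)) (fst (c v x, c x v)) \<and> snd (c u x, c x u) = snd (c v x, c x v) \<or>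
          fst (c u x, c x u) = fst (c v x, c x v) \<and> E_on E S2 (snd (c u x, c x u)) (snd (c v x, c x v))"
          unfolding edge_factors[OF uv] using c_S uv by (simp add: E_on_def)
      qed
      then show ?thesis using fs(1) gs(1) by (intro exI[of _ "fs @ gs"]) auto
    qed
  qed
qed

lemma model_allowed:
  assumes "model G"
  shows "allowed_factor G"
proof -
  consider n k where "k < n" "G = johnson n k" | k where "1 \<le> k" "G = cocktail_party k"
    | n where "5 \<le> n" "G = halved_cube n" | "G = schlaefli" | "G = gosset"
    using assms unfolding model_def by blast
  then show ?thesis
  proof cases
    case 1
    then have "k \<le> n" by simp
    then show ?thesis using 1 unfolding allowed_factor_def by blast
  next
    case 3
    then have "1 \<le> n" by simp
    then show ?thesis using 3 unfolding allowed_factor_def by blast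
  qed (use schlaefli_srg in \<open>unfold allowed_factor_def, blast+\<close>)
qed

theorem theorem2p16:
  fixes V :: "'a set" and E :: "'a \<Rightarrow> 'a \<Rightarrow> bool"
  assumes "finite V"
    and "simple_graph V E"
    and "connected_graph V E"
    and "reflective V E"
  shows "\<exists>fs :: int list graph list. fs \<noteq> [] \<and> (\<forall>G\<in>set fs. allowed_factor G) \<and>
           graph_iso V E (prod_V fs) (prod_E fs)"
proof -
  have "rgraph V E" using assms by unfold_locales
  then obtain fs where fs: "\<forall>G\<in>set fs. factor G" "graph_iso V E (prod_V fs) (prod_E fs)"
    using rgraph_classification assms(1) by blast
  have af: "\<forall>G\<in>set fs. allowed_factor G" using fs(1) model_allowed unfolding factor_def by blast
  show ?thesis
  proof (cases "fs = []")
    case True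
    \<comment> \<open>The list of factors must be nonempty, so the one-vertex graph is written as
      J(0,0), whose only vertex is the empty list.\<close>
    have pV: "prod_V [johnson 0 0] = {[[]]}"
      by (auto simp: prod_V_def johnson_def johnson_V_def length_Suc_conv)
    have pE: "\<not> prod_E [johnson 0 0] [[]] [[]]"
      by (simp add: prod_E_def johnson_def hdist_def)
    have "bij_betw (\<lambda>_. [[]]) (prod_V []) (prod_V [johnson 0 0])"
      unfolding pV by (auto simp: bij_betw_def prod_V_def)
    then have "graph_iso (prod_V []) (prod_E []) (prod_V [johnson 0 0]) (prod_E [johnson 0 0])"
      by (rule graph_isoI) (use pE in \<open>simp add: prod_E_def\<close>)
    then have "graph_iso V E (prod_V [johnson 0 0]) (prod_E [johnson 0 0])"
      using graph_iso_trans fs(2) True by blast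
    moreover have "allowed_factor (johnson 0 0)" unfolding allowed_factor_def by blast
    ultimately show ?thesis by (intro exI[of _ "[johnson 0 0]"]) simp
  next
    case False
    then show ?thesis using fs(2) af by blast
  qed
qed

end
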